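(* Let $\eta^3(\tau)\eta^3(7\tau)=\sum_{n\ge 1}a(n)q^n$ be the Fourier expansion of $\eta^3(\tau)\eta^3(7\tau)$, where $q=e^{2\pi i\tau}$. For any integer $n\ge 0$, $$A_{7,1}(n)=\frac{1}{8}\bigl(\sigma_{2,\chi_{7,4}}^*(n+2)-a(n+2)\bigr).$$
   Context: A partition is called $t$-core if none of its hook numbers (hook lengths) is a multiple of $t$ (the empty partition is $t$-core). A partition $k$-tuple of $n$ is an ordered $k$-tuple $(\lambda_1,\ldots,\lambda_k)$ of (possibly empty) partitions such that the sum of all the parts of all the $\lambda_i$ equals $n$. $A_{t,k}(n)$ denotes the number of partition $k$-tuples of $n$ in which each $\lambda_i$ is $t$-core; in particular $A_{7,1}(n)=A_7(n)$ is the number of $7$-core partitions of $n$. The Dedekind eta function is $\eta(\tau)=q^{1/24}\prod_{m\ge 1}(1-q^m)$ with $q=e^{2\pi i\tau}$, $\tau$ in the complex upper half plane, and $\eta^r(m\tau)$ means $(\eta(m\tau))^r$. $\chi_{7,4}$ is the Dirichlet character mod $7$ given by $\chi_{7,4}(n)=1$ if $n\equiv 1,2,4\pmod 7$, $\chi_{7,4}(n)=-1$ if $n\equiv 3,5,6\pmod 7$, and $\chi_{7,4}(n)=0$ if $\gcd(n,7)>1$. For $n\ge 1$, $\sigma_{2,\chi_{7,4}}^*(n)=\sum_{d\mid n}\chi_{7,4}(n/d)\,d^2$, the sum being over positive divisors $d$ of $n$. *)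

theory Defs
  imports "HOL-Analysis.Analysis"
begin

text \<open>A partition is the weakly decreasing list of its (positive) parts; the empty
  list is the empty partition.\<close>

definition is_partition :: "nat list \<Rightarrow> bool" where
  "is_partition l \<longleftrightarrow> sorted_wrt (\<ge>) l \<and> 0 \<notin> set l"

text \<open>Rows and columns of the Young diagram are numbered from \<open>0\<close>, so its cells are the
  pairs \<open>(i, j)\<close> with \<open>i < length l\<close> and \<open>j < l ! i\<close>. The hook length of a cell is
  arm + leg + 1.\<close>

definition hook_length :: "nat list \<Rightarrow> nat \<Rightarrow> nat \<Rightarrow> nat" where
  "hook_length l i j =
     (l ! i - Suc j) + card {k. i < k \<and> k < length l \<and> j < l ! k} + 1"

definition is_core :: "nat \<Rightarrow> nat list \<Rightarrow> bool" where
  "is_core t l \<longleftrightarrow> (\<forall>i < length l. \<forall>j < l ! i. \<not> t dvd hook_length l i j)"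

definition core_tuples :: "nat \<Rightarrow> nat \<Rightarrow> nat \<Rightarrow> nat list list set" where
  "core_tuples t k n =
     {ls. length ls = k \<and> (\<forall>l \<in> set ls. is_partition l \<and> is_core t l) \<and>
          (\<Sum>l\<leftarrow>ls. sum_list l) = n}"

definition A_core :: "nat \<Rightarrow> nat \<Rightarrow> nat \<Rightarrow> nat" where
  "A_core t k n = card (core_tuples t k n)"

text \<open>So the cardinality above never takes the default value for infinite sets.\<close>

lemma finite_core_tuples: "finite (core_tuples t k n)"
proof -
  let ?P = "{l. set l \<subseteq> {..n} \<and> length l \<le> n}"
  have len: "length l \<le> sum_list l" if "0 \<notin> set l" for l :: "nat list"
    using that by (induction l) auto
  have "core_tuples t k n \<subseteq> {ls. set ls \<subseteq> ?P \<and> length ls \<le> k}"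
  proof
    fix ls assume "ls \<in> core_tuples t k n"
    hence ls: "length ls = k" "\<forall>l \<in> set ls. is_partition l" "(\<Sum>l\<leftarrow>ls. sum_list l) = n"
      by (auto simp: core_tuples_def)
    have "l \<in> ?P" if l: "l \<in> set ls" for l
    proof -
      have le: "sum_list l \<le> n"
        using member_le_sum_list[of "sum_list l" "map sum_list ls"] l ls(3) by simp
      have "x \<le> n" if "x \<in> set l" for x
        using member_le_sum_list[OF that] le by simp
      moreover have "length l \<le> n"
        using len[of l] ls(2) l le by (auto simp: is_partition_def)
      ultimately show ?thesis by auto
    qed
    thus "ls \<in> {ls. set ls \<subseteq> ?P \<and> length ls \<le> k}" using ls(1) by auto
  qed
  moreover have "finite ?P" by (rule finite_lists_length_le) simp
  hence "finite {ls. set ls \<subseteq> ?P \<and> length ls \<le> k}" by (rule finite_lists_length_le)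
  ultimately show ?thesis by (rule finite_subset)
qed

definition qexp :: "complex \<Rightarrow> complex" where
  "qexp \<tau> = exp (2 * of_real pi * \<i> * \<tau>)"

text \<open>The factor \<open>q\<close> to the power \<open>1/24\<close> is read as \<open>exp (2 \<pi> i \<tau> / 24)\<close>; the
  definition is meant for \<open>\<tau>\<close> in the upper half plane, where the product converges.\<close>

definition dedekind_eta :: "complex \<Rightarrow> complex" where
  "dedekind_eta \<tau> = exp (2 * of_real pi * \<i> * \<tau> / 24) * (\<Prod>m. 1 - qexp \<tau> ^ Suc m)"

lemma dedekind_eta_converges:
  assumes "Im \<tau> > 0"
  shows "convergent_prod (\<lambda>m. 1 - qexp \<tau> ^ Suc m)"
proof -
  have "norm (qexp \<tau>) < 1"
    using assms by (simp add: qexp_def norm_exp_eq_Re)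
  hence "summable (\<lambda>m. norm (qexp \<tau>) ^ Suc m)"
    by (subst summable_Suc_iff) (simp add: summable_geometric)
  hence "summable (\<lambda>m. norm ((1 - qexp \<tau> ^ Suc m) - 1))"
    by (simp add: norm_power norm_mult)
  thus ?thesis
    by (intro abs_convergent_prod_imp_convergent_prod summable_imp_abs_convergent_prod)
qed

definition chi74 :: "int \<Rightarrow> int" where
  "chi74 n = (if n mod 7 \<in> {1, 2, 4} then 1 else if n mod 7 \<in> {3, 5, 6} then -1 else 0)"

definition sigma_star :: "nat \<Rightarrow> (int \<Rightarrow> int) \<Rightarrow> nat \<Rightarrow> int" where
  "sigma_star k \<psi> n = (\<Sum>d | d dvd n. \<psi> (int (n div d)) * int d ^ k)"

end

theory Submission
  imports Defs "HOL-Library.Nat_Bijection"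
begin

text \<open>
  Write \<open>(q)\<close> for the Euler product. A partition is a 7-core iff its beta-set is closed under
  subtracting \<open>7\<close>, so 7-cores correspond to vectors of seven integers with sum \<open>0\<close>. The resulting
  lattice sum is the constant term of a product of seven theta series, whence the generating function is
  \<open>(q\<^sup>7)\<^sup>7 / (q)\<close>. What remains is that
  \<open>8 q\<^sup>2 (q\<^sup>7)\<^sup>7 / (q) + q (q)\<^sup>3 (q\<^sup>7)\<^sup>3\<close> is the weight 3 Eisenstein series with coefficients
  \<open>sigma_star 2 chi74\<close>. This series is a sum of three values at \<open>q\<close>, \<open>q\<^sup>2\<close>, \<open>q\<^sup>4\<close> of the derivative
  of the Weierstrass function to the base \<open>q\<^sup>7\<close>, each of which is a product of theta functions. The same
  three products appear when the terms with exponent \<open>1\<close> modulo \<open>7\<close> are extracted from the fourth power of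
  the 7-dissection of \<open>(q)\<close>. On the other hand these terms are known, because the fourth power of the eta
  function is an eigenform of the Hecke operator at \<open>7\<close> (it is a theta series of the Eisenstein
  integers, where \<open>7\<close> splits).
\<close>

section \<open>Infinite products\<close>

text \<open>The link between the Eisenstein series and the two eta products is usually a dimension
  count for modular forms of weight 3. Here it is reduced to numerical identities for each
  \<open>q\<close> with 0 < |q| < 1; coefficients are compared only at the very end. The fourth
  power of the dissection is the right object because of a match of monomials. With a, b, c the
  theta values to the base q^7 at q, q^2, q^3, the derivative of the Weierstrass function
  contributes b/a^4, c/b^4, a/c^4. Multiplied by a b c, which is itself a product of Euler products,
  these become b^2 c/a^3, c^2 a/b^3, a^2 b/c^3, and these are precisely the nonconstant quartic
  monomials of exponent 1 modulo 7 in the dissection b/a - p c/b - p^2 + p^5 a/c. The factor 8 has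
  the same source: the constant monomials contribute 24 and 1, the Hecke relation contributes 7, and
  (24 + 1 + 7) / 4 = 8.\<close>

definition qpoch :: "complex \<Rightarrow> complex \<Rightarrow> complex" where
  "qpoch z q = (\<Prod>n. 1 - z * q ^ n)"

lemma summable_qpoch:
  fixes z q :: complex
  assumes "norm q < 1"
  shows "summable (\<lambda>n. norm (z * q ^ n))"
  using assms by (simp add: norm_mult norm_power summable_mult summable_geometric)

lemma convergent_prod_qpoch:
  fixes z q :: complex
  assumes "norm q < 1"
  shows "convergent_prod (\<lambda>n. 1 - z * q ^ n)"
proof (rule abs_convergent_prod_imp_convergent_prod, rule summable_imp_abs_convergent_prod)
  show "summable (\<lambda>n. norm ((1 - z * q ^ n) - 1))"
    using summable_qpoch[OF assms, of z] by simp
qed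

lemma qpoch_LIMSEQ:
  assumes "norm q < 1"
  shows "(\<lambda>N. \<Prod>n<N. 1 - z * q ^ n) \<longlonglongrightarrow> qpoch z q"
  using convergent_prod_LIMSEQ[OF convergent_prod_qpoch[OF assms, of z]]
  unfolding qpoch_def LIMSEQ_lessThan_iff_atMost .

lemma qpoch_nonzero:
  assumes "norm q < 1" "\<And>n. z * q ^ n \<noteq> 1"
  shows "qpoch z q \<noteq> 0"
  unfolding qpoch_def
  by (rule prodinf_nonzero[OF convergent_prod_qpoch[OF assms(1)]]) (use assms(2) in auto)

lemma qpoch_nonzero':
  assumes "norm q < 1" "norm z < 1"
  shows "qpoch z q \<noteq> 0"
proof (rule qpoch_nonzero[OF assms(1)])
  fix n
  have "norm (z * q ^ n) \<le> norm z * 1"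
    using assms by (simp add: norm_mult norm_power power_le_one mult_left_le)
  with assms(2) show "z * q ^ n \<noteq> 1" by (metis mult.right_neutral norm_one not_le)
qed

lemma qpoch_rec:
  assumes "norm q < 1"
  shows "qpoch z q = (1 - z) * qpoch (z * q) q"
proof (rule LIMSEQ_unique)
  show "(\<lambda>N. \<Prod>n<Suc N. 1 - z * q ^ n) \<longlonglongrightarrow> qpoch z q"
    using qpoch_LIMSEQ[OF assms] by (rule LIMSEQ_Suc)
  have "(\<lambda>N. (1 - z) * (\<Prod>n<N. 1 - (z * q) * q ^ n)) \<longlonglongrightarrow> (1 - z) * qpoch (z * q) q"
    by (intro tendsto_intros qpoch_LIMSEQ assms)
  thus "(\<lambda>N. \<Prod>n<Suc N. 1 - z * q ^ n) \<longlonglongrightarrow> (1 - z) * qpoch (z * q) q"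
    by (subst prod.lessThan_Suc_shift) (simp add: mult_ac)
qed

lemma prod_lessThan_mult:
  fixes f :: "nat \<Rightarrow> 'a :: comm_monoid_mult"
  shows "(\<Prod>n<N * m. f n) = (\<Prod>k<m. \<Prod>n<N. f (n * m + k))"
proof (induction N)
  case (Suc N)
  have "(\<Prod>n<Suc N * m. f n) = (\<Prod>n<N * m. f n) * (\<Prod>n=N * m..<N * m + m. f n)"
    using prod.atLeastLessThan_concat[of 0 "N * m" "N * m + m" f]
    by (simp add: atLeast0LessThan add.commute)
  also have "(\<Prod>n=N * m..<N * m + m. f n) = (\<Prod>k<m. f (N * m + k))"
    using prod.shift_bounds_nat_ivl[of f 0 "N * m" m] by (simp add: atLeast0LessThan add.commute)
  finally show ?case using Suc by (simp add: prod.distrib)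
qed simp

text \<open>Group the factors by the residue of the exponent modulo \<open>m\<close>. It is used
  with m = 3 for the pentagonal series and with m = 7 for the passage between the bases
  \<open>q\<close> and \<open>q ^ 7\<close>.\<close>

lemma qpoch_multisection:
  assumes "norm q < 1" "m > 0"
  shows "qpoch z q = (\<Prod>k<m. qpoch (z * q ^ k) (q ^ m))"
proof (rule LIMSEQ_unique)
  show "(\<lambda>N. \<Prod>n<N * m. 1 - z * q ^ n) \<longlonglongrightarrow> qpoch z q"
  proof -
    have "strict_mono (\<lambda>N. N * m)" using assms(2) by (simp add: strict_mono_def)
    from LIMSEQ_subseq_LIMSEQ[OF qpoch_LIMSEQ[OF assms(1)] this] show ?thesis
      by (simp add: o_def)
  qed
  have "norm (q ^ m) < 1"
    using assms by (simp add: norm_power power_less_one_iff)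
  hence "(\<lambda>N. \<Prod>k<m. \<Prod>n<N. 1 - (z * q ^ k) * (q ^ m) ^ n) \<longlonglongrightarrow> (\<Prod>k<m. qpoch (z * q ^ k) (q ^ m))"
    by (intro tendsto_prod qpoch_LIMSEQ)
  thus "(\<lambda>N. \<Prod>n<N * m. 1 - z * q ^ n) \<longlonglongrightarrow> (\<Prod>k<m. qpoch (z * q ^ k) (q ^ m))"
    by (simp add: prod_lessThan_mult power_add power_mult mult_ac flip: power_mult)
qed

text \<open>The Weierstrass M-test on a ball makes the partial products converge uniformly.
  Continuity is needed to evaluate the cofactor of the zero of theta at 1.\<close>

lemma isCont_qpoch:
  assumes "norm q < 1"
  shows "isCont (\<lambda>z. qpoch z q) z0"
proof -
  define A where "A = cball (0::complex) (norm z0 + 1)"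
  have "uniformly_convergent_on A (\<lambda>N z. \<Prod>n<N. 1 - z * q ^ n)"
  proof (rule uniformly_convergent_on_prod')
    show "uniformly_convergent_on A (\<lambda>N z. \<Sum>n<N. norm ((1 - z * q ^ n) - 1))"
    proof (rule Weierstrass_m_test')
      show "norm (norm ((1 - z * q ^ n) - 1)) \<le> (norm z0 + 1) * norm q ^ n" if "z \<in> A" for n z
        using that by (auto simp: A_def norm_mult norm_power intro!: mult_right_mono)
      show "summable (\<lambda>n. (norm z0 + 1) * norm q ^ n)"
        using assms by (intro summable_mult summable_geometric) auto
    qed
  qed (auto simp: A_def intro!: continuous_intros)
  then obtain l where l: "uniform_limit A (\<lambda>N z. \<Prod>n<N. 1 - z * q ^ n) l sequentially"
    by (auto simp: uniformly_convergent_on_def)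
  have "l z = qpoch z q" if "z \<in> A" for z
    using tendsto_uniform_limitI[OF l that] qpoch_LIMSEQ[OF assms, of z] by (rule LIMSEQ_unique)
  hence "continuous_on A (\<lambda>z. qpoch z q) \<longleftrightarrow> continuous_on A l"
    by (intro continuous_on_cong) auto
  moreover have "continuous_on A l"
    by (rule uniform_limit_theorem[OF _ l]) (auto intro!: always_eventually continuous_intros)
  ultimately have "continuous_on A (\<lambda>z. qpoch z q)" by simp
  hence "continuous_on (ball 0 (norm z0 + 1)) (\<lambda>z. qpoch z q)"
    by (rule continuous_on_subset) (auto simp: A_def)
  thus ?thesis by (subst (asm) continuous_on_eq_continuous_at) auto
qed

text \<open>Dominated convergence for sums over the integers: the enumeration
  \<open>int_decode\<close> reduces it to Tannery's theorem, and absolute convergence makes the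
  choice of enumeration irrelevant.\<close>

lemma tendsto_infsum_int:
  fixes a :: "int \<Rightarrow> 'b \<Rightarrow> complex"
  assumes lim: "\<And>k. ((\<lambda>n. a k n) \<longlongrightarrow> b k) F"
    and bound: "eventually (\<lambda>n. \<forall>k. norm (a k n) \<le> M k) F"
    and M: "M summable_on UNIV" and F: "F \<noteq> bot"
  shows "((\<lambda>n. infsum (\<lambda>k. a k n) UNIV) \<longlongrightarrow> infsum b UNIV) F"
proof -
  have bij: "bij int_decode" by (rule bij_int_decode)
  have infsum_eq: "infsum f UNIV = (\<Sum>n. f (int_decode n))"
    if "summable (\<lambda>n. norm (f (int_decode n)))" for f :: "int \<Rightarrow> complex"
  proof -
    have "((\<lambda>n. f (int_decode n)) has_sum (\<Sum>n. f (int_decode n))) UNIV"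
      by (rule norm_summable_imp_has_sum[OF that summable_sums[OF summable_norm_cancel[OF that]]])
    hence "(f has_sum (\<Sum>n. f (int_decode n))) UNIV"
      using has_sum_reindex_bij_betw[OF bij] by blast
    thus ?thesis by (rule infsumI)
  qed
  have M': "summable (\<lambda>n. M (int_decode n))"
    using summable_on_reindex_bij_betw[OF bij, of M] M
    by (intro summable_on_imp_summable) (simp add: o_def)
  have T: "eventually (\<lambda>n. summable (\<lambda>k. norm (a (int_decode k) n))) F \<and>
           summable (\<lambda>n. norm (b (int_decode n))) \<and>
           ((\<lambda>n. suminf (\<lambda>k. a (int_decode k) n)) \<longlongrightarrow> suminf (\<lambda>k. b (int_decode k))) F"
  proof (rule tannerys_theorem[OF lim _ M' F])
    show "eventually (\<lambda>(k, n). norm (a (int_decode k) n) \<le> M (int_decode k)) (at_top \<times>\<^sub>F F)"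
      unfolding eventually_prod_filter
      by (rule exI[of _ "\<lambda>_. True"], rule exI[of _ "\<lambda>n. \<forall>k. norm (a k n) \<le> M k"])
         (use bound in auto)
  qed
  show ?thesis
    unfolding infsum_eq[OF conjunct1[OF conjunct2[OF T]]]
  proof (rule Lim_transform_eventually[OF conjunct2[OF conjunct2[OF T]]])
    show "eventually (\<lambda>n. suminf (\<lambda>k. a (int_decode k) n) = infsum (\<lambda>k. a k n) UNIV) F"
      using conjunct1[OF T] by eventually_elim (simp add: infsum_eq)
  qed
qed

section \<open>Triangular exponents and Gaussian binomials\<close>

definition tri :: "int \<Rightarrow> int" where "tri n = n * (n - 1) div 2"

lemma two_tri: "2 * tri n = n * (n - 1)"
  unfolding tri_def by simp

lemma tri_Suc: "tri (n + 1) = tri n + n"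
  using two_tri[of n] two_tri[of "n + 1"] by (simp add: algebra_simps)

lemma tri_refl: "tri (1 - n) = tri n"
  using two_tri[of n] two_tri[of "1 - n"] by (simp add: algebra_simps)

lemma tri_0 [simp]: "tri 0 = 0" "tri 1 = 0"
  by (simp_all add: tri_def)

text \<open>Defined by the q-Pascal rule instead of a quotient of q-factorials, so that roots of
  unity need not be excluded.\<close>

fun gauss_binomial :: "complex \<Rightarrow> nat \<Rightarrow> nat \<Rightarrow> complex" where
  "gauss_binomial q n 0 = 1"
| "gauss_binomial q 0 (Suc k) = 0"
| "gauss_binomial q (Suc n) (Suc k) = gauss_binomial q n k + q ^ Suc k * gauss_binomial q n (Suc k)"

lemma gauss_binomial_eq_0: "n < k \<Longrightarrow> gauss_binomial q n k = 0"
  by (induction q n k rule: gauss_binomial.induct) auto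

text \<open>Induction splits off the first factor \<open>1 + x\<close> and applies the hypothesis to
  \<open>x * q\<close>; matching coefficients is the q-Pascal rule.\<close>

lemma gauss_binomial_theorem:
  assumes "q \<noteq> 0"
  shows "(\<Prod>k<n. 1 + x * q ^ k) = (\<Sum>i\<le>n. gauss_binomial q n i * q powi tri (int i) * x ^ i)"
proof (induction n arbitrary: x)
  case (Suc n)
  let ?c = "\<lambda>i. gauss_binomial q n i * q powi tri (int i)"
  have step: "gauss_binomial q (Suc n) (Suc i) * q powi tri (int (Suc i)) * x ^ Suc i =
      ?c (Suc i) * (x * q) ^ Suc i + x * (?c i * (x * q) ^ i)" for i
  proof -
    have "q powi tri (int (Suc i)) = q powi tri (int i) * q ^ i"
      using tri_Suc[of "int i"] assms by (simp add: power_int_add add.commute)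
    thus ?thesis by (simp add: algebra_simps power_mult_distrib)
  qed
  have "(\<Prod>k<Suc n. 1 + x * q ^ k) = (1 + x) * (\<Prod>k<n. 1 + (x * q) * q ^ k)"
    by (subst prod.lessThan_Suc_shift) (simp add: mult_ac)
  also have "\<dots> = (\<Sum>i\<le>n. ?c i * (x * q) ^ i) + x * (\<Sum>i\<le>n. ?c i * (x * q) ^ i)"
    by (simp only: Suc distrib_right mult_1_left)
  also have "\<dots> = 1 + (\<Sum>i\<le>n. ?c (Suc i) * (x * q) ^ Suc i) + x * (\<Sum>i\<le>n. ?c i * (x * q) ^ i)"
  proof -
    have "(\<Sum>i\<le>n. ?c i * (x * q) ^ i) = (\<Sum>i\<le>Suc n. ?c i * (x * q) ^ i)"
      by (simp add: gauss_binomial_eq_0)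
    also have "\<dots> = 1 + (\<Sum>i\<le>n. ?c (Suc i) * (x * q) ^ Suc i)"
      by (subst sum.atMost_Suc_shift) simp
    finally have S: "(\<Sum>i\<le>n. ?c i * (x * q) ^ i) = 1 + (\<Sum>i\<le>n. ?c (Suc i) * (x * q) ^ Suc i)" .
    show ?thesis by (simp only: S)
  qed
  also have "\<dots> = 1 + (\<Sum>i\<le>n. gauss_binomial q (Suc n) (Suc i) * q powi tri (int (Suc i)) * x ^ Suc
      i)"
    unfolding step sum.distrib sum_distrib_left by simp
  also have "\<dots> = (\<Sum>i\<le>Suc n. gauss_binomial q (Suc n) i * q powi tri (int i) * x ^ i)"
    by (subst sum.atMost_Suc_shift) simp
  finally show ?case .
qed simp

text \<open>The quotient formula with denominators cleared. The Pascal step amounts to 1 - q^(k+l) =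
  (1 - q^k) + q^k (1 - q^l).\<close>

lemma gauss_binomial_formula:
  "gauss_binomial q (k + l) k * (\<Prod>j<k. 1 - q * q ^ j) * (\<Prod>j<l. 1 - q * q ^ j) = (\<Prod>j<k + l. 1
      - q * q ^ j)"
proof (induction "k + l" arbitrary: k l)
  case (Suc n)
  let ?f = "\<lambda>n. \<Prod>j<n. 1 - q * q ^ j"
  consider "k = 0" | k' where "k = Suc k'" "l = 0" | k' l' where "k = Suc k'" "l = Suc l'"
    by (meson not0_implies_Suc)
  thus ?case
  proof cases
    case 2
    have "gauss_binomial q k' k' * ?f k' = ?f k'"
      using Suc(1)[of k' 0] Suc(2) 2 by simp
    hence "gauss_binomial q k' k' * ?f k' * (1 - q * q ^ k') = ?f k' * (1 - q * q ^ k')" by simp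
    thus ?thesis using 2 by (simp only: add_0_right gauss_binomial.simps prod.lessThan_Suc)
      (simp add: gauss_binomial_eq_0 mult_ac)
  next
    case 3
    have A: "gauss_binomial q (k' + Suc l') k' * ?f k' * ?f (Suc l') = ?f (k' + Suc l')"
      using Suc(1)[of k' "Suc l'"] Suc(2) 3 by simp
    have B: "gauss_binomial q (k' + Suc l') (Suc k') * ?f (Suc k') * ?f l' = ?f (k' + Suc l')"
      using Suc(1)[of "Suc k'" l'] Suc(2) 3 by simp
    have "gauss_binomial q (k + l) k * ?f k * ?f l =
       (gauss_binomial q (k' + Suc l') k' * ?f k' * ?f (Suc l')) * (1 - q ^ Suc k') +
       q ^ Suc k' * (1 - q ^ Suc l') * (gauss_binomial q (k'
           + Suc l') (Suc k') * ?f (Suc k') * ?f l')"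
      using 3 by (simp add: algebra_simps)
    also have "\<dots> = ?f (k' + Suc l') * (1 - q ^ Suc k' * q ^ Suc l')"
      unfolding A B by (simp add: algebra_simps)
    also have "\<dots> = ?f (k + l)" using 3 by (simp add: power_add algebra_simps)
    finally show ?thesis .
  qed simp
qed simp

section \<open>The Jacobi triple product and its consequences\<close>

lemma summable_on_int:
  fixes f :: "int \<Rightarrow> real"
  assumes "summable (\<lambda>n. f (int n))" "summable (\<lambda>n. f (- int n))" "\<And>n. f n \<ge> 0"
  shows "f summable_on UNIV"
proof -
  have 1: "f summable_on range int"
    using summable_nonneg_imp_summable_on[OF assms(1)] assms(3)
    by (subst summable_on_reindex) (auto simp: o_def)
  have 2: "f summable_on range (\<lambda>n. - int n)"
    using summable_nonneg_imp_summable_on[OF assms(2)] assms(3)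
    by (subst summable_on_reindex) (auto simp: o_def inj_def)
  have "range int \<union> range (\<lambda>n. - int n) = UNIV"
  proof -
    have "x \<in> range int \<union> range (\<lambda>n. - int n)" for x
      by (cases x rule: int_cases2) auto
    thus ?thesis by blast
  qed
  with summable_on_union[OF 1 2] show ?thesis by simp
qed

text \<open>The ratio \<open>C * x ^ n\<close> of successive terms tends to 0 whatever
  \<open>C\<close> is: a quadratic exponent beats every geometric factor.\<close>

lemma summable_ratio_power:
  fixes f :: "nat \<Rightarrow> real"
  assumes x: "0 \<le> x" "x < 1" and step: "\<And>n. f (Suc n) = C * x ^ n * f n"
  shows "summable f"
proof -
  have "(\<lambda>n. \<bar>C\<bar> * x ^ n) \<longlonglongrightarrow> \<bar>C\<bar> * 0"
    by (intro tendsto_intros LIMSEQ_realpow_zero x)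
  hence "eventually (\<lambda>n. \<bar>C\<bar> * x ^ n < 1 / 2) sequentially"
    by (intro order_tendstoD) auto
  then obtain N where N: "\<And>n. n \<ge> N \<Longrightarrow> \<bar>C\<bar> * x ^ n < 1 / 2"
    by (auto simp: eventually_sequentially)
  show ?thesis
  proof (rule summable_ratio_test[of "1 / 2" N])
    fix n assume "n \<ge> N"
    have "norm (f (Suc n)) = (\<bar>C\<bar> * x ^ n) * norm (f n)"
      using x by (simp add: step abs_mult)
    also have "\<dots> \<le> 1 / 2 * norm (f n)"
      using N[OF \<open>n \<ge> N\<close>] by (intro mult_right_mono) auto
    finally show "norm (f (Suc n)) \<le> 1 / 2 * norm (f n)" .
  qed simp
qed

lemma summable_powi_tri:
  fixes x y :: real
  assumes x: "0 < x" "x < 1" and y: "y > 0"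
  shows "(\<lambda>n. x powi tri n * y powi n) summable_on UNIV"
proof (rule summable_on_int)
  show "summable (\<lambda>n. x powi tri (int n) * y powi int n)"
  proof (rule summable_ratio_power[of x _ y])
    fix n
    have "x powi tri (int (Suc n)) = x powi tri (int n) * x ^ n"
      using tri_Suc[of "int n"] x by (simp add: power_int_add add.commute)
    thus "x powi tri (int (Suc n)) * y powi int (Suc n)
        = y * x ^ n * (x powi tri (int n) * y powi int n)"
      by (simp add: power_int_add y)
  qed (use x in auto)
  show "summable (\<lambda>n. x powi tri (- int n) * y powi (- int n))"
  proof (rule summable_ratio_power[of x _ "x / y"])
    fix n
    have "tri (- int (Suc n)) = tri (- int n) + int n + 1"
      using tri_Suc[of "- int (Suc n)"] by simp
    hence "x powi tri (- int (Suc n)) = x powi tri (- int n) * x ^ n * x"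
      using x by (simp add: power_int_add)
    moreover have "y powi (- int (Suc n)) = y powi (- int n) / y"
    proof -
      have e: "- int (Suc n) = - int n - 1" by simp
      show ?thesis unfolding e by (subst power_int_diff) (use y in auto)
    qed
    ultimately show "x powi tri (- int (Suc n)) * y powi (- int (Suc n)) =
        x / y * x ^ n * (x powi tri (- int n) * y powi (- int n))"
      by (simp only: times_divide_eq_right mult_ac times_divide_eq_left)
  qed (use x in auto)
qed (use x y in auto)

definition theta_coeff :: "complex \<Rightarrow> int \<Rightarrow> complex" where
  "theta_coeff q n = (- 1) powi n * q powi tri n"

text \<open>Normalised so that, for 0 < |q| < 1, its zeros are the integer powers of
  \<open>q\<close>; in particular it vanishes at \<open>z = 1\<close>, where the limits in
  \<open>z\<close> are taken.\<close>

definition theta :: "complex \<Rightarrow> complex \<Rightarrow> complex" where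
  "theta q z = (\<Sum>\<^sub>\<infinity>n. theta_coeff q n * z powi n)"

lemma norm_theta_coeff: "norm (theta_coeff q n) = norm q powi tri n"
  by (simp add: theta_coeff_def norm_mult norm_power_int)

lemma theta_coeff_shift: "q \<noteq> 0 \<Longrightarrow> theta_coeff q (n + 1) = - (q powi n) * theta_coeff q n"
  by (simp only: theta_coeff_def tri_Suc) (simp add: power_int_add)

lemma theta_coeff_refl: "theta_coeff q (1 - n) = - theta_coeff q n"
  by (simp only: theta_coeff_def tri_refl power_int_minus_one_diff_commute[of 1 n]) (simp add:
      power_int_diff)

lemma abs_summable_theta_coeff:
  assumes "norm q < 1" "q \<noteq> 0" "z \<noteq> 0"
  shows "(\<lambda>n. norm (theta_coeff q n * z powi n)) summable_on UNIV"
  using summable_powi_tri[of "norm q" "norm z"] assms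
  by (simp add: norm_mult norm_theta_coeff norm_power_int)

lemma theta_has_sum:
  assumes "norm q < 1" "q \<noteq> 0" "z \<noteq> 0"
  shows "((\<lambda>n. theta_coeff q n * z powi n) has_sum theta q z) UNIV"
  unfolding theta_def by (rule has_sum_infsum, rule abs_summable_summable, rule
      abs_summable_theta_coeff[OF assms])

lemma prod_powi_tri:
  assumes "q \<noteq> (0 :: complex)"
  shows "(\<Prod>k<N. q ^ Suc k) = q powi tri (int N + 1)"
proof (induction N)
  case (Suc N)
  have "q powi tri (int (Suc N) + 1) = q powi (tri (int N + 1) + (int N + 1))"
    using tri_Suc[of "int N + 1"] by (simp add: add_ac)
  also have "\<dots> = q powi tri (int N + 1) * q powi int (Suc N)"
    using assms by (subst power_int_add) (auto simp: add_ac)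
  also have "q powi int (Suc N) = q ^ Suc N" by (rule power_int_of_nat)
  finally show ?case using Suc by simp
qed simp

text \<open>The q-binomial theorem with 2 N factors at \<open>x = - z / q ^ N\<close>: the upper N
  factors are those in \<open>z\<close>; the lower N, read backwards, become those in
  \<open>q / z\<close> once \<open>(- z) / q ^ Suc k\<close> is pulled out of each. The constant
  \<open>c\<close> collects what is pulled out.\<close>

lemma finite_jacobi_triple_product:
  assumes q: "q \<noteq> 0" and z: "z \<noteq> 0"
  shows "(\<Prod>k<N. 1 - z * q ^ k) * (\<Prod>k<N. 1 - q / z * q ^ k) =
    (\<Sum>i\<le>2 * N. gauss_binomial q (2 * N) i * (theta_coeff q (int i - int N) * z powi (int i
        - int N)))"
proof -
  define x where "x = - z / q ^ N"
  define c where "c = (- z) ^ N / q powi tri (int N + 1)"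
  have c0: "c \<noteq> 0" using q z by (simp add: c_def)
  have "(\<Prod>k<2 * N. 1 + x * q ^ k) = (\<Prod>k<N. 1 + x * q ^ k) * (\<Prod>k=N..<N + N. 1 + x * q ^ k)"
    using prod.atLeastLessThan_concat[of 0 N "N + N" "\<lambda>k. 1 + x * q ^ k"]
    by (simp add: atLeast0LessThan mult_2)
  also have "(\<Prod>k=N..<N + N. 1 + x * q ^ k) = (\<Prod>k<N. 1 - z * q ^ k)"
    using prod.shift_bounds_nat_ivl[of "\<lambda>k. 1 + x * q ^ k" 0 N N] q
    by (simp add: atLeast0LessThan x_def power_add)
  also have "(\<Prod>k<N. 1 + x * q ^ k) = (\<Prod>k<N. 1 + x * q ^ (N - Suc k))"
    by (rule prod.nat_diff_reindex[symmetric])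
  also have "\<dots> = (\<Prod>k<N. (- z) / q ^ Suc k * (1 - q / z * q ^ k))"
  proof (rule prod.cong)
    fix k assume "k \<in> {..<N}"
    hence "q ^ N = q ^ Suc k * q ^ (N - Suc k)"
      by (metis lessThan_iff Suc_leI le_add_diff_inverse power_add)
    thus "1 + x * q ^ (N - Suc k) = (- z) / q ^ Suc k * (1 - q / z * q ^ k)"
      using q z by (simp add: x_def field_simps)
  qed simp
  also have "\<dots> = c * (\<Prod>k<N. 1 - q / z * q ^ k)"
    by (simp only: prod.distrib prod_dividef prod_powi_tri[OF q] c_def prod_constant card_lessThan)
  finally have "c * ((\<Prod>k<N. 1 - z * q ^ k) * (\<Prod>k<N. 1 - q / z * q ^ k)) =
      (\<Sum>i\<le>2 * N. gauss_binomial q (2 * N) i * q powi tri (int i) * x ^ i)"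
    using gauss_binomial_theorem[OF q, where n = "2 * N" and x = x] by (simp add: mult_ac)
  also have "\<dots> = (\<Sum>i\<le>2 * N. c * (gauss_binomial q (2 * N) i * (theta_coeff q (int i
      - int N) * z powi (int i - int N))))"
  proof (rule sum.cong)
    fix i
    have e: "tri (int i - int N) = tri (int i) + tri (int N + 1) - int N * int i"
      using two_tri[of "int i - int N"] two_tri[of "int i"] two_tri[of "int N + 1"]
      by (simp add: algebra_simps)
    have "c * (theta_coeff q (int i - int N) * z powi (int i - int N)) =
       c * ((- z) powi (int i - int N) * q powi tri (int i - int N))"
      by (simp add: theta_coeff_def power_int_minus_left_distrib[of _ z] mult_ac)
    also have "\<dots> = (c / ((- z) ^ N) * q powi tri (int N
        + 1)) * ((- z) ^ i * q powi tri (int i) / q ^ (N * i))"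
      using q z unfolding e by (simp add: power_int_diff power_int_add flip: of_nat_mult)
    also have "c / ((- z) ^ N) * q powi tri (int N + 1) = 1"
      using q z by (simp add: c_def)
    also have "1 * ((- z) ^ i * q powi tri (int i) / q ^ (N * i)) = q powi tri (int i) * x ^ i"
      unfolding x_def by (simp only: power_divide power_mult) simp
    finally show "gauss_binomial q (2 * N) i * q powi tri (int i) * x ^ i =
       c * (gauss_binomial q (2 * N) i * (theta_coeff q (int i - int N) * z powi (int i - int N)))"
      by (simp add: mult_ac)
  qed simp
  finally show ?thesis using c0 by (simp flip: sum_distrib_left)
qed

text \<open>Let N tend to infinity in the finite version. The central Gaussian binomials tend to
  \<open>1 / qpoch q q\<close> and are bounded uniformly in both indices, so dominated convergence
  applies.\<close>

theorem jacobi_triple_product: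
  assumes q: "norm q < 1" "q \<noteq> 0" and z: "z \<noteq> 0"
  shows "theta q z = qpoch q q * (qpoch z q * qpoch (q / z) q)"
proof -
  define f where "f n = (\<Prod>j<n. 1 - q * q ^ j)" for n
  define L where "L = qpoch q q"
  have f_lim: "f \<longlonglongrightarrow> L"
    using qpoch_LIMSEQ[OF q(1), of q] by (simp add: f_def[abs_def] L_def)
  have L0: "L \<noteq> 0" unfolding L_def using q by (intro qpoch_nonzero')
  have f0: "f n \<noteq> 0" for n
  proof -
    have "q * q ^ j \<noteq> 1" for j
      using power_less_one_iff[of "norm q" "Suc j"] q
      by (metis nat.simps(3) norm_one norm_power order_less_irrefl power_Suc norm_ge_zero
          zero_less_Suc)
    thus ?thesis by (auto simp: f_def)
  qed
  obtain B where B: "\<And>n. norm (f n) \<le> B"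
    using convergent_imp_Bseq[of f] f_lim by (auto simp: convergent_def Bseq_def)
  have "(\<lambda>n. inverse (f n)) \<longlonglongrightarrow> inverse L"
    by (intro tendsto_intros f_lim L0)
  then obtain B' where B': "\<And>n. norm (inverse (f n)) \<le> B'"
    using convergent_imp_Bseq[of "\<lambda>n. inverse (f n)"] by (auto simp: convergent_def Bseq_def)
  \<comment> \<open>Extension by 0 turns the finite sums into sums over all integers with a common
    majorant.\<close>
  define G where "G k N = (if \<bar>k\<bar> \<le> int N then gauss_binomial q (2 * N) (nat (k
      + int N)) else 0)" for k N
  have G_eq: "G k N = f (2 * N) * inverse (f (nat (int N + k))) * inverse (f (nat (int N - k)))"
    if "\<bar>k\<bar> \<le> int N" for k N
  proof -
    have "nat (k + int N) + nat (int N - k) = 2 * N" using that by linarith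
    with gauss_binomial_formula[of q "nat (k + int N)" "nat (int N - k)"]
    have "G k N * f (nat (int N + k)) * f (nat (int N - k)) = f (2 * N)"
      using that by (simp add: f_def G_def add.commute)
    thus ?thesis using f0[of "nat (int N + k)"] f0[of "nat (int N - k)"] by (auto simp: field_simps)
  qed
  have "B \<ge> 0" "B' \<ge> 0"
    using order_trans[OF norm_ge_zero B[of 0]] order_trans[OF norm_ge_zero B'[of 0]] by auto
  have G_bound: "norm (G k N) \<le> B * B' * B'" for k N
  proof (cases "\<bar>k\<bar> \<le> int N")
    case True
    show ?thesis unfolding G_eq[OF True] norm_mult
      using \<open>B \<ge> 0\<close> \<open>B' \<ge> 0\<close> by (intro mult_mono B B' mult_nonneg_nonneg) auto
  qed (use \<open>B \<ge> 0\<close> \<open>B' \<ge> 0\<close> in \<open>auto simp: G_def\<close>)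
  have G_lim: "(\<lambda>N. G k N) \<longlonglongrightarrow> L * inverse L * inverse L" for k
  proof (rule Lim_transform_eventually)
    show "eventually (\<lambda>N. f (2 * N) * inverse (f (nat (int N + k))) * inverse (f (nat (int N - k)))
        = G k N) sequentially"
      using eventually_ge_at_top[of "nat \<bar>k\<bar>"] by eventually_elim (rule G_eq[symmetric], linarith)
    have a: "filterlim (\<lambda>N. 2 * N) sequentially (sequentially :: nat filter)"
      by (rule filterlim_subseq) (simp add: strict_mono_def)
    have b: "filterlim (\<lambda>N. nat (int N + m)) sequentially (sequentially :: nat filter)" for m
      unfolding filterlim_at_top
    proof safe
      fix Z show "eventually (\<lambda>N. Z \<le> nat (int N + m)) sequentially"
        using eventually_ge_at_top[of "Z + nat \<bar>m\<bar>"] by eventually_elim linarith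
    qed
    show "(\<lambda>N. f (2 * N) * inverse (f (nat (int N + k))) * inverse (f (nat (int N - k))))
           \<longlonglongrightarrow> L * inverse L * inverse L"
      using b[of "- k"] by (intro tendsto_intros L0 filterlim_compose[OF f_lim] a b) simp
  qed
  have "(\<lambda>N. \<Sum>\<^sub>\<infinity>k. G k N * (theta_coeff q k * z powi k)) \<longlonglongrightarrow>
        (\<Sum>\<^sub>\<infinity>k. L * inverse L * inverse L * (theta_coeff q k * z powi k))"
  proof (rule tendsto_infsum_int)
    show "(\<lambda>N. G k N * (theta_coeff q k * z powi k)) \<longlonglongrightarrow> L * inverse L * inverse L * (theta_coeff q k
        * z powi k)" for k
      by (intro tendsto_intros G_lim)
    show "eventually (\<lambda>N. \<forall>k. norm (G k N * (theta_coeff q k * z powi k)) \<le>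
            B * B' * B' * norm (theta_coeff q k * z powi k)) sequentially"
      using G_bound by (auto simp: norm_mult[of "G _ _"] intro!: always_eventually mult_right_mono)
    show "(\<lambda>k. B * B' * B' * norm (theta_coeff q k * z powi k)) summable_on UNIV"
      by (intro summable_on_cmult_right abs_summable_theta_coeff q z)
  qed simp
  moreover have "(\<Sum>\<^sub>\<infinity>k. G k N * (theta_coeff q k * z powi k)) = (\<Prod>k<N. 1 - z * q ^ k) * (\<Prod>k<N. 1
      - q / z * q ^ k)" for N
  proof -
    have "(\<Sum>\<^sub>\<infinity>k. G k N * (theta_coeff q k * z powi k))
        = (\<Sum>\<^sub>\<infinity>k\<in>{-int N..int N}. G k N * (theta_coeff q k * z powi k))"
      by (rule infsum_cong_neutral) (auto simp: G_def)
    also have "\<dots> = (\<Sum>k\<in>{-int N..int N}. G k N * (theta_coeff q k * z powi k))" by simp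
    also have "\<dots> = (\<Sum>i\<le>2 * N. gauss_binomial q (2 * N) i * (theta_coeff q (int i
        - int N) * z powi (int i - int N)))"
      by (rule sum.reindex_bij_witness[of _ "\<lambda>i. int i - int N"
          "\<lambda>k. nat (k + int N)"]) (auto simp: G_def)
    finally show ?thesis by (simp only: finite_jacobi_triple_product[OF q(2) z])
  qed
  ultimately have "(\<lambda>N. (\<Prod>k<N. 1 - z * q ^ k) * (\<Prod>k<N. 1 - q / z * q ^ k)) \<longlonglongrightarrow>
      inverse L * theta q z"
    using L0 by (simp add: theta_def infsum_cmult_right')
  moreover have "(\<lambda>N. (\<Prod>k<N. 1 - z * q ^ k) * (\<Prod>k<N. 1
      - q / z * q ^ k)) \<longlonglongrightarrow> qpoch z q * qpoch (q / z) q"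
    by (intro tendsto_intros qpoch_LIMSEQ q)
  ultimately have "inverse L * theta q z = qpoch z q * qpoch (q / z) q"
    by (rule LIMSEQ_unique)
  thus ?thesis using L0 by (simp add: L_def field_simps)
qed

lemma has_sum_times:
  fixes f :: "'a \<Rightarrow> complex" and g :: "'b \<Rightarrow> complex"
  assumes "(f has_sum a) A" "(g has_sum b) B"
  shows "((\<lambda>(x, y). f x * g y) has_sum (a * b)) (A \<times> B)"
proof (rule has_sum_SigmaI)
  show "((\<lambda>y. case (x, y) of (x, y) \<Rightarrow> f x * g y) has_sum f x * b) B" for x
    using has_sum_cmult_right[OF assms(2)] by simp
  show "((\<lambda>x. f x * b) has_sum a * b) A"
    by (rule has_sum_cmult_left[OF assms(1)])
  have f: "(\<lambda>x. norm (f x)) summable_on A" and g: "(\<lambda>y. norm (g y)) summable_on B"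
    using assms summable_on_iff_abs_summable_on_complex has_sum_imp_summable by blast+
  have "(\<lambda>x. norm (case x of (x, y) \<Rightarrow> f x * g y)) summable_on A \<times> B"
  proof (rule summable_on_SigmaI)
    show "((\<lambda>y. norm (case (x, y) of (x, y) \<Rightarrow> f x * g y))
        has_sum norm (f x) * infsum (\<lambda>y. norm (g y)) B) B" for x
      using has_sum_cmult_right[OF has_sum_infsum[OF g], of "norm (f x)"] by (simp add: norm_mult)
    show "(\<lambda>x. norm (f x) * infsum (\<lambda>y. norm (g y)) B) summable_on A"
      by (rule summable_on_cmult_left[OF f])
  qed auto
  thus "(\<lambda>(x, y). f x * g y) summable_on A \<times> B"
    using summable_on_iff_abs_summable_on_complex by blast
qed

lemma theta_reflect:
  assumes "norm q < 1" "q \<noteq> 0" "z \<noteq> 0"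
  shows "theta q (q / z) = theta q z"
  using assms by (simp add: jacobi_triple_product mult_ac)

lemma theta_shift:
  assumes "norm q < 1" "q \<noteq> 0" "z \<noteq> 0" "z \<noteq> 1"
  shows "theta q (q * z) = - theta q z / z"
proof -
  have "qpoch z q = (1 - z) * qpoch (q * z) q" "qpoch (1 / z) q = (1 - 1 / z) * qpoch (q / z) q"
    using qpoch_rec[OF assms(1), of z] qpoch_rec[OF assms(1), of "1 / z"]
      by (simp_all add: mult.commute)
  moreover define P where "P = qpoch q q * (qpoch (q * z) q * qpoch (q / z) q)"
  ultimately have "theta q z = (1 - z) * P" "theta q (q * z) = (1 - 1 / z) * P"
    using assms by (simp_all add: jacobi_triple_product mult_ac)
  thus ?thesis using assms by (simp add: divide_simps) (simp add: algebra_simps)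
qed

lemma theta_nonzero:
  assumes "norm q < 1" "q \<noteq> 0" "z \<noteq> 0" "norm z < 1" "norm q < norm z"
  shows "theta q z \<noteq> 0"
  using assms by (auto simp: jacobi_triple_product qpoch_nonzero' norm_divide)

text \<open>The zero comes from the first factor \<open>1 - z\<close> of \<open>qpoch z q\<close>;
  without it each of the three products equals the Euler product at \<open>z = 1\<close>.\<close>

lemma tendsto_theta_divide:
  assumes q: "norm q < 1" "q \<noteq> 0"
  shows "((\<lambda>z. theta q z / (1 - z)) \<longlongrightarrow> qpoch q q ^ 3) (at 1)"
proof (rule Lim_transform_eventually)
  have ev: "eventually (\<lambda>z::complex. z \<noteq> 0 \<and> z \<noteq> 1) (at 1)"
    using eventually_conj[OF eventually_neq_at_within[of 0 1 UNIV] eventually_neq_at_within[of 1 1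
        UNIV]] .
  show "eventually (\<lambda>z. qpoch q q * (qpoch (z * q) q * qpoch (q / z) q) = theta q z / (1
      - z)) (at 1)"
    using ev
  proof eventually_elim
    case (elim z)
    have "theta q z = (1 - z) * (qpoch q q * (qpoch (z * q) q * qpoch (q / z) q))"
      using elim q jacobi_triple_product[OF q, of z] qpoch_rec[OF q(1), of z] by (simp add: mult_ac)
    thus ?case using elim by simp
  qed
  have "((\<lambda>z. qpoch q q * (qpoch (z * q) q * qpoch (q / z) q)) \<longlongrightarrow> qpoch q q * (qpoch (1 * q) q *
      qpoch (q / 1) q)) (at 1)"
    by (intro tendsto_intros isCont_tendsto_compose[OF isCont_qpoch] q) auto
  thus "((\<lambda>z. qpoch q q * (qpoch (z * q) q * qpoch (q / z) q)) \<longlongrightarrow> qpoch q q ^ 3) (at 1)"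
    by (simp add: power3_eq_cube mult_ac)
qed

section \<open>Differentiation at z = 1: Jacobi's series for the cube of the Euler product\<close>

lemma abs_of_int_le_powi:
  "\<bar>real_of_int n\<bar> \<le> 2 powi n + 2 powi (- n)"
proof -
  have "real k \<le> 2 ^ k" for k using less_exp[of k]
    by (metis less_imp_le of_nat_le_iff of_nat_numeral of_nat_power)
  hence "\<bar>real_of_int n\<bar> \<le> 2 powi \<bar>n\<bar>"
    by (metis of_int_abs of_int_of_nat_eq power_int_of_nat abs_of_nonneg abs_ge_zero nat_0_le)
  also have "\<dots> \<le> 2 powi n + 2 powi (- n)" by (auto simp: abs_if)
  finally show ?thesis .
qed

text \<open>Majorant, uniform in \<open>x\<close>, for the difference quotients in
  \<open>jacobi_cube\<close>. The power with the smaller exponent, x^(-k), is pulled out and is at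
  most 2^k because x >= 1/2; Bernoulli's inequality handles the remaining 1 - x^(2k+1).\<close>

lemma one_minus_powi_bound:
  fixes x :: real
  assumes "1 / 2 \<le> x" "x \<le> 1"
  shows "\<bar>x powi n - x powi (1 - n)\<bar> \<le> (1 - x) * \<bar>real_of_int (1 - 2 * n)\<bar> * (2 * (2 powi n
      + 2 powi (- n)))"
proof -
  have *: "1 - x ^ m \<le> (1 - x) * real m" for m
    using Bernoulli_inequality[of "x - 1" m] assms by (simp add: algebra_simps)
  have pw: "x powi (- int k) \<le> 2 ^ k" for k
  proof -
    have "(1 / 2) ^ k \<le> x ^ k" using assms by (intro power_mono) auto
    thus ?thesis using assms by (simp add: power_int_minus field_simps)
  qed
  show ?thesis
  proof (cases "n \<ge> 1")
    case True
    define k where "k = nat (n - 1)"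
    have n: "n = int k + 1" using True by (simp add: k_def)
    have "x powi n = x powi (- int k) * x ^ (2 * k + 1)"
    proof -
      have "x powi n = x powi (- int k + int (2 * k + 1))" by (simp add: n)
      also have "\<dots> = x powi (- int k) * x powi int (2 * k + 1)"
        using assms by (subst power_int_add) auto
      finally show ?thesis by (simp only: power_int_of_nat)
    qed
    hence "x powi (1 - n) - x powi n = x powi (- int k) * (1 - x ^ (2 * k + 1))"
      by (simp add: n algebra_simps)
    moreover have "x ^ (2 * k + 1) \<le> 1" using assms by (intro power_le_one) auto
    ultimately have "\<bar>x powi n - x powi (1 - n)\<bar> = x powi (- int k) * (1 - x ^ (2 * k + 1))"
      using assms by (subst abs_minus_commute) (simp add: abs_mult del: power_Suc)
    also have "\<dots> \<le> 2 ^ k * ((1 - x) * real (2 * k + 1))"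
      using assms \<open>x ^ (2 * k + 1) \<le> 1\<close> by (intro mult_mono pw *) auto
    also have "\<dots> = (1 - x) * \<bar>real_of_int (1 - 2 * n)\<bar> * 2 ^ k"
      by (simp add: n)
    also have "\<dots> \<le> (1 - x) * \<bar>real_of_int (1 - 2 * n)\<bar> * (2 * (2 powi n + 2 powi (- n)))"
      using assms by (intro mult_left_mono) (auto simp: n power_int_add intro!: add_increasing2)
    finally show ?thesis .
  next
    case False
    define k where "k = nat (- n)"
    have n: "n = - int k" using False by (simp add: k_def)
    have "x powi (1 - n) = x powi (- int k) * x ^ (2 * k + 1)"
    proof -
      have "x powi (1 - n) = x powi (- int k + int (2 * k + 1))" by (simp add: n add.commute)
      also have "\<dots> = x powi (- int k) * x powi int (2 * k + 1)"
        using assms by (subst power_int_add) auto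
      finally show ?thesis by (simp only: power_int_of_nat)
    qed
    hence "x powi n - x powi (1 - n) = x powi (- int k) * (1 - x ^ (2 * k + 1))"
      by (simp add: n algebra_simps)
    moreover have "x ^ (2 * k + 1) \<le> 1" using assms by (intro power_le_one) auto
    ultimately have "\<bar>x powi n - x powi (1 - n)\<bar> = x powi (- int k) * (1 - x ^ (2 * k + 1))"
      using assms by (simp add: abs_mult del: power_Suc)
    also have "\<dots> \<le> 2 ^ k * ((1 - x) * real (2 * k + 1))"
      using assms \<open>x ^ (2 * k + 1) \<le> 1\<close> by (intro mult_mono pw *) auto
    also have "\<dots> = (1 - x) * \<bar>real_of_int (1 - 2 * n)\<bar> * 2 ^ k"
      by (simp add: n)
    also have "\<dots> \<le> (1 - x) * \<bar>real_of_int (1 - 2 * n)\<bar> * (2 * (2 powi n + 2 powi (- n)))"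
      using assms by (intro mult_left_mono) (auto simp: n intro!: add_increasing)
    finally show ?thesis .
  qed
qed

text \<open>Coefficients of Laurent series that converge absolutely on the whole punctured plane.
  This class is closed under multiplication by the index and under convolution, so moments can be
  computed without further convergence questions.\<close>

definition rapid :: "(int \<Rightarrow> complex) \<Rightarrow> bool" where
  "rapid u \<longleftrightarrow> (\<forall>r>0. (\<lambda>n. norm (u n) * r powi n) summable_on UNIV)"

lemma rapid_theta_coeff:
  assumes "norm q < 1" "q \<noteq> 0"
  shows "rapid (theta_coeff q)"
  using summable_powi_tri[of "norm q"] assms by (simp add: rapid_def norm_theta_coeff)

text \<open>The factor |n| is at most 2^n + 2^(-n), so it is absorbed by passing to the radii
  \<open>2 * r\<close> and \<open>r / 2\<close>.\<close>

lemma rapid_of_int_mult: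
  assumes "rapid u"
  shows "rapid (\<lambda>n. of_int n * u n)"
  unfolding rapid_def
proof safe
  fix r :: real assume r: "r > 0"
  have s: "(\<lambda>n. norm (u n) * x powi n) summable_on UNIV" if "x > 0" for x
    using assms that by (simp add: rapid_def)
  have "(\<lambda>n. norm (u n) * (2 * r) powi n + norm (u n) * (r / 2) powi n) summable_on UNIV"
    by (intro summable_on_add s) (use r in auto)
  thus "(\<lambda>n. norm (of_int n * u n) * r powi n) summable_on UNIV"
  proof (rule summable_on_comparison_test)
    fix n
    have "norm (of_int n * u n) * r powi n = \<bar>real_of_int n\<bar> * (norm (u n) * r powi n)"
      by (simp add: norm_mult)
    also have "\<dots> \<le> (2 powi n + 2 powi (- n)) * (norm (u n) * r powi n)"
      using r by (intro mult_right_mono abs_of_int_le_powi) auto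
    also have "\<dots> = norm (u n) * (2 * r) powi n + norm (u n) * (r / 2) powi n"
      by (simp add: power_int_mult_distrib power_int_divide_distrib power_int_minus field_simps)
    finally show "norm (of_int n * u n) * r powi n \<le> norm (u n) * (2 * r) powi n
        + norm (u n) * (r / 2) powi n" .
  qed (use r in auto)
qed

lemma rapid_summable:
  assumes "rapid u" "z \<noteq> 0"
  shows "(\<lambda>n. u n * z powi n) summable_on UNIV"
proof (rule abs_summable_summable)
  show "(\<lambda>n. norm (u n * z powi n)) summable_on UNIV"
    using assms by (simp add: rapid_def norm_mult norm_power_int)
qed

lemma tendsto_powi_quotient:
  "((\<lambda>z::complex. (z powi n - z powi m) / (1 - z)) \<longlongrightarrow> of_int (m - n)) (at 1)"
proof -
  have "((\<lambda>z::complex. z powi n - z powi m) has_field_derivative of_int (n - m)) (at 1)"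
    by (auto intro!: derivative_eq_intros)
  hence "((\<lambda>z::complex. (z powi n - z powi m) / (z - 1)) \<longlongrightarrow> of_int (n - m)) (at 1)"
    by (simp add: has_field_derivative_iff)
  hence "((\<lambda>z::complex. - ((z powi n - z powi m) / (z - 1))) \<longlongrightarrow> - of_int (n - m)) (at 1)"
    by (rule tendsto_minus)
  moreover have "- ((z powi n - z powi m) / (z - 1)) = (z powi n - z powi m) / (1
      - z)" for z :: complex
    by (metis minus_diff_eq minus_divide_right)
  ultimately show ?thesis by simp
qed

lemma filterlim_of_real_at_left: "filterlim complex_of_real (at 1) (at_left 1)"
  unfolding filterlim_at
    using tendsto_of_real[OF tendsto_ident_at, of 1 "{..<1}", where ?'a = complex]
  by (auto simp: eventually_at_filter)

text \<open>Divide the triple product by \<open>1 - z\<close>, with the terms of index \<open>n\<close> and \<open>1 - n\<close> paired,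
  and let \<open>z\<close> tend to \<open>1\<close> from the left.\<close>

theorem jacobi_cube:
  assumes q: "norm q < 1" "q \<noteq> 0"
  shows "((\<lambda>n. (- 1) powi n * of_int (2 * n + 1) * q powi tri (n + 1))
      has_sum 2 * qpoch q q ^ 3) UNIV"
proof -
  define M where "M n = norm (theta_coeff q n) * (\<bar>real_of_int (1 - 2 * n)\<bar> * (2 * (2 powi n
      + 2 powi (- n))))" for n
  have g: "rapid (\<lambda>n. of_int (1 - 2 * n) * theta_coeff q n)"
  proof -
    note g1 = rapid_theta_coeff[OF q] and g2 = rapid_of_int_mult[OF rapid_theta_coeff[OF q]]
    show ?thesis unfolding rapid_def
    proof safe
      fix r :: real assume r: "r > 0"
      have "(\<lambda>n. norm (theta_coeff q n) * r powi n
          + 2 * (norm (of_int n * theta_coeff q n) * r powi n)) summable_on UNIV"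
        using g1 g2 r by (intro summable_on_add summable_on_cmult_right) (auto simp: rapid_def)
      thus "(\<lambda>n. norm (of_int (1 - 2 * n) * theta_coeff q n) * r powi n) summable_on UNIV"
      proof (rule summable_on_comparison_test)
        fix n
        have "norm (of_int (1 - 2 * n) :: complex) \<le> 1 + 2 * norm (of_int n :: complex)"
          by (simp only: norm_of_int)
        from mult_right_mono[OF this, of "norm (theta_coeff q n) * r powi n"]
        show "norm (of_int (1 - 2 * n) * theta_coeff q n) * r powi n \<le>
          norm (theta_coeff q n) * r powi n + 2 * (norm (of_int n * theta_coeff q n) * r powi n)"
          unfolding norm_mult using r by (simp add: algebra_simps)
      qed (use r in auto)
    qed
  qed
  have M: "M summable_on UNIV"
  proof -
    have "(\<lambda>n. 2 * (norm (of_int (1 - 2 * n) * theta_coeff q n) * 2 powi n) +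
            2 * (norm (of_int (1 - 2 * n) * theta_coeff q n) * (1 / 2) powi n)) summable_on UNIV"
      using g by (intro summable_on_add summable_on_cmult_right) (auto simp: rapid_def)
    moreover have "2 * (norm (of_int (1 - 2 * n) * theta_coeff q n) * 2 powi n) +
            2 * (norm (of_int (1 - 2 * n) * theta_coeff q n) * (1 / 2) powi n) = M n" for n
      unfolding M_def norm_mult norm_of_int
      by (simp add: power_int_minus power_int_divide_distrib field_simps)
    ultimately show ?thesis by simp
  qed
  \<comment> \<open>Along the reals below 1 the majorant \<open>one_minus_powi_bound\<close> is
    available.\<close>
  define F where "F = at_left (1 :: real)"
  have ev: "eventually (\<lambda>x. 1 / 2 < x \<and> x < 1) F"
    unfolding F_def using eventually_at_left_real[of "1 / 2" "1 :: real"] by simp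
  have "((\<lambda>x. \<Sum>\<^sub>\<infinity>n. theta_coeff q n * ((of_real x powi n - of_real x powi (1 - n)) / (1
      - of_real x))) \<longlongrightarrow>
        (\<Sum>\<^sub>\<infinity>n. theta_coeff q n * of_int (1 - n - n))) F"
  proof (rule tendsto_infsum_int)
    show "((\<lambda>x. theta_coeff q n * ((of_real x powi n - of_real x powi (1 - n)) / (1
        - of_real x))) \<longlongrightarrow>
           theta_coeff q n * of_int (1 - n - n)) F" for n
      unfolding F_def
      by (intro tendsto_intros filterlim_compose[OF tendsto_powi_quotient
          filterlim_of_real_at_left])
    show "eventually (\<lambda>x. \<forall>n. norm (theta_coeff q n * ((of_real x powi n - of_real x powi (1
        - n)) / (1 - of_real x))) \<le> M n) F"
      using ev
    proof (eventually_elim, safe)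
      fix x :: real and n assume x: "1 / 2 < x" "x < 1"
      have "norm ((of_real x powi n - of_real x powi (1 - n)) / (1 - of_real x) :: complex) =
            \<bar>x powi n - x powi (1 - n)\<bar> / (1 - x)"
      proof -
        have "(of_real x powi n - of_real x powi (1 - n)) / (1 - of_real x) =
              (complex_of_real ((x powi n - x powi (1 - n)) / (1 - x)))" by simp
        thus ?thesis using x by (simp only: norm_of_real) simp
      qed
      also have "\<dots> \<le> \<bar>real_of_int (1 - 2 * n)\<bar> * (2 * (2 powi n + 2 powi (- n)))"
        using one_minus_powi_bound[of x n] x by (simp add: field_simps)
      finally show "norm (theta_coeff q n * ((of_real x powi n - of_real x powi (1 - n)) / (1
          - of_real x))) \<le> M n"
        unfolding M_def norm_mult by (intro mult_left_mono) auto
    qed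
  qed (use M in \<open>auto simp: F_def\<close>)
  moreover have "((\<lambda>x. \<Sum>\<^sub>\<infinity>n. theta_coeff q n * ((of_real x powi n - of_real x powi (1 - n)) / (1
      - of_real x))) \<longlongrightarrow>
        2 * qpoch q q ^ 3) F"
  proof (rule Lim_transform_eventually)
    show "((\<lambda>x. 2 * (theta q (of_real x) / (1 - of_real x))) \<longlongrightarrow> 2 * qpoch q q ^ 3) F"
      unfolding F_def
      by (intro tendsto_intros filterlim_compose[OF tendsto_theta_divide[OF q]
          filterlim_of_real_at_left])
    show "eventually (\<lambda>x. 2 * (theta q (of_real x) / (1 - of_real x)) =
       (\<Sum>\<^sub>\<infinity>n. theta_coeff q n * ((of_real x powi n - of_real x powi (1 - n)) / (1 - of_real x)))) F"
      using ev
    proof eventually_elim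
      case (elim x)
      let ?z = "complex_of_real x"
      have z: "?z \<noteq> 0" "1 - ?z \<noteq> 0" using elim by auto
      have 1: "((\<lambda>n. theta_coeff q n * ?z powi n) has_sum theta q ?z) UNIV"
        by (rule theta_has_sum[OF q z(1)])
      have "((\<lambda>n. - (theta_coeff q n * ?z powi (1 - n))) has_sum theta q ?z) UNIV"
        by (rule has_sum_reindex_bij_witness[of _ "\<lambda>n. 1 - n"
            "\<lambda>n. 1 - n", THEN iffD1, OF _ _ _ _ _ _ 1])
           (auto simp: theta_coeff_refl)
      from has_sum_divide_const[OF has_sum_add[OF 1 this], of "1 - ?z"]
      have "((\<lambda>n. theta_coeff q n * ((?z powi n - ?z powi (1 - n)) / (1 - ?z)))
          has_sum (2 * (theta q ?z / (1 - ?z)))) UNIV"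
        by (simp add: algebra_simps)
      thus ?case by (rule infsumI[symmetric])
    qed
  qed
  ultimately have "(\<Sum>\<^sub>\<infinity>n. theta_coeff q n * of_int (1 - n - n)) = 2 * qpoch q q ^ 3"
    using tendsto_unique[of F] by (auto simp: F_def)
  moreover have "(\<lambda>n. theta_coeff q n * of_int (1 - n - n)) summable_on UNIV"
    using rapid_summable[OF g, of 1] by (simp add: mult.commute)
  ultimately have "((\<lambda>n. theta_coeff q n * of_int (1 - n - n)) has_sum 2 * qpoch q q ^ 3) UNIV"
    by (simp add: has_sum_iff)
  \<comment> \<open>Negating the index turns 1 - 2n into 2n + 1. The sum is over all integers and
    the terms n and -1 - n agree, whence twice the cube.\<close>
  also have "?this \<longleftrightarrow> ?thesis"
  proof (rule has_sum_reindex_bij_witness[of _ uminus uminus])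
    fix n :: int
    show "(- 1) powi - n * of_int (2 * - n + 1) * q powi tri (- n + 1) = theta_coeff q n * of_int (1
        - n - n)"
      using tri_refl[of n] by (simp add: theta_coeff_def power_int_minus_one_minus)
  qed auto
  finally show ?thesis .
qed

section \<open>Pentagonal number theorem and quintuple product\<close>

definition pent :: "int \<Rightarrow> int" where "pent k = 3 * tri k + k"

lemma two_pent: "2 * pent k = k * (3 * k - 1)"
  using two_tri[of k] by (simp add: pent_def algebra_simps)

text \<open>The triple product to the base \<open>q ^ 3\<close> at \<open>z = q\<close>: its three
  factors take the exponents 1, 2 and 0 modulo 3 and together form the Euler product.\<close>

lemma pentagonal:
  assumes q: "norm q < 1" "q \<noteq> 0"
  shows "((\<lambda>k. (- 1) powi k * q powi pent k) has_sum qpoch q q) UNIV"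
proof -
  have "norm (q ^ 3) < 1" using q by (simp add: norm_power power_less_one_iff)
  hence "((\<lambda>n. theta_coeff (q ^ 3) n * q powi n) has_sum theta (q ^ 3) q) UNIV"
    using q by (intro theta_has_sum) auto
  moreover have "theta (q ^ 3) q = qpoch q q"
    using q \<open>norm (q ^ 3) < 1\<close> qpoch_multisection[OF q(1), of 3 q]
    by (simp add: jacobi_triple_product eval_nat_numeral mult_ac)
  moreover have "theta_coeff (q ^ 3) n * q powi n = (- 1) powi n * q powi pent n" for n
    using q by (simp add: theta_coeff_def pent_def power_int_add power_int_power)
  ultimately show ?thesis by simp
qed

text \<open>Written as double series, the even part of the product
  is matched by the linear substitutions \<open>k = (n + m) / 2, s = (n - 3 m) / 2\<close> and
  \<open>k = (m - n + 1) / 2, s = (n + 3 m + 1) / 2\<close>, which preserve \<open>3 (k - 1/6)\<^sup>2 + (s - 1/2)\<^sup>2\<close>;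
  the remaining terms cancel.\<close>

theorem quintuple_product:
  assumes q: "norm q < 1" "q \<noteq> 0" and z: "z \<noteq> 0"
  shows "qpoch q q * theta q (z ^ 2) = theta q z * (theta (q ^ 3) (q ^ 2 / z ^ 3)
      + z * theta (q ^ 3) (q ^ 2 * z ^ 3))"
proof -
  define f1 where "f1 = (\<lambda>(n, m). (- 1) powi (n + m) * q powi (tri n + 3 * tri m
      + 2 * m) * z powi (n - 3 * m))"
  define f2 where "f2 = (\<lambda>(n, m). (- 1) powi (n + m) * q powi (tri n + 3 * tri m
      + 2 * m) * z powi (n + 3 * m + 1))"
  define g where "g = (\<lambda>(k, s). (- 1) powi (k + s) * q powi (3 * tri k + k
      + tri s) * z powi (2 * s))"
  define E where "E = {(n :: int, m :: int). even (n + m)}"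
  define D where "D = {(n :: int, m :: int). odd (n + m)}"
  have ED: "\<exists>t m. x = (2 * t - m, m)" if "x \<in> E" for x
  proof -
    obtain n m where nm: "x = (n, m)" "even (n + m)" using \<open>x \<in> E\<close> by (auto simp: E_def)
    from nm(2) obtain t where "n + m = 2 * t" by (rule evenE)
    hence "n = 2 * t - m" by linarith
    with nm show ?thesis by simp
  qed
  have DD: "\<exists>t m. x = (2 * t + 1 - m, m)" if "x \<in> D" for x
  proof -
    obtain n m where nm: "x = (n, m)" "odd (n + m)" using \<open>x \<in> D\<close> by (auto simp: D_def)
    from nm(2) obtain t where "n + m = 2 * t + 1" by (rule oddE)
    hence "n = 2 * t + 1 - m" by linarith
    with nm show ?thesis by simp
  qed
  have EI: "even (n + m) \<Longrightarrow> (n, m) \<in> E" and DI: "odd (n + m) \<Longrightarrow> (n, m) \<in> D" for n m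
    by (simp_all add: E_def D_def)
  have [simp]: "- (2 * m) div 2 = - m" for m :: int by presburger
  have q3: "norm (q ^ 3) < 1" "q ^ 3 \<noteq> 0"
    using q by (auto simp: norm_power power_less_one_iff)
  have f1: "(f1 has_sum theta q z * theta (q ^ 3) (q ^ 2 / z ^ 3)) UNIV"
  proof -
    have "f1 = (\<lambda>(n, m). (theta_coeff q n * z powi n) * (theta_coeff (q ^ 3) m * (q ^ 2 / z ^ 3)
        powi m))"
      using q z by (auto simp: f1_def theta_coeff_def fun_eq_iff power_int_add power_int_diff
          power_int_power
          power_int_divide_distrib)
    thus ?thesis
      using has_sum_times[OF theta_has_sum[OF q z] theta_has_sum[OF q3, of "q ^ 2 / z ^ 3"]] q z
        by simp
  qed
  have f2: "(f2 has_sum theta q z * (z * theta (q ^ 3) (q ^ 2 * z ^ 3))) UNIV"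
  proof -
    have "f2 = (\<lambda>(n, m). (theta_coeff q n * z powi n) * (z * (theta_coeff (q ^ 3) m * (q ^ 2 * z ^
        3) powi m)))"
      using q z by (auto simp: f2_def theta_coeff_def fun_eq_iff power_int_add power_int_power
          power_int_mult_distrib)
    thus ?thesis
      using has_sum_times[OF theta_has_sum[OF q z] has_sum_cmult_right[OF theta_has_sum[OF q3, of
          "q ^ 2 * z ^ 3"]]] q z by simp
  qed
  have g: "(g has_sum qpoch q q * theta q (z ^ 2)) UNIV"
  proof -
    have "g = (\<lambda>(k, s). ((- 1) powi k * q powi pent k) * (theta_coeff q s * (z ^ 2) powi s))"
      using q z by (auto simp: g_def theta_coeff_def pent_def fun_eq_iff power_int_add
          power_int_power)
    thus ?thesis
      using has_sum_times[OF pentagonal[OF q] theta_has_sum[OF q, of "z ^ 2"]] z by simp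
  qed
  have split: "(f has_sum infsum f E + infsum f D) UNIV" if "(f has_sum s) UNIV" for f ::
      "int \<times> int \<Rightarrow> complex" and s
  proof -
    have "f summable_on X" for X
      by (rule summable_on_subset[OF has_sum_imp_summable[OF that]]) auto
    hence "(f has_sum infsum f E + infsum f D) (E \<union> D)"
      by (intro has_sum_Un_disjoint has_sum_infsum) (auto simp: E_def D_def)
    moreover have "E \<union> D = UNIV" by (auto simp: E_def D_def)
    ultimately show ?thesis by simp
  qed
  have "infsum f1 E = infsum g E"
  proof (rule infsum_reindex_bij_witness[of E "\<lambda>(k, s). ((3 * k + s) div 2, (k - s) div 2)"
      "\<lambda>(n, m). ((n + m) div 2, (n - 3 * m) div 2)"])
    fix a assume "a \<in> E"
    then obtain m t where a: "a = (2 * t - m, m)" using ED by blast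
    have d: "(2 * t - m + m) div 2 = t" "(2 * t - m - 3 * m) div 2 = t - 2 * m" by auto
    have "3 * tri t + t + tri (t - 2 * m) = tri (2 * t - m) + 3 * tri m + 2 * m"
      using two_tri[of t] two_tri[of "t - 2 * m"] two_tri[of "2 * t - m"] two_tri[of m]
      by (simp add: algebra_simps)
    moreover have "(- 1) powi (t + (t - 2 * m)) = ((- 1) powi (2 * t - m + m) :: complex)"
      by simp
    ultimately show "g (case a of (n, m) \<Rightarrow> ((n + m) div 2, (n - 3 * m) div 2)) = f1 a"
      unfolding a g_def f1_def prod.case d by (simp add: algebra_simps)
  qed (auto dest!: ED DD intro!: EI DI)
  moreover have "infsum f2 D = infsum g D"
  proof (rule infsum_reindex_bij_witness[of D "\<lambda>(k, s). ((s - 3 * k + 1) div 2, (k + s - 1) div 2)"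
      "\<lambda>(n, m). ((m - n + 1) div 2, (n + 3 * m + 1) div 2)"])
    fix a assume "a \<in> D"
    then obtain m t where a: "a = (2 * t + 1 - m, m)" using DD by blast
    have d: "(m - (2 * t + 1 - m) + 1) div 2 = m - t"
        "(2 * t + 1 - m + 3 * m + 1) div 2 = t + m + 1" by auto
    have "3 * tri (m - t) + (m - t) + tri (t + m + 1) = tri (2 * t + 1 - m) + 3 * tri m + 2 * m"
      using two_tri[of "m - t"] two_tri[of "t + m + 1"] two_tri[of "2 * t + 1 - m"] two_tri[of m]
      by (simp add: algebra_simps)
    moreover have "(- 1) powi (m - t + (t + m + 1)) = ((- 1) powi (2 * t + 1 - m + m) :: complex)"
      by simp
    ultimately show "g (case a of (n, m) \<Rightarrow> ((m - n + 1) div 2, (n + 3 * m + 1) div 2)) = f2 a"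
      unfolding a g_def f2_def prod.case d by (simp add: algebra_simps)
  qed (auto dest!: ED DD intro!: EI DI)
  \<comment> \<open>The cancellation: this substitution preserves 3 (m + 1/6)^2 + (n - 1/2)^2, hence
    the power of \<open>q\<close>, and carries the power of \<open>z\<close> in \<open>f1\<close> to
    that in \<open>f2\<close>, while the sign is reversed.\<close>
  moreover have "infsum f1 D = infsum (\<lambda>x. - f2 x) E"
  proof (rule infsum_reindex_bij_witness[of D
      "\<lambda>(n, m). (m - n + 1 + (n + m) div 2, - ((n + m) div 2))"
      "\<lambda>(n, m). ((1 - n - 3 * m) div 2, (n - m - 1) div 2)"])
    fix a assume "a \<in> D"
    then obtain m t where a: "a = (2 * t + 1 - m, m)" using DD by blast
    have d: "(1 - (2 * t + 1 - m) - 3 * m) div 2 = - t - m" "(2 * t + 1 - m - m - 1) div 2 = t - m"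
      by auto
    have "tri (- t - m) + 3 * tri (t - m) + 2 * (t - m) = tri (2 * t + 1 - m) + 3 * tri m + 2 * m"
      using two_tri[of "- t - m"] two_tri[of "t - m"] two_tri[of "2 * t + 1 - m"] two_tri[of m]
      by (simp add: algebra_simps)
    moreover have "(- 1) powi (- t - m + (t - m)) = - ((- 1) powi (2 * t + 1 - m + m) :: complex)"
      by simp
    ultimately show "- f2 (case a of (n, m) \<Rightarrow> ((1 - n - 3 * m) div 2, (n - m - 1) div 2)) = f1 a"
      unfolding a f2_def f1_def prod.case d by (simp add: algebra_simps)
  qed (auto dest!: ED DD intro!: EI DI)
  ultimately have *: "infsum f1 E = infsum g E" "infsum f2 D = infsum g D"
      "infsum f1 D = - infsum f2 E"
    by (simp_all add: infsum_uminus)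
  show ?thesis
    using has_sum_unique[OF f1 split[OF f1]] has_sum_unique[OF f2 split[OF f2]] has_sum_unique[OF g
        split[OF g]] *
    by (simp add: algebra_simps)
qed

section \<open>The 7-dissection and the fourth power of the Euler product\<close>

lemma theta_cube_eq:
  assumes q: "norm q < 1" "q \<noteq> 0"
  shows "theta (q ^ 3) (q ^ 2) = qpoch q q"
proof -
  have q3: "norm (q ^ 3) < 1" using q by (simp add: norm_power power_less_one_iff)
  show ?thesis
    using q q3 qpoch_multisection[OF q(1), of 3 q]
    by (simp add: jacobi_triple_product eval_nat_numeral mult_ac)
qed

lemma theta_has_sum_powi:
  assumes p: "norm p < 1" "p \<noteq> 0" and "c > 0"
  shows "((\<lambda>m. (- 1) powi m * p powi (int c * tri m + b * m))
      has_sum theta (p ^ c) (p powi b)) UNIV"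
proof -
  have "norm (p ^ c) < 1" using p \<open>c > 0\<close> by (simp add: norm_power power_less_one_iff)
  from theta_has_sum[OF this, of "p powi b"] p show ?thesis
    by (simp add: theta_coeff_def power_int_add power_int_power mult_ac flip: power_int_mult)
qed

text \<open>Substitute k = alpha - 7m. Here 147 = 3 * 7^2, and 77 = (147 + 7) / 2 arises when m^2 is
  expressed through \<open>tri m\<close>.\<close>

lemma pentagonal_class:
  assumes p: "norm p < 1" "p \<noteq> 0"
  shows "((\<lambda>k. (- 1) powi k * p powi pent k) has_sum
      (- 1) powi \<alpha> * p powi pent \<alpha> * theta (p ^ 147) (p powi (77 - 21 * \<alpha>))) {k. k mod 7 = \<alpha> mod 7}"
proof -
  have "((\<lambda>m. (- 1) powi \<alpha> * p powi pent \<alpha> * ((- 1) powi m * p powi (int 147 * tri m + (77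
      - 21 * \<alpha>) * m))) has_sum
     (- 1) powi \<alpha> * p powi pent \<alpha> * theta (p ^ 147) (p powi (77 - 21 * \<alpha>))) UNIV"
    by (intro has_sum_cmult_right theta_has_sum_powi p) simp
  also have "?this \<longleftrightarrow> ?thesis"
  proof (rule has_sum_reindex_bij_witness[of _ "\<lambda>k. (\<alpha> - k) div 7" "\<lambda>m. \<alpha> - 7 * m"])
    fix m :: int
    have "pent (\<alpha> - 7 * m) = pent \<alpha> + (147 * tri m + (77 - 21 * \<alpha>) * m)"
      using two_pent[of "\<alpha> - 7 * m"] two_pent[of \<alpha>] two_tri[of m] by (simp add: algebra_simps)
    moreover have "(- 1) powi (\<alpha> - 7 * m) = (- 1) powi \<alpha> * ((- 1) powi m :: complex)"
      by (cases "even m") (auto simp: power_int_diff)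
    ultimately show "(- 1) powi (\<alpha> - 7 * m) * p powi pent (\<alpha> - 7 * m) =
      (- 1) powi \<alpha> * p powi pent \<alpha> * ((- 1) powi m * p powi (int 147 * tri m + (77 - 21 * \<alpha>) * m))"
      using p by (simp add: power_int_add)
  next
    fix b assume "b \<in> {k. k mod 7 = \<alpha> mod 7}"
    hence "7 dvd \<alpha> - b" by (simp add: mod_eq_dvd_iff[symmetric])
    thus "\<alpha> - 7 * ((\<alpha> - b) div 7) = b" by simp
  next
    fix a show "\<alpha> - 7 * a \<in> {k. k mod 7 = \<alpha> mod 7}"
      by (simp add: mod_eq_dvd_iff)
  qed auto
  finally show ?thesis .
qed

text \<open>Pentagonal numbers are 0, 1, 2 or 5 modulo 7, and the classes alpha and -2 - alpha give
  the same residue. Each of the pairs (0, -2), (1, -3), (2, -4) is one quintuple product to the base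
  \<open>Q\<close> at \<open>q\<close>, \<open>q ^ 2\<close>, \<open>q ^ 3\<close>; the self-paired
  class -1 reproduces the Euler product.\<close>

theorem euler_dissection:
  assumes p: "norm p < 1" "p \<noteq> 0" and q: "q = p ^ 7" and Q: "Q = q ^ 7"
  shows "qpoch p p = qpoch Q Q * (theta Q (q ^ 2) / theta Q q
      - p * (theta Q (q ^ 3) / theta Q (q ^ 2)) - p ^ 2
           + p ^ 5 * (theta Q q / theta Q (q ^ 3)))"
proof -
  have q': "norm q < 1" "q \<noteq> 0" using p by (simp_all add: q norm_power power_less_one_iff)
  have Q': "norm Q < 1" "Q \<noteq> 0" using q' by (simp_all add: Q norm_power power_less_one_iff)
  have Tn: "theta Q (q ^ r) \<noteq> 0" if "r > 0" "r < 7" for r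
    using q' that Q' by (intro theta_nonzero) (auto simp: Q norm_power power_less_one_iff
        power_strict_decreasing)
  let ?V = "\<lambda>\<alpha>. (- 1) powi \<alpha> * p powi pent \<alpha> * theta (p ^ 147) (p powi (77 - 21 * \<alpha>))"
  let ?F = "\<lambda>k. (- 1) powi k * p powi pent k"
  have "(?F has_sum sum ?V {0, -2, 1, -3, 2, -4, -1}) (\<Union>\<alpha>\<in>{0, -2, 1, -3, 2, -4, -1}. {k. k mod 7
      = \<alpha> mod 7})"
    by (rule sum_has_sum) (use pentagonal_class[OF p] in auto)
  also have "(\<Union>\<alpha>\<in>{0, -2, 1, -3, 2, -4, -1}. {k. k mod 7 = \<alpha> mod 7}) = (UNIV :: int set)"
  proof -
    have "k mod 7 \<in> {0, 1, 2, 3, 4, 5, 6}" for k :: int by simp presburger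
    thus ?thesis by auto
  qed
  finally have "qpoch p p = sum ?V {0, -2, 1, -3, 2, -4, -1}"
    using pentagonal[OF p] has_sum_unique by blast
  also have "\<dots> = (theta (p ^ 147) (p ^ 77) + p ^ 7 * theta (p ^ 147) (p ^ 119))
     - p * (theta (p ^ 147) (p ^ 56) + p ^ 14 * theta (p ^ 147) (p ^ 140))
     + p ^ 5 * (theta (p ^ 147) (p ^ 35) + p ^ 21 * theta (p ^ 147) (p ^ 161))
         - p ^ 2 * theta (p ^ 147) (p ^ 98)"
  proof -
    have "p ^ 15 = p * p ^ 14" by (simp flip: power_Suc)
    thus ?thesis by (simp add: pent_def tri_def algebra_simps)
  qed
  also have "theta (p ^ 147) (p ^ 98) = qpoch Q Q"
    using theta_cube_eq[OF Q'] by (simp add: Q q flip: power_mult)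
  also have "theta (p ^ 147) (p ^ 77) + p ^ 7 * theta (p ^ 147) (p ^ 119)
      = qpoch Q Q * theta Q (q ^ 2) / theta Q q"
  proof -
    have "Q ^ 3 = p ^ 147" "Q ^ 2 / q ^ 3 = p ^ 77" "q = p ^ 7" "Q ^ 2 * q ^ 3 = p ^ 119"
      using p by (auto simp: Q q field_simps simp flip: power_mult power_add)
    thus ?thesis using quintuple_product[OF Q', of q] Tn[of 1] q' by (simp add: field_simps)
  qed
  also have "theta (p ^ 147) (p ^ 56) + p ^ 14 * theta (p ^ 147) (p ^ 140)
      = qpoch Q Q * theta Q (q ^ 3) / theta Q (q ^ 2)"
  proof -
    have *: "Q ^ 3 = p ^ 147" "Q ^ 2 / (q ^ 2) ^ 3 = p ^ 56" "q ^ 2 = p ^ 14"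
        "Q ^ 2 * (q ^ 2) ^ 3 = p ^ 140"
      using p by (auto simp: Q q field_simps simp flip: power_mult power_add)
    \<comment> \<open>Reflection folds the exponent 4 to 3, and in the next case 6 to 1, since
      \<open>Q = q ^ 7\<close>.\<close>
    have "theta Q ((q ^ 2) ^ 2) = theta Q (Q / q ^ 3)"
      using q' by (simp add: Q eval_nat_numeral field_simps)
    also have "\<dots> = theta Q (q ^ 3)" using q' by (intro theta_reflect Q') auto
    finally have "qpoch Q Q * theta Q (q ^ 3)
        = theta Q (q ^ 2) * (theta (Q ^ 3) (Q ^ 2 / (q ^ 2) ^ 3)
        + q ^ 2 * theta (Q ^ 3) (Q ^ 2 * (q ^ 2) ^ 3))"
      using quintuple_product[OF Q', of "q ^ 2"] q'
        by (simp only: power_not_zero simp_thms not_False_eq_True)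
    also have "\<dots> = theta Q (q ^ 2) * (theta (p ^ 147) (p ^ 56)
        + p ^ 14 * theta (p ^ 147) (p ^ 140))"
      by (simp only: *(1,2,4)) (simp only: *(3))
    finally show ?thesis using Tn[of 2] by (simp add: field_simps)
  qed
  also have "theta (p ^ 147) (p ^ 35) + p ^ 21 * theta (p ^ 147) (p ^ 161)
      = qpoch Q Q * theta Q q / theta Q (q ^ 3)"
  proof -
    have *: "Q ^ 3 = p ^ 147" "Q ^ 2 / (q ^ 3) ^ 3 = p ^ 35" "q ^ 3 = p ^ 21"
        "Q ^ 2 * (q ^ 3) ^ 3 = p ^ 161"
      using p by (auto simp: Q q field_simps simp flip: power_mult power_add)
    have "theta Q ((q ^ 3) ^ 2) = theta Q (Q / q)"
      using q' by (simp add: Q eval_nat_numeral field_simps)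
    also have "\<dots> = theta Q q" using q' by (intro theta_reflect Q') auto
    finally have "qpoch Q Q * theta Q q = theta Q (q ^ 3) * (theta (Q ^ 3) (Q ^ 2 / (q ^ 3) ^ 3)
        + q ^ 3 * theta (Q ^ 3) (Q ^ 2 * (q ^ 3) ^ 3))"
      using quintuple_product[OF Q', of "q ^ 3"] q'
        by (simp only: power_not_zero simp_thms not_False_eq_True)
    also have "\<dots> = theta Q (q ^ 3) * (theta (p ^ 147) (p ^ 35)
        + p ^ 21 * theta (p ^ 147) (p ^ 161))"
      by (simp only: *(1,2,4)) (simp only: *(3))
    finally show ?thesis using Tn[of 3] by (simp add: field_simps)
  qed
  finally show ?thesis by (simp add: algebra_simps)
qed

text \<open>The fourth power of the Euler product is the product of the pentagonal series and the series
  for the cube. Its exponent is \<open>(X\<^sup>2 + 3 Y\<^sup>2 - 4) / 24\<close> with \<open>X = 6 m - 1\<close>, \<open>Y = 2 n + 1\<close>.\<close>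

definition eta4_weight :: "int \<times> int \<Rightarrow> complex" where
  "eta4_weight = (\<lambda>(m, n). (- 1) powi (m + n) * of_int (2 * n + 1))"

definition eta4_exponent :: "int \<times> int \<Rightarrow> int" where
  "eta4_exponent = (\<lambda>(m, n). pent m + tri (n + 1))"

lemma two_eta4_exponent: "2 * eta4_exponent (m, n) = m * (3 * m - 1) + n * (n + 1)"
  using two_pent[of m] two_tri[of "n + 1"] by (simp add: eta4_exponent_def algebra_simps)

lemma eta4_has_sum:
  assumes q: "norm q < 1" "q \<noteq> 0"
  shows "((\<lambda>x. eta4_weight x * q powi eta4_exponent x) has_sum 2 * qpoch q q ^ 4) UNIV"
proof -
  have "(\<lambda>x. eta4_weight x * q powi eta4_exponent x) = (\<lambda>(m, n). ((- 1) powi m * q powi pent m) *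
          ((- 1) powi n * of_int (2 * n + 1) * q powi tri (n + 1)))"
    using q by (auto simp: fun_eq_iff eta4_weight_def eta4_exponent_def power_int_add)
  thus ?thesis
    using has_sum_times[OF pentagonal[OF q] jacobi_cube[OF q]]
      by (simp add: eval_nat_numeral mult_ac)
qed

text \<open>The part of the weight depending on \<open>m\<close> drops out under the involution \<open>n \<mapsto> - 1 - n\<close>.\<close>

lemma eta4_branch:
  assumes q: "norm q < 1" "q \<noteq> 0"
    and s: "((\<lambda>(m, n). (- 1) powi (m + n) * of_int (k * m + 4 * n
        + l) * q powi eta4_exponent (m, n)) has_sum S) UNIV"
  shows "S = 4 * qpoch q q ^ 4"
proof -
  define h where "h = (\<lambda>(m, n). (- 1) powi (m + n) * of_int (k * m + 4 * n
      + l) * q powi eta4_exponent (m, n))"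
  have "((\<lambda>(m, n). h (m, - 1 - n)) has_sum S) UNIV"
    by (rule has_sum_reindex_bij_witness[of _ "\<lambda>(m, n). (m, - 1 - n)"
        "\<lambda>(m, n). (m, - 1 - n)", THEN iffD1, OF _ _ _ _ _ _ s[folded h_def]])
      auto
  from has_sum_add[OF this s[folded h_def]]
  have "((\<lambda>x. (case x of (m, n) \<Rightarrow> h (m, - 1 - n)) + h x) has_sum S + S) UNIV" .
  moreover have "(case x of (m, n) \<Rightarrow> h (m, - 1 - n)) + h x
      = 4 * (eta4_weight x * q powi eta4_exponent x)" for x
  proof -
    obtain m n where x: "x = (m, n)" by (cases x)
    have e: "eta4_exponent (m, - 1 - n) = eta4_exponent (m, n)"
      using two_eta4_exponent[of m "- 1 - n"] two_eta4_exponent[of m n] by (simp add: algebra_simps)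
    have sg: "(- 1) powi (m + (- 1 - n)) = - ((- 1) powi (m + n) :: complex)"
      by (cases "even m"; cases "even n") auto
    show ?thesis unfolding x h_def eta4_weight_def prod.case e sg by (simp add: algebra_simps)
  qed
  ultimately have "((\<lambda>x. 4 * (eta4_weight x * q powi eta4_exponent x)) has_sum S + S) UNIV" by simp
  from has_sum_unique[OF this has_sum_cmult_right[OF eta4_has_sum[OF q], of 4]] show ?thesis by simp
qed

text \<open>The Hecke relation at the prime \<open>7\<close>. The exponent is \<open>1\<close> modulo \<open>7\<close> iff
  \<open>X + Y \<surd>-3\<close> is divisible by \<open>2 + \<surd>-3\<close> or by its conjugate (the sets \<open>J1\<close>, \<open>J2\<close>);
  the reindexings are the divisions by these two elements, and by \<open>7\<close> on the intersection.\<close>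

theorem eta4_hecke:
  assumes p: "norm p < 1" "p \<noteq> 0"
  shows "((\<lambda>x. eta4_weight x * p powi eta4_exponent x) has_sum - 8 * p * qpoch (p ^ 7) (p ^ 7) ^ 4
           - 14 * p ^ 8 * qpoch (p ^ 49) (p ^ 49) ^ 4) {x. eta4_exponent x mod 7 = 1}"
proof -
  let ?f = "\<lambda>x. eta4_weight x * p powi eta4_exponent x"
  have q: "norm (p ^ 7) < 1" "p ^ 7 \<noteq> 0" and Q: "norm (p ^ 49) < 1" "p ^ 49 \<noteq> 0"
    using p by (simp_all add: norm_power power_less_one_iff)
  have summ: "?f summable_on A" for A
    by (rule summable_on_subset[OF has_sum_imp_summable[OF eta4_has_sum[OF p]]]) auto
  define J1 where "J1 = {(m, n). 7 dvd 2 * m + n - (1::int)}"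
  define J2 where "J2 = {(m, n). 7 dvd 2 * m - n - (2::int)}"
  have pw: "p powi (7 * e + 1) = p * (p ^ 7) powi e" for e
    using p by (simp add: power_int_add power_int_power)
  have pw3: "p powi (49 * e + 8) = p ^ 8 * (p ^ 49) powi e" for e
    using p by (simp add: power_int_add power_int_power)
  have J1: "(?f has_sum - 4 * p * qpoch (p ^ 7) (p ^ 7) ^ 4) J1"
  proof -
    define S where "S = infsum ?f J1"
    have "(?f has_sum S) J1" unfolding S_def by (rule has_sum_infsum[OF summ])
    \<comment> \<open>Dividing by an element of norm 7 makes the weight \<open>2 * n + 1\<close> a
      linear form in both variables; \<open>eta4_branch\<close> brings it back to the original
      weight.\<close>
    also have "?this \<longleftrightarrow> ((\<lambda>x. - p * (case x of (m, n) \<Rightarrow> (- 1) powi (m + n) * of_int ((- 6) * m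
        + 4 * n + 3) * (p ^ 7) powi eta4_exponent (m, n))) has_sum S) UNIV"
    proof (rule has_sum_reindex_bij_witness[of _ "\<lambda>(m, n). (- 2 * m - n, - 3 * m + 2 * n + 1)"
        "\<lambda>(m, n). ((1 - 2 * m - n) div 7, (2 * n - 3 * m - 2) div 7)"])
      fix a assume "a \<in> J1"
      then obtain m n where a: "a = (m, n)" "7 dvd 2 * m + n - 1" by (auto simp: J1_def)
      then obtain t where t: "2 * m + n - 1 = 7 * t" by (auto elim: dvdE)
      hence n: "n = 7 * t + 1 - 2 * m" by linarith
      have d: "(1 - 2 * m - n) div 7 = - t" "(2 * n - 3 * m - 2) div 7 = 2 * t - m"
        by (simp_all add: n)
      show "(case case a of (m, n) \<Rightarrow> ((1 - 2 * m - n) div 7, (2 * n - 3 * m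
          - 2) div 7) of (m, n) \<Rightarrow> (- 2 * m - n, - 3 * m + 2 * n + 1)) = a"
        unfolding a prod.case d by (simp add: n)
      have e: "eta4_exponent (m, n) = 7 * eta4_exponent (- t, 2 * t - m) + 1"
        using two_eta4_exponent[of m n] two_eta4_exponent[of "- t" "2 * t - m"]
          by (simp add: n algebra_simps)
      have sg: "(- 1) powi (m + n) = - ((- 1) powi (- t + (2 * t - m)) :: complex)"
        by (cases "even t"; cases "even m") (auto simp: n)
      show "- p * (case (case a of (m, n) \<Rightarrow> ((1 - 2 * m - n) div 7, (2 * n - 3 * m
          - 2) div 7)) of (m, n) \<Rightarrow> (- 1) powi (m + n) * of_int ((- 6) * m + 4 * n
          + 3) * (p ^ 7) powi eta4_exponent (m, n)) = ?f a"
        unfolding a prod.case d eta4_weight_def e pw sg by (simp add: n algebra_simps)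
    qed (auto simp: J1_def)
    also have "\<dots> \<longleftrightarrow> ((\<lambda>(m, n). (- 1) powi (m + n) * of_int ((- 6) * m + 4 * n
        + 3) * (p ^ 7) powi eta4_exponent (m, n)) has_sum S / (- p)) UNIV"
      by (rule has_sum_cmult_right_iff) (use p in auto)
    finally have "S / (- p) = 4 * qpoch (p ^ 7) (p ^ 7) ^ 4" by (rule eta4_branch[OF q])
    moreover have "S = - p * (S / (- p))" using p by simp
    ultimately have "S = - 4 * p * qpoch (p ^ 7) (p ^ 7) ^ 4"
      by (metis mult.assoc mult.commute mult_minus_left)
    thus ?thesis using has_sum_infsum[OF summ, of J1] by (simp add: S_def)
  qed
  have J2: "(?f has_sum - 4 * p * qpoch (p ^ 7) (p ^ 7) ^ 4) J2"
  proof -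
    define S where "S = infsum ?f J2"
    have "(?f has_sum S) J2" unfolding S_def by (rule has_sum_infsum[OF summ])
    also have "?this \<longleftrightarrow> ((\<lambda>x. - p * (case x of (m, n) \<Rightarrow> (- 1) powi (m + n) * of_int (6 * m + 4 * n
        + 1) * (p ^ 7) powi eta4_exponent (m, n))) has_sum S) UNIV"
    proof (rule has_sum_reindex_bij_witness[of _ "\<lambda>(m, n). (- 2 * m + n + 1, 3 * m + 2 * n)"
        "\<lambda>(m, n). ((2 - 2 * m + n) div 7, (3 * m + 2 * n - 3) div 7)"])
      fix a assume "a \<in> J2"
      then obtain m n where a: "a = (m, n)" "7 dvd 2 * m - n - 2" by (auto simp: J2_def)
      then obtain t where t: "2 * m - n - 2 = 7 * t" by (auto elim: dvdE)
      hence n: "n = 2 * m - 2 - 7 * t" by linarith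
      have d: "(2 - 2 * m + n) div 7 = - t" "(3 * m + 2 * n - 3) div 7 = m - 1 - 2 * t"
        by (simp_all add: n)
      show "(case case a of (m, n) \<Rightarrow> ((2 - 2 * m + n) div 7, (3 * m + 2 * n
          - 3) div 7) of (m, n) \<Rightarrow> (- 2 * m + n + 1, 3 * m + 2 * n)) = a"
        unfolding a prod.case d by (simp add: n)
      have e: "eta4_exponent (m, n) = 7 * eta4_exponent (- t, m - 1 - 2 * t) + 1"
        using two_eta4_exponent[of m n] two_eta4_exponent[of "- t" "m - 1 - 2 * t"]
          by (simp add: n algebra_simps)
      have sg: "(- 1) powi (m + n) = - ((- 1) powi (- t + (m - 1 - 2 * t)) :: complex)"
        by (cases "even t"; cases "even m") (auto simp: n)
      show "- p * (case (case a of (m, n) \<Rightarrow> ((2 - 2 * m + n) div 7, (3 * m + 2 * n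
          - 3) div 7)) of (m, n) \<Rightarrow> (- 1) powi (m + n) * of_int (6 * m + 4 * n
          + 1) * (p ^ 7) powi eta4_exponent (m, n)) = ?f a"
        unfolding a prod.case d eta4_weight_def e pw sg by (simp add: n algebra_simps)
    qed (auto simp: J2_def)
    also have "\<dots> \<longleftrightarrow> ((\<lambda>(m, n). (- 1) powi (m + n) * of_int (6 * m + 4 * n
        + 1) * (p ^ 7) powi eta4_exponent (m, n)) has_sum S / (- p)) UNIV"
      by (rule has_sum_cmult_right_iff) (use p in auto)
    finally have "S / (- p) = 4 * qpoch (p ^ 7) (p ^ 7) ^ 4" by (rule eta4_branch[OF q])
    moreover have "S = - p * (S / (- p))" using p by simp
    ultimately have "S = - 4 * p * qpoch (p ^ 7) (p ^ 7) ^ 4"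
      by (metis mult.assoc mult.commute mult_minus_left)
    thus ?thesis using has_sum_infsum[OF summ, of J2] by (simp add: S_def)
  qed
  \<comment> \<open>The map (m, n) to (7m - 1, 7n + 3) multiplies both X = 6m - 1 and Y = 2n + 1 by
    7: the weight gains 7, and the exponent e becomes 49 e + (49 - 1) * 4 / 24.\<close>
  have J12: "(?f has_sum 14 * p ^ 8 * qpoch (p ^ 49) (p ^ 49) ^ 4) (J1 \<inter> J2)"
  proof -
    have "((\<lambda>x. (7 * p ^ 8) * (eta4_weight x * (p ^ 49) powi eta4_exponent x))
        has_sum (7 * p ^ 8) * (2 * qpoch (p ^ 49) (p ^ 49) ^ 4)) UNIV"
      by (intro has_sum_cmult_right eta4_has_sum Q)
    also have "?this \<longleftrightarrow> (?f has_sum (7 * p ^ 8) * (2 * qpoch (p ^ 49) (p ^ 49) ^ 4)) (J1 \<inter> J2)"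
    proof (rule has_sum_reindex_bij_witness[of _ "\<lambda>(m, n). ((m + 1) div 7, (n - 3) div 7)"
        "\<lambda>(m, n). (7 * m - 1, 7 * n + 3)"])
      fix x :: "int \<times> int"
      obtain m n where x: "x = (m, n)" by (cases x)
      have e: "eta4_exponent (7 * m - 1, 7 * n + 3) = 49 * eta4_exponent (m, n) + 8"
        using two_eta4_exponent[of m n] two_eta4_exponent[of "7 * m - 1" "7 * n + 3"]
          by (simp add: algebra_simps)
      have sg: "(- 1) powi (7 * m - 1 + (7 * n + 3)) = ((- 1) powi (m + n) :: complex)"
        by (cases "even n"; cases "even m") auto
      show "?f (case x of (m, n) \<Rightarrow> (7 * m - 1, 7 * n + 3))
          = (7 * p ^ 8) * (eta4_weight x * (p ^ 49) powi eta4_exponent x)"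
        unfolding x prod.case e pw3 eta4_weight_def sg by (simp add: algebra_simps)
    next
      fix x assume "x \<in> J1 \<inter> J2"
      then obtain m n where x: "x = (m, n)" "7 dvd 2 * m + n - 1" "7 dvd 2 * m - n - 2"
        by (auto simp: J1_def J2_def)
      hence "7 dvd m + 1" "7 dvd n - 3" by presburger+
      thus "(case case x of (m, n) \<Rightarrow> ((m + 1) div 7, (n - 3) div 7) of (m, n) \<Rightarrow> (7 * m - 1, 7 * n
          + 3)) = x"
        by (auto simp: x)
    next
      fix x :: "int \<times> int"
      obtain m n where x: "x = (m, n)" by (cases x)
      have "7 dvd 2 * (7 * m - 1) + (7 * n + 3) - 1" "7 dvd 2 * (7 * m - 1) - (7 * n + 3) - 2"
        by presburger+
      thus "(case x of (m, n) \<Rightarrow> (7 * m - 1, 7 * n + 3)) \<in> J1 \<inter> J2"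
        by (simp only: x J1_def J2_def prod.case Int_iff mem_Collect_eq simp_thms)
    qed auto
    finally show ?thesis by (simp add: mult_ac)
  qed
  have "x \<in> J1 \<union> J2 \<longleftrightarrow> eta4_exponent x mod 7 = 1" for x
  proof -
    obtain m n where x: "x = (m, n)" by (cases x)
    have "eta4_exponent x mod 7 = 1 \<longleftrightarrow> 7 dvd eta4_exponent x - 1" by presburger
    also have "\<dots> \<longleftrightarrow> 7 dvd 2 * eta4_exponent x - 2" by presburger
    \<comment> \<open>The quadratic form splits modulo 7 because -3 is congruent to 2^2; the two
      factors define \<open>J1\<close> and \<open>J2\<close>.\<close>
    also have "\<dots> \<longleftrightarrow> 7 dvd (2 * m + n - 1) * (2 * m - n - 2)"
    proof -
      have "2 * eta4_exponent x - 2 = 7 * (m * m - m) - (2 * m + n - 1) * (2 * m - n - 2)"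
        unfolding x two_eta4_exponent by (simp add: algebra_simps)
      thus ?thesis by (metis dvd_diff_right_iff dvd_triv_left)
    qed
    also have "\<dots> \<longleftrightarrow> x \<in> J1 \<union> J2"
    proof -
      have "prime (7 :: int)" by simp
      thus ?thesis by (simp add: x J1_def J2_def prime_dvd_mult_iff)
    qed
    finally show ?thesis by simp
  qed
  hence "J1 \<union> J2 = {x. eta4_exponent x mod 7 = 1}" by blast
  \<comment> \<open>Inclusion and exclusion. Up to the factor 2 of \<open>eta4_has_sum\<close>, the
    constants are the Hecke eigenvalue -4 and the -7 of weight 2.\<close>
  moreover have "(?f has_sum (- 4 * p * qpoch (p ^ 7) (p ^ 7) ^ 4 +
     (- 4 * p * qpoch (p ^ 7) (p ^ 7) ^ 4 - 14 * p ^ 8 * qpoch (p ^ 49) (p ^ 49) ^ 4))) (J1 \<union> (J2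
         - J1 \<inter> J2))"
    by (intro has_sum_Un_disjoint J1 has_sum_Diff J2 J12) auto
  moreover have "J1 \<union> (J2 - J1 \<inter> J2) = J1 \<union> J2" by blast
  ultimately show ?thesis by (simp add: algebra_simps)
qed

section \<open>Extraction of a residue class modulo 7 by roots of unity\<close>

lemma has_sum_sum:
  fixes f :: "'a \<Rightarrow> 'b \<Rightarrow> complex"
  assumes "finite I" "\<And>i. i \<in> I \<Longrightarrow> (f i has_sum s i) A"
  shows "((\<lambda>x. \<Sum>i\<in>I. f i x) has_sum (\<Sum>i\<in>I. s i)) A"
  using assms by (induction I rule: finite_induct) (auto intro!: has_sum_add)

definition zeta7 :: complex where "zeta7 = exp (2 * of_real pi * \<i> * of_nat 1 / of_nat 7)"

lemma zeta7_pow7: "zeta7 ^ 7 = 1"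
  using complex_root_unity[of 7 1] by (simp add: zeta7_def)

lemma zeta7_power_eq_1_iff: "zeta7 ^ j = 1 \<longleftrightarrow> 7 dvd j"
proof -
  have "zeta7 ^ j = exp (2 * of_real pi * \<i> * of_nat j / of_nat 7)"
    unfolding zeta7_def by (subst exp_of_nat_mult[symmetric]) (simp add: mult_ac)
  thus ?thesis using complex_root_unity_eq_1[of 7 j] by simp
qed

lemma sum_zeta7_power: "(\<Sum>k<7. (zeta7 ^ k) ^ j) = (if 7 dvd j then 7 else 0)"
proof -
  have *: "(zeta7 ^ k) ^ j = (zeta7 ^ j) ^ k" for k
    by (metis power_mult mult.commute)
  show ?thesis
  proof (cases "7 dvd j")
    case False
    hence "zeta7 ^ j \<noteq> 1" by (simp add: zeta7_power_eq_1_iff)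
    moreover have "(zeta7 ^ j) ^ 7 = 1"
      by (metis power_mult mult.commute zeta7_pow7 power_one)
    ultimately show ?thesis using False by (simp add: * sum_gp_strict)
  qed (use zeta7_power_eq_1_iff[of j] in \<open>simp add: *\<close>)
qed

text \<open>Since zeta^6 = zeta^(-1), the multiplier \<open>(zeta7 ^ k) ^ 6\<close> shifts the
  orthogonality relation so that it selects the exponents congruent to 1.\<close>

lemma sum_zeta7_powi:
  assumes "p \<noteq> 0"
  shows "(\<Sum>k<7. (zeta7 ^ k) ^ 6 * (zeta7 ^ k * p) powi e) = (if e mod 7
      = 1 then 7 * p powi e else 0)"
proof -
  have "zeta7 \<noteq> 0" by (simp add: zeta7_def)
  define r where "r = nat (e mod 7)"
  have r: "e = 7 * (e div 7) + int r" by (simp add: r_def)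
  have "(zeta7 ^ k) powi e = (zeta7 ^ k) ^ r" for k
  proof -
    have "(zeta7 ^ k) ^ 7 = 1" by (metis power_mult mult.commute zeta7_pow7 power_one)
    hence "(zeta7 ^ k) powi (7 * (e div 7)) = 1" by (subst power_int_mult) simp
    thus ?thesis using \<open>zeta7 \<noteq> 0\<close> by (subst r, subst power_int_add) auto
  qed
  hence 1: "(\<Sum>k<7. (zeta7 ^ k) ^ 6 * (zeta7 ^ k * p) powi e) = (\<Sum>k<7. (zeta7 ^ k) ^ (6
      + r)) * p powi e"
    by (simp add: power_int_mult_distrib sum_distrib_left power_add mult_ac)
  have "r < 7" by (simp add: r_def nat_less_iff)
  hence "7 dvd 6 + r \<longleftrightarrow> r = 1" by presburger
  moreover have "r = 1 \<longleftrightarrow> e mod 7 = 1" by (auto simp: r_def)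
  ultimately have "(\<Sum>k<7. (zeta7 ^ k) ^ (6 + r)) * p powi e = (if e mod 7
      = 1 then 7 * p powi e else 0)"
    by (simp add: sum_zeta7_power)
  with 1 show ?thesis by simp
qed

text \<open>The powers of the root attached to \<open>A\<close>, \<open>B\<close>, \<open>C\<close>,
  \<open>D\<close> are those of \<open>p\<close> in the dissection. Squaring twice modulo x^7 = 1
  keeps the expansion small: \<open>S0\<close> to \<open>S6\<close> are the coefficients of the
  square, \<open>R0\<close> to \<open>R6\<close> those of the fourth power times x^6, and only
  \<open>R0\<close> survives the summation.\<close>

lemma sum_zeta7_fourth_power:
  fixes A B C D :: complex
  shows "(\<Sum>k<7. (zeta7 ^ k) ^ 6 * (A + zeta7 ^ k * B + (zeta7 ^ k) ^ 5 * C
      + (zeta7 ^ k) ^ 2 * D) ^ 4) =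
     7 * (4 * (A ^ 3 * B + B ^ 3 * C + A * C ^ 3) + 24 * A * B * C * D + D ^ 4)"
proof -
  define S0 S1 S2 S3 S4 S5 S6 where S: "S0 = A ^ 2 + 2 * C * D" "S1 = 2 * A * B"
      "S2 = B ^ 2 + 2 * A * D"
    "S3 = C ^ 2 + 2 * B * D" "S4 = D ^ 2" "S5 = 2 * A * C" "S6 = 2 * B * C"
  define R1 R2 R3 R4 R5 R6 where R:
    "R1 = 2 * S0 * S2 + S1 ^ 2 + 2 * S3 * S6 + 2 * S4 * S5"
    "R2 = 2 * S0 * S3 + 2 * S1 * S2 + 2 * S4 * S6 + S5 ^ 2"
    "R3 = 2 * S0 * S4 + 2 * S1 * S3 + S2 ^ 2 + 2 * S5 * S6"
    "R4 = 2 * S0 * S5 + 2 * S1 * S4 + 2 * S2 * S3 + S6 ^ 2"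
    "R5 = 2 * S0 * S6 + 2 * S1 * S5 + 2 * S2 * S4 + S3 ^ 2"
    "R6 = S0 ^ 2 + 2 * S1 * S6 + 2 * S2 * S5 + 2 * S3 * S4"
  define R0 where "R0 = 2 * (S0 * S1 + S2 * S6 + S3 * S5) + S4 ^ 2"
  have "x ^ 6 * (A + x * B + x ^ 5 * C + x ^ 2 * D) ^ 4 =
     R0 + R1 * x ^ 1 + R2 * x ^ 2 + R3 * x ^ 3 + R4 * x ^ 4 + R5 * x ^ 5 + R6 * x ^ 6" if x: "x ^ 7
         = 1" for x
  proof -
    have sq: "(A + x * B + x ^ 5 * C + x ^ 2 * D) ^ 2 = S0 + S1 * x + S2 * x ^ 2 + S3 * x ^ 3
        + S4 * x ^ 4 + S5 * x ^ 5 + S6 * x ^ 6"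
      using x unfolding S by algebra
    have sq2: "x ^ 6 * (S0 + S1 * x + S2 * x ^ 2 + S3 * x ^ 3 + S4 * x ^ 4 + S5 * x ^ 5
        + S6 * x ^ 6) ^ 2 =
        R0 + R1 * x ^ 1 + R2 * x ^ 2 + R3 * x ^ 3 + R4 * x ^ 4 + R5 * x ^ 5 + R6 * x ^ 6"
      using x unfolding R R0_def by algebra
    have "(A + x * B + x ^ 5 * C + x ^ 2 * D) ^ 4 = ((A + x * B + x ^ 5 * C + x ^ 2 * D) ^ 2) ^ 2"
      by (simp flip: power_mult)
    thus ?thesis using sq sq2 by simp
  qed
  moreover have "(zeta7 ^ k) ^ 7 = 1" for k by (metis power_mult mult.commute zeta7_pow7 power_one)
  ultimately have "(\<Sum>k<7. (zeta7 ^ k) ^ 6 * (A + zeta7 ^ k * B + (zeta7 ^ k) ^ 5 * C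
      + (zeta7 ^ k) ^ 2 * D) ^ 4) =
     (\<Sum>k<7. R0 * (zeta7 ^ k) ^ 0 + R1 * (zeta7 ^ k) ^ 1 + R2 * (zeta7 ^ k) ^ 2
         + R3 * (zeta7 ^ k) ^ 3 +
       R4 * (zeta7 ^ k) ^ 4 + R5 * (zeta7 ^ k) ^ 5 + R6 * (zeta7 ^ k) ^ 6)"
    by simp
  also have "\<dots> = 7 * R0"
    by (simp only: sum.distrib sum_distrib_left[symmetric] sum_zeta7_power) simp
  also have "R0 = 4 * (A ^ 3 * B + B ^ 3 * C + A * C ^ 3) + 24 * A * B * C * D + D ^ 4"
    unfolding R0_def S by algebra
  finally show ?thesis .
qed

text \<open>Compare the two expressions for the terms of exponent \<open>1\<close> modulo \<open>7\<close> in the fourth power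
  of the Euler product in \<open>p\<close>, where \<open>p ^ 7 = q\<close>:
  the one from the dissection and the one from the Hecke relation.\<close>

theorem klein_identity:
  assumes q: "norm q < 1" "q \<noteq> 0" and Q: "Q = q ^ 7"
    and abc: "a = theta Q q" "b = theta Q (q ^ 2)" "c = theta Q (q ^ 3)"
  shows "b ^ 2 * c / a ^ 3 + q * (c ^ 2 * a / b ^ 3) - q ^ 2 * (a ^ 2 * b / c ^ 3) =
    8 * q + (qpoch q q / qpoch Q Q) ^ 4"
proof -
  obtain p where p7: "p ^ 7 = q" using exists_complex_root[of 7 q] by auto
  have p: "norm p < 1" "p \<noteq> 0"
    using q p7 power_less_one_iff[of "norm p" 7] by (auto simp flip: norm_power)
  have Q': "norm Q < 1" "Q \<noteq> 0" using q by (simp_all add: Q norm_power power_less_one_iff)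
  have Tn: "theta Q (q ^ r) \<noteq> 0" if "r > 0" "r < 7" for r
    using q that Q' by (intro theta_nonzero) (auto simp: Q norm_power power_less_one_iff
        power_strict_decreasing)
  have nz: "a \<noteq> 0" "b \<noteq> 0" "c \<noteq> 0" using Tn[of 1] Tn[of 2] Tn[of 3] by (simp_all add: abc)
  define F where "F = qpoch Q Q"
  have F0: "F \<noteq> 0" using Q' by (simp add: F_def qpoch_nonzero')
  define A where "A = F * (b / a)"
  define B C D where "B = - p * F * (c / b)" and "C = p ^ 5 * F * (a / c)" and "D = - (p ^ 2) * F"
  note ABCD = A_def B_def C_def D_def
  have z1: "norm (zeta7 ^ k) = 1" for k
  proof -
    have "norm zeta7 ^ 7 = 1 ^ 7" by (metis norm_one norm_power zeta7_pow7 power_one)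
    hence "norm zeta7 = 1" by (subst (asm) power_eq_iff_eq_base) auto
    thus ?thesis by (simp add: norm_power)
  qed
  have xp: "norm (zeta7 ^ k * p) < 1" "zeta7 ^ k * p \<noteq> 0" for k
    using p z1[of k] by (simp_all add: norm_mult zeta7_def)
  \<comment> \<open>Rotating \<open>p\<close> by a seventh root of unity leaves \<open>q\<close>,
    hence \<open>a\<close>, \<open>b\<close>, \<open>c\<close> and \<open>F\<close>, unchanged; only
    the explicit powers of \<open>p\<close> rotate.\<close>
  have f: "qpoch (zeta7 ^ k * p) (zeta7 ^ k * p) = A + zeta7 ^ k * B + (zeta7 ^ k) ^ 5 * C
      + (zeta7 ^ k) ^ 2 * D" for k
  proof -
    have "(zeta7 ^ k) ^ 7 = 1" by (metis power_mult mult.commute zeta7_pow7 power_one)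
    hence "q = (zeta7 ^ k * p) ^ 7" by (simp add: p7 power_mult_distrib)
    from euler_dissection[OF xp this Q] show ?thesis
      by (simp add: ABCD abc F_def algebra_simps power_mult_distrib)
  qed
  have "((\<lambda>y. \<Sum>k<7. (zeta7 ^ k) ^ 6 * (eta4_weight y * (zeta7 ^ k * p) powi eta4_exponent y))
      has_sum
      (\<Sum>k<7. (zeta7 ^ k) ^ 6 * (2 * qpoch (zeta7 ^ k * p) (zeta7 ^ k * p) ^ 4))) UNIV"
    by (intro has_sum_sum has_sum_cmult_right eta4_has_sum xp) auto
  also have "(\<lambda>y. \<Sum>k<7. (zeta7 ^ k) ^ 6 * (eta4_weight y * (zeta7 ^ k * p) powi eta4_exponent y)) =
     (\<lambda>y. if eta4_exponent y mod 7 = 1 then 7 * (eta4_weight y * p powi eta4_exponent y) else 0)"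
  proof
    fix y
    have "(\<Sum>k<7. (zeta7 ^ k) ^ 6 * (eta4_weight y * (zeta7 ^ k * p) powi eta4_exponent y)) =
       eta4_weight y * (\<Sum>k<7. (zeta7 ^ k) ^ 6 * (zeta7 ^ k * p) powi eta4_exponent y)"
      by (simp add: sum_distrib_left mult_ac)
    thus "(\<Sum>k<7. (zeta7 ^ k) ^ 6 * (eta4_weight y * (zeta7 ^ k * p) powi eta4_exponent y)) =
      (if eta4_exponent y mod 7 = 1 then 7 * (eta4_weight y * p powi eta4_exponent y) else 0)"
      by (simp add: sum_zeta7_powi[OF p(2)])
  qed
  also have "(\<Sum>k<7. (zeta7 ^ k) ^ 6 * (2 * qpoch (zeta7 ^ k * p) (zeta7 ^ k * p) ^ 4)) =
      2 * (7 * (4 * (A ^ 3 * B + B ^ 3 * C + A * C ^ 3) + 24 * A * B * C * D + D ^ 4))"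
    unfolding f sum_zeta7_fourth_power[symmetric] sum_distrib_left by (simp add: mult_ac)
  finally have hs: "((\<lambda>y. 7 * (eta4_weight y * p powi eta4_exponent y)) has_sum
      2 * (7 * (4 * (A ^ 3 * B + B ^ 3 * C + A * C ^ 3) + 24 * A * B * C * D
          + D ^ 4))) {y. eta4_exponent y mod 7 = 1}"
    by (rule has_sum_cong_neutral[THEN iffD1, rotated -1]) auto
  have main: "4 * (A ^ 3 * B + B ^ 3 * C + A * C ^ 3) + 24 * A * B * C * D + D ^ 4 =
     - 4 * p * qpoch q q ^ 4 - 7 * p ^ 8 * F ^ 4"
  proof -
    have "p ^ 49 = Q" by (simp add: Q flip: p7 power_mult)
    hence "14 * (4 * (A ^ 3 * B + B ^ 3 * C + A * C ^ 3) + 24 * A * B * C * D + D ^ 4) =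
     14 * (- 4 * p * qpoch q q ^ 4 - 7 * p ^ 8 * F ^ 4)"
      using has_sum_unique[OF hs has_sum_cmult_right[OF eta4_hecke[OF p], of 7]]
      by (simp add: p7 F_def algebra_simps)
    thus ?thesis by (subst (asm) mult_left_cancel) auto
  qed
  have p8: "p ^ 8 = p * q" "p ^ 15 = p * q ^ 2"
    unfolding p7[symmetric] by (simp_all flip: power_Suc power_mult)
  have X1: "A ^ 3 * B = - p * F ^ 4 * (b ^ 2 * c / a ^ 3)"
    using nz by (simp add: ABCD power_divide power_mult_distrib field_simps eval_nat_numeral)
  have X2: "B ^ 3 * C = - (p ^ 8) * F ^ 4 * (c ^ 2 * a / b ^ 3)"
    using nz by (simp add: ABCD power_divide power_mult_distrib field_simps eval_nat_numeral)
  have X3: "A * C ^ 3 = p ^ 15 * F ^ 4 * (a ^ 2 * b / c ^ 3)"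
    using nz by (simp add: ABCD power_divide power_mult_distrib field_simps eval_nat_numeral)
  have X4: "A * B * C * D = p ^ 8 * F ^ 4" "D ^ 4 = p ^ 8 * F ^ 4"
    using nz by (simp_all add: ABCD power_divide power_mult_distrib field_simps eval_nat_numeral)
  have "4 * (A ^ 3 * B + B ^ 3 * C + A * C ^ 3) + 24 * (A * B * C * D) + D ^ 4 =
     - 4 * p * qpoch q q ^ 4 - 7 * p ^ 8 * F ^ 4"
    using main by (simp add: mult.assoc)
  hence "p * F ^ 4 * (- 4 * (b ^ 2 * c / a ^ 3) - 4 * q * (c ^ 2 * a / b ^ 3)
      + 4 * q ^ 2 * (a ^ 2 * b / c ^ 3) + 32 * q)
      = - 4 * p * qpoch q q ^ 4"
    unfolding X1 X2 X3 X4 p8 by (simp add: algebra_simps)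
  also have "\<dots> = p * F ^ 4 * (- 4 * (qpoch q q / qpoch Q Q) ^ 4)"
    using F0 by (simp add: F_def power_divide)
  finally have eq: "p * F ^ 4 * (- 4 * (b ^ 2 * c / a ^ 3) - 4 * q * (c ^ 2 * a / b ^ 3)
      + 4 * q ^ 2 * (a ^ 2 * b / c ^ 3) + 32 * q)
      = p * F ^ 4 * (- 4 * (qpoch q q / qpoch Q Q) ^ 4)" .
  have "p * F ^ 4 \<noteq> 0" using p F0 by simp
  with eq have "- 4 * (b ^ 2 * c / a ^ 3) - 4 * q * (c ^ 2 * a / b ^ 3)
      + 4 * q ^ 2 * (a ^ 2 * b / c ^ 3) + 32 * q =
     - 4 * (qpoch q q / qpoch Q Q) ^ 4"
    by (simp only: mult_left_cancel simp_thms)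
  hence "4 * (b ^ 2 * c / a ^ 3 + q * (c ^ 2 * a / b ^ 3) - q ^ 2 * (a ^ 2 * b / c ^ 3)) =
    4 * (8 * q + (qpoch q q / qpoch Q Q) ^ 4)"
    by (simp add: algebra_simps)
  thus ?thesis by (subst (asm) mult_left_cancel) auto
qed

section \<open>The Lambert series of weight 3\<close>

definition int_conv :: "(int \<Rightarrow> complex) \<Rightarrow> (int \<Rightarrow> complex) \<Rightarrow> int \<Rightarrow> complex" where
  "int_conv u v k = (\<Sum>\<^sub>\<infinity>n. u n * v (k - n))"

lemma
  fixes u v :: "int \<Rightarrow> complex"
  assumes "(u has_sum a) UNIV" "(v has_sum b) UNIV"
  shows summable_int_conv: "(\<lambda>n. u n * v (k - n)) summable_on UNIV"
    and has_sum_int_conv: "(int_conv u v has_sum a * b) UNIV"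
proof -
  have "((\<lambda>(x, y). u x * v y) has_sum a * b) (UNIV \<times> UNIV)"
    by (rule has_sum_times[OF assms])
  also have "?this \<longleftrightarrow> ((\<lambda>(k, n). u n * v (k - n)) has_sum a * b) (UNIV \<times> UNIV)"
    by (rule has_sum_reindex_bij_witness[of _ "\<lambda>(k, n). (n, k - n)" "\<lambda>(x, y). (x + y, x)"]) auto
  finally have *: "((\<lambda>(k, n). u n * v (k - n)) has_sum a * b) (UNIV \<times> UNIV)" .
  show **: "(\<lambda>n. u n * v (k - n)) summable_on UNIV" for k
    using summable_on_SigmaD1[OF has_sum_imp_summable[OF *], of k] by simp
  show "(int_conv u v has_sum a * b) UNIV"
    by (rule has_sum_SigmaD[OF *]) (auto simp: int_conv_def intro!: has_sum_infsum **)
qed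

lemma int_conv_powi:
  assumes "z \<noteq> 0"
  shows "int_conv (\<lambda>n. u n * z powi n) (\<lambda>n. v n * z powi n) k = int_conv u v k * z powi k"
proof -
  have "u n * z powi n * (v (k - n) * z powi (k - n)) = (u n * v (k - n)) * z powi k" for n
    using assms by (simp add: power_int_diff field_simps)
  thus ?thesis unfolding int_conv_def by (simp only: infsum_cmult_left')
qed

lemma has_sum_int_conv_powi:
  assumes "((\<lambda>n. u n * z powi n) has_sum a) UNIV" "((\<lambda>n. v n * z powi n) has_sum b) UNIV" "z \<noteq> 0"
  shows "((\<lambda>n. int_conv u v n * z powi n) has_sum a * b) UNIV"
proof -
  have "int_conv (\<lambda>n. u n * z powi n) (\<lambda>n. v n * z powi n) = (\<lambda>n. int_conv u v n * z powi n)"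
    by (rule ext, rule int_conv_powi[OF assms(3)])
  thus ?thesis using has_sum_int_conv[OF assms(1,2)] by simp
qed

lemma summable_int_conv_powi:
  fixes u v :: "int \<Rightarrow> complex"
  assumes "((\<lambda>n. u n * z powi n) has_sum a) UNIV" "((\<lambda>n. v n * z powi n) has_sum b) UNIV" "z \<noteq> 0"
  shows "(\<lambda>n. u n * v (k - n)) summable_on UNIV"
proof -
  have "(\<lambda>n. u n * z powi n * (v (k - n) * z powi (k - n)) * z powi (- k)) summable_on UNIV"
    by (rule summable_on_cmult_left[OF summable_int_conv[OF assms(1,2)]])
  also have "(\<lambda>n. u n * z powi n * (v (k - n) * z powi (k - n)) * z powi (- k)) = (\<lambda>n. u n * v (k
      - n))"
    using assms(3) by (auto simp: power_int_diff power_int_minus field_simps fun_eq_iff)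
  finally show ?thesis .
qed

lemma rapid_has_sum:
  assumes "rapid u" "z \<noteq> 0"
  shows "((\<lambda>n. u n * z powi n) has_sum infsum (\<lambda>n. u n * z powi n) UNIV) UNIV"
  by (rule has_sum_infsum[OF rapid_summable[OF assms]])

lemma rapid_has_sum1:
  assumes "rapid u"
  shows "(u has_sum infsum u UNIV) UNIV"
  using rapid_has_sum[OF assms, of 1] by simp

text \<open>The weights r^n are multiplicative, so at each radius the convolution is dominated by
  that of the absolute values. These are cast to complex numbers so that
  \<open>has_sum_int_conv\<close> applies to them.\<close>

lemma rapid_int_conv:
  assumes "rapid u" "rapid v"
  shows "rapid (int_conv u v)"
  unfolding rapid_def
proof safe
  fix r :: real assume r: "r > 0"
  define U V where "U n = complex_of_real (norm (u n) * r powi n)" and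
      "V n = complex_of_real (norm (v n) * r powi n)" for n
  have UV: "U summable_on UNIV" "V summable_on UNIV"
    unfolding U_def V_def by (rule summable_on_of_real, use assms r in \<open>simp add: rapid_def\<close>)+
  note hs = has_sum_infsum[OF UV(1)] has_sum_infsum[OF UV(2)]
  have "(\<lambda>k. norm (int_conv U V k)) summable_on UNIV"
    using has_sum_imp_summable[OF has_sum_int_conv[OF hs]] summable_on_iff_abs_summable_on_complex
      by blast
  thus "(\<lambda>k. norm (int_conv u v k) * r powi k) summable_on UNIV"
  proof (rule summable_on_comparison_test)
    fix k
    let ?g = "\<lambda>n. (norm (u n) * r powi n) * (norm (v (k - n)) * r powi (k - n))"
    have g: "U n * V (k - n) = complex_of_real (?g n)" for n by (simp add: U_def V_def)
    have g_summ: "?g summable_on UNIV"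
    proof -
      have "(\<lambda>n. norm (U n * V (k - n))) summable_on UNIV"
        by (rule summable_on_iff_abs_summable_on_complex[THEN iffD1, OF summable_int_conv[OF hs]])
      thus ?thesis using r unfolding g norm_of_real by (simp add: abs_mult)
    qed
    have int_conv_eq: "int_conv U V k = complex_of_real (infsum ?g UNIV)"
      unfolding int_conv_def g using has_sum_of_real[OF has_sum_infsum[OF g_summ]] by (rule infsumI)
    have "norm (int_conv u v k) * r powi k = norm (int_conv u v k * of_real r powi k)"
      using r by (simp add: norm_mult norm_power_int)
    also have "\<dots> = norm (\<Sum>\<^sub>\<infinity>n. u n * of_real r powi n * (v (k - n) * of_real r powi (k - n)))"
      using int_conv_powi[of "of_real r" u v k] r by (simp add: int_conv_def)
    also have "\<dots> \<le> (\<Sum>\<^sub>\<infinity>n. norm (u n * of_real r powi n * (v (k - n) * of_real r powi (k - n))))"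
      by (rule norm_infsum_bound) (use g_summ r in \<open>simp add: norm_mult norm_power_int\<close>)
    also have "\<dots> = infsum ?g UNIV" using r by (simp add: norm_mult norm_power_int)
    also have "\<dots> \<le> norm (int_conv U V k)" unfolding int_conv_eq norm_of_real by simp
    finally show "norm (int_conv u v k) * r powi k \<le> norm (int_conv U V k)" .
  qed (use r in auto)
qed

text \<open>On Laurent coefficients this is the derivation \<open>z d/dz\<close>; the moments computed with it
  encode the fourfold zero of \<open>theta q z ^ 4\<close> at \<open>z = 1\<close>.\<close>

definition index_mult :: "(int \<Rightarrow> complex) \<Rightarrow> int \<Rightarrow> complex" where
  "index_mult u n = of_int n * u n"

lemma rapid_index_mult: "rapid u \<Longrightarrow> rapid (index_mult u)"
  using rapid_of_int_mult[of u] by (simp add: index_mult_def[abs_def])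

lemma infsum_int_conv:
  assumes "rapid u" "rapid v"
  shows "infsum (int_conv u v) UNIV = infsum u UNIV * infsum v UNIV"
  by (rule infsumI[OF has_sum_int_conv[OF rapid_has_sum1[OF assms(1)] rapid_has_sum1[OF assms(2)]]])

lemma index_mult_int_conv:
  assumes "rapid u" "rapid v"
  shows "index_mult (int_conv u v) k = int_conv (index_mult u) v k + int_conv u (index_mult v) k"
proof -
  have "int_conv (index_mult u) v k + int_conv u (index_mult v) k = (\<Sum>\<^sub>\<infinity>n. index_mult u n * v (k
      - n) + u n * index_mult v (k - n))"
    unfolding int_conv_def
    by (intro infsum_add[symmetric] summable_int_conv[OF rapid_has_sum1 rapid_has_sum1]
        rapid_index_mult assms)
  also have "\<dots> = (\<Sum>\<^sub>\<infinity>n. of_int k * (u n * v (k - n)))"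
    by (simp add: index_mult_def algebra_simps)
  also have "\<dots> = index_mult (int_conv u v) k"
    by (simp add: infsum_cmult_right' index_mult_def int_conv_def)
  finally show ?thesis ..
qed

lemma infsum_index_mult_int_conv:
  assumes "rapid u" "rapid v"
  shows "infsum (index_mult (int_conv u v)) UNIV = infsum (index_mult u) UNIV * infsum v UNIV
      + infsum u UNIV * infsum (index_mult v) UNIV"
proof -
  have "infsum (index_mult (int_conv u v)) UNIV = infsum (\<lambda>k. int_conv (index_mult u) v k
      + int_conv u (index_mult v) k) UNIV"
    by (rule infsum_cong) (rule index_mult_int_conv[OF assms])
  also have "\<dots> = infsum (int_conv (index_mult u) v) UNIV + infsum (int_conv u (index_mult v)) UNIV"
    by (intro infsum_add has_sum_imp_summable[OF rapid_has_sum1] rapid_int_conv rapid_index_mult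
        assms)
  finally show ?thesis by (simp add: infsum_int_conv rapid_index_mult assms)
qed

lemma infsum_index_mult2_int_conv:
  assumes "rapid u" "rapid v"
  shows "infsum (index_mult (index_mult (int_conv u v))) UNIV
      = infsum (index_mult (index_mult u)) UNIV * infsum v UNIV
    + 2 * infsum (index_mult u) UNIV * infsum (index_mult v) UNIV
        + infsum u UNIV * infsum (index_mult (index_mult v)) UNIV"
proof -
  have "index_mult (index_mult (int_conv u v)) k = index_mult (int_conv (index_mult u) v) k
      + index_mult (int_conv u (index_mult v)) k" for k
  proof -
    have "index_mult (index_mult (int_conv u v)) k = of_int k * index_mult (int_conv u v) k"
      by (simp add: index_mult_def)
    also have "\<dots> = of_int k * (int_conv (index_mult u) v k + int_conv u (index_mult v) k)"
      by (simp only: index_mult_int_conv[OF assms])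
    finally show ?thesis by (simp add: index_mult_def distrib_left)
  qed
  hence "infsum (index_mult (index_mult (int_conv u v))) UNIV
      = infsum (\<lambda>k. index_mult (int_conv (index_mult u) v) k
      + index_mult (int_conv u (index_mult v)) k) UNIV"
    by (rule infsum_cong)
  also have "\<dots> = infsum (index_mult (int_conv (index_mult u) v)) UNIV
      + infsum (index_mult (int_conv u (index_mult v))) UNIV"
    by (intro infsum_add has_sum_imp_summable[OF rapid_has_sum1] rapid_int_conv rapid_index_mult
        assms)
  finally show ?thesis by (simp add: infsum_index_mult_int_conv rapid_index_mult assms)
qed

section \<open>Laurent coefficients of the fourth power of theta\<close>

definition theta4_coeff :: "complex \<Rightarrow> int \<Rightarrow> complex" where
  "theta4_coeff q = int_conv (int_conv (theta_coeff q) (theta_coeff q)) (int_conv (theta_coeff q)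
      (theta_coeff q))"

lemma rapid_theta4_coeff: "norm q < 1 \<Longrightarrow> q \<noteq> 0 \<Longrightarrow> rapid (theta4_coeff q)"
  unfolding theta4_coeff_def by (intro rapid_int_conv rapid_theta_coeff)

lemma theta4_coeff_has_sum:
  assumes "norm q < 1" "q \<noteq> 0" "z \<noteq> 0"
  shows "((\<lambda>n. theta4_coeff q n * z powi n) has_sum theta q z ^ 4) UNIV"
proof -
  have "((\<lambda>n. theta4_coeff q n * z powi n) has_sum (theta q z * theta q z) * (theta q z * theta q
      z)) UNIV"
    unfolding theta4_coeff_def by (intro has_sum_int_conv_powi theta_has_sum assms)
  thus ?thesis by (simp add: eval_nat_numeral mult_ac)
qed

lemma theta2_coeff_shift:
  assumes "q \<noteq> 0"
  shows "int_conv (theta_coeff q) (theta_coeff q) (k + 2)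
      = q powi k * int_conv (theta_coeff q) (theta_coeff q) k"
proof -
  have "int_conv (theta_coeff q) (theta_coeff q) (k + 2)
      = (\<Sum>\<^sub>\<infinity>n. q powi k * (theta_coeff q n * theta_coeff q (k - n)))"
    unfolding int_conv_def
  proof (rule infsum_reindex_bij_witness[of _ "\<lambda>n. n + 1" "\<lambda>n. n - 1"])
    fix n
    have "theta_coeff q n = - (q powi (n - 1)) * theta_coeff q (n - 1)"
        "theta_coeff q (k + 2 - n) = - (q powi (k - (n - 1))) * theta_coeff q (k - (n - 1))"
      using theta_coeff_shift[OF assms, of "n - 1"] theta_coeff_shift[OF assms, of "k - (n - 1)"]
        by (simp_all add: algebra_simps)
    moreover have "q powi k = q powi (n - 1) * q powi (k - (n - 1))"
      using assms by (simp flip: power_int_add)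
    ultimately show "q powi k * (theta_coeff q (n - 1) * theta_coeff q (k - (n - 1)))
        = theta_coeff q n * theta_coeff q (k + 2 - n)"
      by simp
  qed auto
  thus ?thesis by (simp add: infsum_cmult_right' int_conv_def)
qed

lemma theta2_coeff_refl:
    "int_conv (theta_coeff q) (theta_coeff q) (2 - k) = int_conv (theta_coeff q) (theta_coeff q) k"
  unfolding int_conv_def
proof (rule infsum_reindex_bij_witness[of _ "\<lambda>n. 1 - n" "\<lambda>n. 1 - n"])
  fix n
  show "theta_coeff q (1 - n) * theta_coeff q (k - (1 - n)) = theta_coeff q n * theta_coeff q (2 - k
      - n)"
    using theta_coeff_refl[of q n] theta_coeff_refl[of q "2 - k - n"] by (simp add: algebra_simps)
qed auto

text \<open>Coefficient form of the quasi-periodicity: replacing z by q z divides the fourth power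
  of theta by z^4.\<close>

lemma theta4_coeff_shift:
  assumes "q \<noteq> 0"
  shows "theta4_coeff q (k + 4) = q powi k * theta4_coeff q k"
proof -
  define s where "s = int_conv (theta_coeff q) (theta_coeff q)"
  have "int_conv s s (k + 4) = (\<Sum>\<^sub>\<infinity>n. q powi k * (s n * s (k - n)))"
    unfolding int_conv_def
  proof (rule infsum_reindex_bij_witness[of _ "\<lambda>n. n + 2" "\<lambda>n. n - 2"])
    fix n
    have "s n = q powi (n - 2) * s (n - 2)" "s (k + 4 - n) = q powi (k - (n - 2)) * s (k - (n - 2))"
      using theta2_coeff_shift[OF assms, of "n - 2"] theta2_coeff_shift[OF assms, of "k - (n - 2)"]
        by (simp_all add: s_def algebra_simps)
    moreover have "q powi k = q powi (n - 2) * q powi (k - (n - 2))"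
      using assms by (simp flip: power_int_add)
    ultimately show "q powi k * (s (n - 2) * s (k - (n - 2))) = s n * s (k + 4 - n)"
      by simp
  qed auto
  thus ?thesis by (simp add: infsum_cmult_right' int_conv_def theta4_coeff_def s_def)
qed

lemma theta4_coeff_refl: "theta4_coeff q (4 - k) = theta4_coeff q k"
proof -
  define s where "s = int_conv (theta_coeff q) (theta_coeff q)"
  have "int_conv s s (4 - k) = int_conv s s k"
    unfolding int_conv_def
  proof (rule infsum_reindex_bij_witness[of _ "\<lambda>n. 2 - n" "\<lambda>n. 2 - n"])
    fix n
    show "s (2 - n) * s (k - (2 - n)) = s n * s (4 - k - n)"
      using theta2_coeff_refl[of q n] theta2_coeff_refl[of q "4 - k - n"]
        by (simp add: s_def algebra_simps)
  qed auto
  thus ?thesis by (simp add: theta4_coeff_def s_def)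
qed

text \<open>By the Leibniz rule and \<open>theta q 1 = 0\<close>, the moments of order 0 and 1 of
  the square vanish; each term of a moment of order at most 2 of the fourth power contains one of
  them.\<close>

lemma theta4_coeff_moments:
  assumes "norm q < 1" "q \<noteq> 0"
  shows "infsum (theta4_coeff q) UNIV = 0" "infsum (index_mult (theta4_coeff q)) UNIV = 0"
      "infsum (index_mult (index_mult (theta4_coeff q))) UNIV = 0"
proof -
  have "qpoch 1 q = 0" using qpoch_rec[OF assms(1), of 1] by simp
  hence "theta q 1 = 0" using assms by (simp add: jacobi_triple_product)
  hence c0: "infsum (theta_coeff q) UNIV = 0" by (simp add: theta_def)
  note g = rapid_theta_coeff[OF assms] and g2
      = rapid_int_conv[OF rapid_theta_coeff[OF assms] rapid_theta_coeff[OF assms]]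
  show "infsum (theta4_coeff q) UNIV = 0" "infsum (index_mult (theta4_coeff q)) UNIV = 0"
      "infsum (index_mult (index_mult (theta4_coeff q))) UNIV = 0"
    unfolding theta4_coeff_def
      by (simp_all add: infsum_int_conv infsum_index_mult_int_conv infsum_index_mult2_int_conv g g2
        c0)
qed

text \<open>Writing d = M - n expresses the sum through the three vanishing moments. It is the error
  term in both functional equations of \<open>lambert_sum_theta_proportional\<close>: the triple
  pole of the Lambert series is cancelled by the fourfold zero.\<close>

lemma theta4_coeff_square_moment:
  assumes "norm q < 1" "q \<noteq> 0"
  shows "(\<Sum>\<^sub>\<infinity>d. of_int d ^ 2 * theta4_coeff q (M - d)) = 0"
proof -
  note g = rapid_theta4_coeff[OF assms]
  note m = theta4_coeff_moments[OF assms]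
  have h: "((\<lambda>n. of_int M ^ 2 * theta4_coeff q n + (- 2 * of_int M) * index_mult (theta4_coeff q) n
      + index_mult (index_mult (theta4_coeff q)) n) has_sum
     of_int M ^ 2 * infsum (theta4_coeff q) UNIV
         + (- 2 * of_int M) * infsum (index_mult (theta4_coeff q)) UNIV
         + infsum (index_mult (index_mult (theta4_coeff q))) UNIV) UNIV"
    by (intro has_sum_add has_sum_cmult_right rapid_has_sum1 rapid_index_mult g)
  have "(\<Sum>\<^sub>\<infinity>d. of_int d ^ 2 * theta4_coeff q (M - d)) =
      (\<Sum>\<^sub>\<infinity>n. of_int M ^ 2 * theta4_coeff q n + (- 2 * of_int M) * index_mult (theta4_coeff q) n
          + index_mult (index_mult (theta4_coeff q)) n)"
    by (rule infsum_reindex_bij_witness[of _ "\<lambda>d. M - d" "\<lambda>d. M - d"])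
       (auto simp: index_mult_def power2_eq_square algebra_simps)
  also have "\<dots> = 0" using infsumI[OF h] by (simp add: m)
  finally show ?thesis .
qed

text \<open>The value at \<open>d = 0\<close> is \<open>0 / 0 = 0\<close>, as it should be.\<close>

definition lambert_coeff :: "complex \<Rightarrow> int \<Rightarrow> complex" where
  "lambert_coeff q d = of_int d ^ 2 / (1 - q powi d)"

lemma powi_neq_1:
  assumes "norm q < 1" "q \<noteq> 0" "d \<noteq> 0"
  shows "(q :: complex) powi d \<noteq> 1"
proof
  assume *: "q powi d = 1"
  have "norm q ^ nat \<bar>d\<bar> = 1"
  proof (cases "d \<ge> 0")
    case True
    thus ?thesis using arg_cong[OF *, of norm] by (simp add: norm_power power_int_nonneg_exp)
  next
    case False
    hence "q powi (- d) = 1" using * by (simp add: power_int_minus)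
    hence "q ^ nat (- d) = 1" using False by (simp add: power_int_nonneg_exp)
    thus ?thesis using False by (simp flip: norm_power)
  qed
  moreover have "nat \<bar>d\<bar> > 0" using assms(3) by simp
  ultimately show False using power_less_one_iff[of "norm q" "nat \<bar>d\<bar>"] assms(1) by simp
qed

text \<open>Clears the denominator; at d = 0 both sides are 0. The d^2 on the right is what
  \<open>theta4_coeff_square_moment\<close> disposes of.\<close>

lemma lambert_coeff_mult:
  assumes "norm q < 1" "q \<noteq> 0"
  shows "lambert_coeff q d - q powi d * lambert_coeff q d = of_int d ^ 2"
proof (cases "d = 0")
  case False
  hence "lambert_coeff q d * (1 - q powi d) = of_int d ^ 2" using powi_neq_1[OF assms False]
    by (simp add: lambert_coeff_def)
  thus ?thesis by (simp add: algebra_simps)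
qed (simp add: lambert_coeff_def)

lemma lambert_coeff_uminus:
  assumes "norm q < 1" "q \<noteq> 0"
  shows "lambert_coeff q (- d) = of_int d ^ 2 - lambert_coeff q d"
proof (cases "d = 0")
  case False
  thus ?thesis using powi_neq_1[OF assms False] assms
    by (simp add: lambert_coeff_def power_int_minus field_simps)
qed (simp add: lambert_coeff_def)

text \<open>The nonnegative half of the Laurent series with coefficients
  \<open>lambert_coeff\<close>, defined on the full unit disc; the term d = 0 is again 0 / 0 =
  0.\<close>

definition lambert_sum :: "complex \<Rightarrow> complex \<Rightarrow> complex" where
  "lambert_sum q x = (\<Sum>d. of_nat d ^ 2 / (1 - q ^ d) * x ^ d)"

lemma summable_square_geometric:
  fixes x :: real
  assumes "0 \<le> x" "x < 1"
  shows "summable (\<lambda>d. real d ^ 2 * x ^ d)"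
proof -
  \<comment> \<open>Splitting x^d as y^d * y^d gives each factor d a convergence factor of its own:
    one d y^d is bounded, the other is summable.\<close>
  define y where "y = sqrt x"
  have y: "0 \<le> y" "y < 1" "y ^ 2 = x" using assms by (auto simp: y_def)
  have lim: "(\<lambda>n. real n * y ^ n) \<longlonglongrightarrow> 0"
    using powser_times_n_limit_0[of y] y by simp
  then obtain B where B: "\<And>n. norm (real n * y ^ n) \<le> B"
    using convergent_imp_Bseq[of "\<lambda>n. real n * y ^ n"] by (auto simp: convergent_def Bseq_def)
  have "summable (\<lambda>n. real (Suc n) * y ^ n)"
    using geometric_deriv_sums[of y] y by (auto simp: sums_iff)
  hence "summable (\<lambda>n. B * (real (Suc n) * y ^ n))" by (rule summable_mult)
  thus ?thesis
  proof (rule summable_comparison_test[rotated], intro exI allI impI)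
    fix n
    have "norm (real n ^ 2 * x ^ n) = (real n * y ^ n) * (real n * y ^ n)"
      using y by (simp add: power2_eq_square power_mult_distrib flip: y(3))
    also have "\<dots> \<le> B * (real (Suc n) * y ^ n)"
      using B[of n] y by (intro mult_mono) (auto intro!: mult_right_mono order_trans[OF norm_ge_zero
          B[of 0]])
    finally show "norm (real n ^ 2 * x ^ n) \<le> B * (real (Suc n) * y ^ n)" .
  qed
qed

lemma summable_lambert_sum:
  fixes q x :: complex
  assumes "norm q < 1" "norm x < 1"
  shows "summable (\<lambda>d. norm (of_nat d ^ 2 / (1 - q ^ d) * x ^ d))"
proof -
  have "summable (\<lambda>d. 1 / (1 - norm q) * (real d ^ 2 * norm x ^ d))"
    using assms by (intro summable_mult summable_square_geometric) auto
  thus ?thesis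
  proof (rule summable_comparison_test[rotated], intro exI allI impI)
    fix d
    show "norm (norm (of_nat d ^ 2 / (1 - q ^ d) * x ^ d)) \<le> 1 / (1
        - norm q) * (real d ^ 2 * norm x ^ d)"
    proof (cases "d = 0")
      case False
      have "norm q ^ d \<le> norm q ^ 1" using assms False by (intro power_decreasing) auto
      hence *: "1 - norm q \<le> norm (1 - q ^ d)"
        using norm_triangle_ineq2[of 1 "q ^ d"] by (simp add: norm_power)
      have "norm (of_nat d ^ 2 / (1 - q ^ d) * x ^ d) = (real d ^ 2 * norm x ^ d) / norm (1
          - q ^ d)"
        by (simp add: norm_mult norm_divide norm_power)
      also have "\<dots> \<le> (real d ^ 2 * norm x ^ d) / (1 - norm q)"
      proof -
        have "0 < norm (1 - q ^ d)" using * assms by linarith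
        thus ?thesis using * assms by (intro divide_left_mono mult_pos_pos) auto
      qed
      finally show ?thesis by simp
    qed simp
  qed
qed

lemma lambert_sum_sums:
  assumes "norm q < 1" "norm x < 1"
  shows "(\<lambda>d. of_nat d ^ 2 / (1 - q ^ d) * x ^ d) sums lambert_sum q x"
  unfolding lambert_sum_def
    by (rule summable_sums[OF summable_norm_cancel[OF summable_lambert_sum[OF assms]]])

text \<open>Shifting the index with (d + 1)^2 = d^2 + 2 (d + 1) - 1 gives a linear equation for the
  sum.\<close>

lemma square_geometric_sums:
  fixes z :: complex
  assumes z: "norm z < 1"
  shows "(\<lambda>d. of_nat d ^ 2 * z ^ d) sums (z * (1 + z) / (1 - z) ^ 3)"
proof -
  have "summable (\<lambda>d. norm (of_nat d ^ 2 * z ^ d))"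
    using summable_square_geometric[of "norm z"] z by (simp add: norm_mult norm_power)
  from summable_sums[OF summable_norm_cancel[OF this]]
  obtain S where S: "(\<lambda>d. of_nat d ^ 2 * z ^ d) sums S" by blast
  have z1: "1 - z \<noteq> 0" using z by auto
  have "(\<lambda>d. z * (of_nat d ^ 2 * z ^ d + 2 * (of_nat (Suc d) * z ^ d) - z ^ d)) sums
          (z * (S + 2 * (1 / (1 - z) ^ 2) - 1 / (1 - z)))"
    by (intro sums_mult sums_add sums_diff S geometric_deriv_sums geometric_sums z)
  moreover have "z * (of_nat d ^ 2 * z ^ d + 2 * (of_nat (Suc d) * z ^ d) - z ^ d)
      = of_nat (Suc d) ^ 2 * z ^ Suc d" for d
    by (simp add: power2_eq_square algebra_simps)
  ultimately have "(\<lambda>d. of_nat (Suc d) ^ 2 * z ^ Suc d) sums (z * (S + 2 * (1 / (1 - z) ^ 2)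
      - 1 / (1 - z)))"
    by (simp only:)
  hence "(\<lambda>d. of_nat d ^ 2 * z ^ d) sums (z * (S + 2 * (1 / (1 - z) ^ 2) - 1 / (1 - z)))"
    by (subst (asm) sums_Suc_iff) simp
  with S have "S = z * (S + 2 * (1 / (1 - z) ^ 2) - 1 / (1 - z))" by (rule sums_unique2)
  moreover define w where "w = 1 / (1 - z)"
  ultimately have "S = z * (S + 2 * w ^ 2 - w)" by (simp add: power_divide)
  moreover have "w * (1 - z) = 1" using z1 by (simp add: w_def)
  ultimately have "S = z * (1 + z) * w ^ 3" by algebra
  hence "S = z * (1 + z) / (1 - z) ^ 3" by (simp add: w_def power_divide)
  with S show ?thesis by simp
qed

text \<open>From 1 / (1 - q^d) = 1 + q^d / (1 - q^d). It isolates the triple pole at x = 1, since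
  the remaining series is regular there.\<close>

lemma lambert_sum_rec:
  assumes "norm q < 1" "norm x < 1"
  shows "lambert_sum q x = x * (1 + x) / (1 - x) ^ 3 + lambert_sum q (q * x)"
proof -
  have qx: "norm (q * x) < 1"
  proof -
    have "norm q * norm x \<le> norm q" using assms by (simp add: mult_left_le)
    thus ?thesis using assms by (simp add: norm_mult)
  qed
  have "(\<lambda>d. of_nat d ^ 2 * x ^ d + of_nat d ^ 2 / (1 - q ^ d) * (q * x) ^ d) sums (x * (1 + x) / (1
      - x) ^ 3 + lambert_sum q (q * x))"
    by (intro sums_add square_geometric_sums lambert_sum_sums assms qx)
  moreover have "of_nat d ^ 2 * x ^ d + of_nat d ^ 2 / (1 - q ^ d) * (q * x) ^ d = of_nat d ^ 2 / (1
      - q ^ d) * x ^ d" for d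
  proof (cases "d = 0")
    case False
    hence "q ^ d \<noteq> 1" using power_less_one_iff[of "norm q" d] assms
      by (metis norm_ge_zero norm_one norm_power order_less_irrefl gr0I)
    thus ?thesis by (simp add: field_simps power_mult_distrib)
  qed simp
  ultimately show ?thesis using lambert_sum_sums[OF assms] sums_unique2 by simp
qed

text \<open>For negative indices 1 / (1 - q^(-n)) = - q^n / (1 - q^n), so the negative half is minus
  the same power series in \<open>q / z\<close>; both halves converge on the annulus.\<close>

lemma lambert_coeff_has_sum:
  assumes q: "norm q < 1" "q \<noteq> 0" and z: "norm q < norm z" "norm z < 1"
  shows "((\<lambda>d. lambert_coeff q d * z powi d) has_sum lambert_sum q z - lambert_sum q (q / z)) UNIV"
proof -
  have z0: "z \<noteq> 0" using z by auto
  have qz: "norm (q / z) < 1" using z z0 by (simp add: norm_divide)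
  have "((\<lambda>d. of_nat d ^ 2 / (1 - q ^ d) * z ^ d) has_sum lambert_sum q z) UNIV"
    by (rule norm_summable_imp_has_sum[OF summable_lambert_sum[OF q(1) z(2)] lambert_sum_sums[OF
        q(1) z(2)]])
  also have "?this \<longleftrightarrow> ((\<lambda>d. lambert_coeff q d * z powi d) has_sum lambert_sum q z) {0..}"
    by (rule has_sum_reindex_bij_witness[of _ nat int]) (auto simp: lambert_coeff_def)
  finally have 1: "((\<lambda>d. lambert_coeff q d * z powi d) has_sum lambert_sum q z) {0..}" .
  have "((\<lambda>d. - (of_nat d ^ 2 / (1 - q ^ d) * (q / z) ^ d)) has_sum - lambert_sum q (q / z)) UNIV"
    by (rule has_sum_uminusI[OF norm_summable_imp_has_sum[OF summable_lambert_sum[OF q(1) qz]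
        lambert_sum_sums[OF q(1) qz]]])
  also have "?this \<longleftrightarrow> ((\<lambda>d. - (of_nat d ^ 2 / (1 - q ^ d) * (q / z) ^ d)) has_sum
      - lambert_sum q (q / z)) {1..}"
    by (rule has_sum_cong_neutral) auto
  also have "\<dots> \<longleftrightarrow> ((\<lambda>d. lambert_coeff q d * z powi d) has_sum - lambert_sum q (q / z)) {..<0}"
  proof (rule has_sum_reindex_bij_witness[of _ "\<lambda>d. nat (- d)" "\<lambda>n. - int n"])
    fix n :: nat
    have "lambert_coeff q (- int n) = - (q ^ n) * lambert_coeff q (int n)"
    proof -
      have "lambert_coeff q (- int n) = (lambert_coeff q (int n)
          - q powi int n * lambert_coeff q (int n)) - lambert_coeff q (int n)"
        by (simp only: lambert_coeff_uminus[OF q] lambert_coeff_mult[OF q])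
      thus ?thesis by simp
    qed
    thus "lambert_coeff q (- int n) * z powi - int n = - (of_nat n ^ 2 / (1 - q ^ n) * (q / z) ^ n)"
      by (simp add: power_int_minus power_divide lambert_coeff_def field_simps)
  qed auto
  finally have 2: "((\<lambda>d. lambert_coeff q d * z powi d) has_sum - lambert_sum q (q / z)) {..<0}" .
  have "{0..} \<union> {..<0} = (UNIV :: int set)" "{0..} \<inter> {..<0} = ({} :: int set)" by auto
  thus ?thesis using has_sum_Un_disjoint[OF 1 2] by simp
qed

lemma two_step_recurrence_zero:
  fixes g :: "int \<Rightarrow> complex"
  assumes step: "\<And>n. g (n + 2) = X n * g n" and X: "\<And>n. X n \<noteq> 0" and "g 0 = 0" "g 1 = 0"
  shows "g n = 0"
proof -
  have "g n = 0 \<and> g (n + 1) = 0"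
  proof (induction n rule: int_induct[of _ 0])
    case (step1 i)
    thus ?case using step[of i] by (simp add: add.commute)
  next
    case (step2 i)
    have "i - 1 + 2 = i + 1" by simp
    hence "X (i - 1) * g (i - 1) = 0" using step[of "i - 1"] step2 by metis
    thus ?case using X[of "i - 1"] step2 by simp
  qed (use assms in auto)
  thus ?thesis ..
qed

text \<open>The Laurent coefficients \<open>h N\<close> of the left-hand side on the annulus satisfy
  \<open>h (N + 4) = q powi N * h N\<close> and \<open>h (4 - N) = - h N\<close>, which leaves one free parameter.\<close>

lemma lambert_sum_theta_proportional:
  assumes q: "norm q < 1" "q \<noteq> 0"
  obtains C where "\<And>z. norm q < norm z \<Longrightarrow> norm z < 1 \<Longrightarrow> (lambert_sum q z
      - lambert_sum q (q / z)) * theta q z ^ 4 = C * (z * theta q (z ^ 2))"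
proof -
  define h where "h = int_conv (lambert_coeff q) (theta4_coeff q)"
  \<comment> \<open>Any point of the annulus would do: it only serves to show that the convolution
    defining \<open>h\<close> is summable.\<close>
  define z0 where "z0 = complex_of_real ((norm q + 1) / 2)"
  have "norm z0 = (norm q + 1) / 2"
    unfolding z0_def norm_of_real by simp
  hence "norm q < norm z0" "norm z0 < 1" using q(1) by auto
  moreover from this have "z0 \<noteq> 0" by auto
  ultimately have z0: "norm q < norm z0" "norm z0 < 1" "z0 \<noteq> 0" by auto
  have summ: "(\<lambda>d. lambert_coeff q d * theta4_coeff q (k - d)) summable_on UNIV" for k
    by (rule summable_int_conv_powi[OF lambert_coeff_has_sum[OF q z0(1,2)] theta4_coeff_has_sum[OF q
        z0(3)] z0(3)])
  have summ2: "(\<lambda>d. of_int d ^ 2 * theta4_coeff q (k - d)) summable_on UNIV" for k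
  proof -
    have "(\<lambda>d. lambert_coeff q d * theta4_coeff q (k - d) + (- (q powi (k
        - 4))) * (lambert_coeff q d * theta4_coeff q (k - 4 - d))) summable_on UNIV"
      by (intro summable_on_add summable_on_cmult_right summ)
    moreover have "lambert_coeff q d * theta4_coeff q (k - d) + (- (q powi (k
        - 4))) * (lambert_coeff q d * theta4_coeff q (k - 4 - d)) = of_int d ^ 2 * theta4_coeff q (k
        - d)" for d
    proof -
      have "theta4_coeff q (k - d) = q powi (k - 4 - d) * theta4_coeff q (k - 4 - d)"
        using theta4_coeff_shift[OF q(2), of "k - 4 - d"] by (simp add: algebra_simps)
      hence "q powi (k - 4) * theta4_coeff q (k - 4 - d) = q powi d * theta4_coeff q (k - d)"
        using q by (simp flip: power_int_add add: mult.assoc[symmetric])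
      hence "lambert_coeff q d * theta4_coeff q (k - d) + (- (q powi (k
          - 4))) * (lambert_coeff q d * theta4_coeff q (k - 4 - d)) = (lambert_coeff q d
          - q powi d * lambert_coeff q d) * theta4_coeff q (k - d)"
        by (simp add: algebra_simps)
      thus ?thesis by (simp add: lambert_coeff_mult[OF q])
    qed
    ultimately show ?thesis by simp
  qed
  have h_shift: "h (N + 4) = q powi N * h N" for N
  proof -
    have "lambert_coeff q d * theta4_coeff q (N + 4 - d)
        = q powi N * (lambert_coeff q d * theta4_coeff q (N - d)) + of_int d ^ 2 * theta4_coeff q (N
        + 4 - d)" for d
    proof -
      have "theta4_coeff q (N + 4 - d) = q powi (N - d) * theta4_coeff q (N - d)"
        using theta4_coeff_shift[OF q(2), of "N - d"] by (simp add: algebra_simps)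
      hence "q powi N * theta4_coeff q (N - d) = q powi d * theta4_coeff q (N + 4 - d)"
        using q by (simp flip: power_int_add add: mult.assoc[symmetric])
      hence "q powi N * (lambert_coeff q d * theta4_coeff q (N - d))
          = q powi d * lambert_coeff q d * theta4_coeff q (N + 4 - d)"
        by (simp add: algebra_simps)
      thus ?thesis unfolding lambert_coeff_mult[OF q, symmetric]
        by (simp only: left_diff_distrib) simp
    qed
    hence "h (N + 4) = (\<Sum>\<^sub>\<infinity>d. q powi N * (lambert_coeff q d * theta4_coeff q (N - d))
        + of_int d ^ 2 * theta4_coeff q (N + 4 - d))"
      by (simp add: h_def int_conv_def)
    also have "\<dots> = q powi N * h N + (\<Sum>\<^sub>\<infinity>d. of_int d ^ 2 * theta4_coeff q (N + 4 - d))"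
      by (subst infsum_add) (auto intro!: summable_on_cmult_right summ summ2 simp:
          infsum_cmult_right' h_def int_conv_def)
    finally show ?thesis by (simp add: theta4_coeff_square_moment[OF q])
  qed
  have h_refl: "h (4 - N) = - h N" for N
  proof -
    have "h (4 - N) = (\<Sum>\<^sub>\<infinity>d. lambert_coeff q (- d) * theta4_coeff q (N - d))"
      unfolding h_def int_conv_def
    proof (rule infsum_reindex_bij_witness[of _ uminus uminus])
      fix d show "lambert_coeff q (- (- d)) * theta4_coeff q (N - - d)
          = lambert_coeff q d * theta4_coeff q (4 - N - d)"
        using theta4_coeff_refl[of q "N + d"] by (simp add: algebra_simps)
    qed auto
    also have "\<dots> = (\<Sum>\<^sub>\<infinity>d. of_int d ^ 2 * theta4_coeff q (N - d)
        + (- 1) * (lambert_coeff q d * theta4_coeff q (N - d)))"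
      by (simp add: lambert_coeff_uminus[OF q] algebra_simps)
    also have "\<dots> = (\<Sum>\<^sub>\<infinity>d. of_int d ^ 2 * theta4_coeff q (N - d)) - h N"
      by (subst infsum_add) (auto intro!: summ summ2 simp: summable_on_uminus infsum_uminus h_def
          int_conv_def)
    finally show ?thesis by (simp add: theta4_coeff_square_moment[OF q])
  qed
  \<comment> \<open>The shift relates indices equal modulo 4. The classes of 0 and 2 vanish because
    h 4 = h 0 = - h 0 and h 2 = - h 2, while h 3 = - h 1 ties the odd classes together; their values
    follow the recurrence of \<open>theta_coeff\<close>, giving the series of z theta(z^2).\<close>
  have h0: "h 0 = 0" using h_shift[of 0] h_refl[of 0] by simp
  have h2: "h 2 = 0" using h_refl[of 2] by simp
  have even: "h (2 * n) = 0" for n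
  proof (rule two_step_recurrence_zero[of "\<lambda>n. h (2 * n)" "\<lambda>n. q powi (2 * n)"])
    show "h (2 * (n + 2)) = q powi (2 * n) * h (2 * n)" for n
      using h_shift[of "2 * n"] by (simp add: algebra_simps)
  qed (use q h0 h2 in auto)
  have odd: "h (2 * n + 1) - h 1 * theta_coeff q n = 0" for n
  proof (rule two_step_recurrence_zero[of "\<lambda>n. h (2 * n + 1) - h 1 * theta_coeff q n"
      "\<lambda>n. q powi (2 * n + 1)"])
    fix n
    have "theta_coeff q (n + 2) = q powi (n + 1) * q powi n * theta_coeff q n"
      using theta_coeff_shift[OF q(2), of "n + 1"] theta_coeff_shift[OF q(2), of n]
        by (simp add: add.commute[of n 2])
    also have "q powi (n + 1) * q powi n = q powi (2 * n + 1)"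
      using q by (simp flip: power_int_add)
    finally show "h (2 * (n + 2) + 1) - h 1 * theta_coeff q (n + 2) = q powi (2 * n + 1) * (h (2 * n
        + 1) - h 1 * theta_coeff q n)"
      using h_shift[of "2 * n + 1"] by (simp add: algebra_simps)
  next
    show "h (2 * 1 + 1) - h 1 * theta_coeff q 1 = 0"
      using h_refl[of 1] by (simp add: theta_coeff_def)
  qed (use q in \<open>auto simp: theta_coeff_def\<close>)
  show ?thesis
  proof (rule that)
    fix z :: complex assume z: "norm q < norm z" "norm z < 1"
    have z0: "z \<noteq> 0" using z by auto
    have "((\<lambda>n. h n * z powi n) has_sum (lambert_sum q z
        - lambert_sum q (q / z)) * theta q z ^ 4) UNIV"
      unfolding h_def by (rule has_sum_int_conv_powi[OF lambert_coeff_has_sum[OF q z]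
          theta4_coeff_has_sum[OF q z0] z0])
    also have "?this \<longleftrightarrow> ((\<lambda>n. h n * z powi n) has_sum (lambert_sum q z
        - lambert_sum q (q / z)) * theta q z ^ 4) {n. odd n}"
      by (rule has_sum_cong_neutral) (auto elim!: evenE simp: even h0)
    also have "\<dots> \<longleftrightarrow> ((\<lambda>n. h 1 * (z * (theta_coeff q n * (z ^ 2) powi n))) has_sum (lambert_sum q z
        - lambert_sum q (q / z)) * theta q z ^ 4) UNIV"
    proof (rule has_sum_reindex_bij_witness[of _ "\<lambda>n. 2 * n + 1" "\<lambda>n. n div 2"])
      fix n :: int assume "n \<in> {n. odd n}"
      then obtain k where n: "n = 2 * k + 1" by (auto elim: oddE)
      show "h 1 * (z * (theta_coeff q (n div 2) * (z ^ 2) powi (n div 2))) = h n * z powi n"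
        using odd[of k] z0 by (simp add: n power_int_add power_int_power)
    qed auto
    finally have 1: "((\<lambda>n. h 1 * (z * (theta_coeff q n * (z ^ 2) powi n))) has_sum (lambert_sum q z
        - lambert_sum q (q / z)) * theta q z ^ 4) UNIV" .
    have 2: "((\<lambda>n. h 1 * (z * (theta_coeff q n * (z ^ 2) powi n)))
        has_sum h 1 * (z * theta q (z ^ 2))) UNIV"
      using z0 by (intro has_sum_cmult_right theta_has_sum q) auto
    show "(lambert_sum q z - lambert_sum q (q / z)) * theta q z ^ 4 = h 1 * (z * theta q (z ^ 2))"
      by (rule has_sum_unique[OF 1 2])
  qed
qed

text \<open>The left-hand side is, up to constants, \<open>\<wp>'(z) \<sigma>(z)\<^sup>4\<close> and the right-hand side \<open>\<sigma>(2 z)\<close>.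
  The constant is found by letting \<open>z\<close> tend to \<open>1\<close>.\<close>

theorem lambert_sum_theta_identity:
  assumes q: "norm q < 1" "q \<noteq> 0" and z: "norm q < norm z" "norm z < 1"
  shows "(lambert_sum q z - lambert_sum q (q / z)) * theta q z ^ 4
      = qpoch q q ^ 9 * (z * theta q (z ^ 2))"
proof -
  obtain C where C: "\<And>z. norm q < norm z \<Longrightarrow> norm z < 1 \<Longrightarrow> (lambert_sum q z
      - lambert_sum q (q / z)) * theta q z ^ 4 = C * (z * theta q (z ^ 2))"
    using lambert_sum_theta_proportional[OF q] by blast
  have lambert_sum_cont: "isCont (lambert_sum q) q"
  proof -
    have "summable (\<lambda>d. of_nat d ^ 2 / (1 - q ^ d) * of_real ((norm q + 1) / 2) ^ d)"
      using lambert_sum_sums[OF q(1), of "of_real ((norm q + 1) / 2)"] q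
        by (auto simp: sums_iff simp del: of_real_add of_real_divide)
    from isCont_powser[OF this, of q] show ?thesis
      using q unfolding lambert_sum_def[abs_def] by (auto simp del: of_real_add of_real_divide)
  qed
  define F where "F = filtermap complex_of_real (at_left 1)"
  have F1: "filterlim (\<lambda>z. z) (at 1) F"
    unfolding F_def filterlim_filtermap using filterlim_of_real_at_left .
  have F1': "((\<lambda>z. z) \<longlongrightarrow> 1) F" using F1 by (simp add: filterlim_at)
  have Fbot: "F \<noteq> bot" by (simp add: F_def filtermap_bot_iff)
  have ev: "eventually (\<lambda>z. norm q < norm z \<and> norm z < 1 \<and> z \<noteq> 0 \<and> 1 + z \<noteq> 0) F"
    unfolding F_def eventually_filtermap
  proof -
    have "eventually (\<lambda>x. x \<in> {norm q<..<1}) (at_left 1)"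
      by (rule eventually_at_left_real) (use q in auto)
    thus "eventually (\<lambda>x. norm q < norm (complex_of_real x) \<and> norm (complex_of_real x) < 1 \<and>
        complex_of_real x \<noteq> 0 \<and> 1 + complex_of_real x \<noteq> 0) (at_left 1)"
    proof eventually_elim
      case (elim x)
      hence "0 < x" "norm (complex_of_real x) = x"
        using order_le_less_trans[OF norm_ge_zero, of q x] by auto
      moreover have "1 + complex_of_real x = complex_of_real (1 + x)" by simp
      ultimately show ?case using elim by (simp del: of_real_add)
    qed
  qed
  have sq: "filterlim (\<lambda>z. z ^ 2) (at 1) F"
    unfolding filterlim_at
  proof
    show "((\<lambda>z. z ^ 2) \<longlongrightarrow> 1) F" using tendsto_power[OF F1', of 2] by simp
    show "eventually (\<lambda>z. z ^ 2 \<in> UNIV \<and> z ^ 2 \<noteq> 1) F"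
      using ev by eventually_elim (metis UNIV_I norm_one norm_power norm_ge_zero power_less_one_iff
          order_less_irrefl pos2)
  qed
  \<comment> \<open>By \<open>lambert_sum_rec\<close> this is (1 - z)^3 times the odd Lambert
    function, written so that it is continuous at z = 1. The fourth power of theta supplies four
    zeros against the three of this factor and the one of theta(z^2).\<close>
  define E where "E z = z * (1 + z) + (1 - z) ^ 3 * (lambert_sum q (q * z)
      - lambert_sum q (q / z))" for z
  have "((\<lambda>z. E z * (theta q z / (1 - z)) ^ 4) \<longlongrightarrow> (1 * (1 + 1) + (1 - 1) ^ 3 * (lambert_sum q q
      - lambert_sum q q)) * (qpoch q q ^ 3) ^ 4) F"
    unfolding E_def
  proof (intro tendsto_intros F1' filterlim_compose[OF tendsto_theta_divide[OF q] F1])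
    have "((\<lambda>z. q * z) \<longlongrightarrow> q * 1) F" "((\<lambda>z. q / z) \<longlongrightarrow> q / 1) F"
      by (intro tendsto_intros F1'; simp)+
    thus "((\<lambda>z. lambert_sum q (q * z)) \<longlongrightarrow> lambert_sum q q) F"
        "((\<lambda>z. lambert_sum q (q / z)) \<longlongrightarrow> lambert_sum q q) F"
      using isCont_tendsto_compose[OF lambert_sum_cont] by auto
  qed
  moreover have "((\<lambda>z. E z * (theta q z / (1 - z)) ^ 4) \<longlongrightarrow> C * (1 * (1 + 1) * qpoch q q ^ 3)) F"
  proof (rule Lim_transform_eventually)
    show "((\<lambda>z. C * (z * (1 + z) * (theta q (z ^ 2) / (1 - z ^ 2)))) \<longlongrightarrow> C * (1 * (1
        + 1) * qpoch q q ^ 3)) F"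
      by (intro tendsto_intros F1' filterlim_compose[OF tendsto_theta_divide[OF q] sq])
    show "eventually (\<lambda>z. C * (z * (1 + z) * (theta q (z ^ 2) / (1 - z ^ 2)))
        = E z * (theta q z / (1 - z)) ^ 4) F"
      using ev
    proof eventually_elim
      case (elim z)
      have z1: "1 - z \<noteq> 0" using elim by auto
      have EE: "E z = (1 - z) ^ 3 * (lambert_sum q z - lambert_sum q (q / z))"
      proof -
        have gen: "a + u * (w - v) = u * (a / u + w - v)" if "u \<noteq> 0" for a u w v :: complex
          using that by (simp add: field_simps)
        have "lambert_sum q z = z * (1 + z) / (1 - z) ^ 3 + lambert_sum q (q * z)"
          using lambert_sum_rec[OF q(1), of z] elim by simp
        thus ?thesis unfolding E_def using gen[of "(1 - z) ^ 3" "z * (1 + z)"] z1 by simp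
      qed
      have "E z * (theta q z / (1 - z)) ^ 4 = (lambert_sum q z
          - lambert_sum q (q / z)) * theta q z ^ 4 / (1 - z)"
      proof -
        have "u ^ 3 * X * (t / u) ^ 4 = X * t ^ 4 / u" if "u \<noteq> 0" for u X t :: complex
          using that by (simp add: field_simps eval_nat_numeral)
        thus ?thesis using z1 EE by simp
      qed
      also have "\<dots> = C * (z * theta q (z ^ 2)) / (1 - z)" using C elim by simp
      also have "\<dots> = C * (z * (1 + z) * (theta q (z ^ 2) / ((1 - z) * (1 + z))))"
        using z1 elim by simp
      also have "(1 - z) * (1 + z) = 1 - z ^ 2" by (simp add: power2_eq_square algebra_simps)
      finally show ?case by simp
    qed
  qed
  \<comment> \<open>The limits give 2 f^12 = 2 C f^3 for the Euler product f, whence the ninth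
    power.\<close>
  ultimately have "(1 * (1 + 1) + (1 - 1) ^ 3 * (lambert_sum q q
      - lambert_sum q q)) * (qpoch q q ^ 3) ^ 4 = C * (1 * (1 + 1) * qpoch q q ^ 3)"
    using tendsto_unique[OF Fbot] by blast
  moreover have "qpoch q q \<noteq> 0" using q by (intro qpoch_nonzero') auto
  ultimately have "C = qpoch q q ^ 9" by (simp add: eval_nat_numeral)
  thus ?thesis using C[OF z] by simp
qed

text \<open>The exponents 1, 2, 4 are the squares modulo 7 and 6, 5, 3 their negatives, so pairing
  \<open>q ^ r\<close> with \<open>Q / q ^ r\<close> matches the signs of the character. Division of
  \<open>klein_identity\<close> by the product a b c then yields both eta products at once.\<close>

theorem eisenstein_product:
  assumes q: "norm q < 1" "q \<noteq> 0" and Q: "Q = q ^ 7"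
  shows "lambert_sum Q q + lambert_sum Q (q ^ 2) + lambert_sum Q (q ^ 4) - lambert_sum Q (q ^ 3)
      - lambert_sum Q (q ^ 5) - lambert_sum Q (q ^ 6) =
    8 * q ^ 2 * (qpoch Q Q ^ 7 / qpoch q q) + q * qpoch q q ^ 3 * qpoch Q Q ^ 3"
proof -
  have Q': "norm Q < 1" "Q \<noteq> 0" using q by (simp_all add: Q norm_power power_less_one_iff)
  have nr: "norm Q < norm (q ^ r)" "norm (q ^ r) < 1" if "r > 0" "r < 7" for r
    using q that by (auto simp: Q norm_power power_less_one_iff power_strict_decreasing)
  define a b c where abc: "a = theta Q q" "b = theta Q (q ^ 2)" "c = theta Q (q ^ 3)"
  have Tn: "theta Q (q ^ r) \<noteq> 0" if "r > 0" "r < 7" for r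
    by (rule theta_nonzero[OF Q' _ nr(2,1)]) (use that q in auto)
  have nz: "a \<noteq> 0" "b \<noteq> 0" "c \<noteq> 0" unfolding abc
    using Tn[of 1] Tn[of 2] Tn[of 3] by simp_all
  define F f where Ff: "F = qpoch Q Q" "f = qpoch q q"
  have F0: "F \<noteq> 0" "f \<noteq> 0" using Q' q by (auto simp: Ff qpoch_nonzero')
  have T4: "theta Q (q ^ 4) = c"
  proof -
    have "q ^ 4 = Q / q ^ 3" using q by (simp add: Q eval_nat_numeral)
    thus ?thesis using theta_reflect[OF Q', of "q ^ 3"] q by (simp add: abc)
  qed
  \<comment> \<open>Doubling the exponent 4 leaves the range below 7; the quasi-period is
    responsible for the negative third term.\<close>
  have T8: "theta Q (q ^ 8) = - a / q"
  proof -
    have "q \<noteq> 1" using q by auto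
    moreover have "q ^ 8 = Q * q" by (simp add: Q eval_nat_numeral)
    ultimately show ?thesis using theta_shift[OF Q', of q] q by (simp add: abc)
  qed
  have P1: "lambert_sum Q q - lambert_sum Q (q ^ 6) = F ^ 9 * q * (b / a ^ 4)"
  proof -
    have "Q / q = q ^ 6" using q by (simp add: Q eval_nat_numeral)
    thus ?thesis using lambert_sum_theta_identity[OF Q' nr[of 1, simplified]] nz
      by (simp add: abc Ff field_simps)
  qed
  have P2: "lambert_sum Q (q ^ 2) - lambert_sum Q (q ^ 5) = F ^ 9 * q ^ 2 * (c / b ^ 4)"
  proof -
    have "Q / q ^ 2 = q ^ 5" using q by (simp add: Q eval_nat_numeral)
    moreover have "(q ^ 2) ^ 2 = q ^ 4" by (simp flip: power_mult)
    ultimately have "(lambert_sum Q (q ^ 2) - lambert_sum Q (q ^ 5)) * b ^ 4 = F ^ 9 * (q ^ 2 * c)"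
      using lambert_sum_theta_identity[OF Q' nr[of 2]] by (simp only: T4 abc(2) Ff)
    thus ?thesis using nz by (simp add: field_simps)
  qed
  have P4: "lambert_sum Q (q ^ 4) - lambert_sum Q (q ^ 3) = - (F ^ 9) * q ^ 3 * (a / c ^ 4)"
  proof -
    have "Q / q ^ 4 = q ^ 3" using q by (simp add: Q eval_nat_numeral)
    moreover have "(q ^ 4) ^ 2 = q ^ 8" by (simp flip: power_mult)
    ultimately have "(lambert_sum Q (q ^ 4) - lambert_sum Q (q ^ 3)) * c ^ 4
        = F ^ 9 * (q ^ 4 * (- a / q))"
      using lambert_sum_theta_identity[OF Q' nr[of 4]] by (simp only: T4 T8 Ff)
    also have "\<dots> = - (F ^ 9) * q ^ 3 * a" using q by (simp add: eval_nat_numeral)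
    finally show ?thesis using nz by (simp add: field_simps)
  qed
  have prod: "a * b * c = F ^ 2 * f"
  proof -
    have "Q / q = q ^ 6" "Q / q ^ 2 = q ^ 5" "Q / q ^ 3 = q ^ 4" using q
      by (simp_all add: Q eval_nat_numeral)
    hence "a * b * c = F ^ 3 * (qpoch q Q * qpoch (q ^ 6) Q * qpoch (q ^ 2) Q * qpoch (q ^ 5) Q *
        qpoch (q ^ 3) Q * qpoch (q ^ 4) Q)"
      using q by (simp add: abc Ff jacobi_triple_product[OF Q'] eval_nat_numeral mult_ac)
    moreover have "f = qpoch q Q * qpoch (q ^ 2) Q * qpoch (q ^ 3) Q * qpoch (q ^ 4) Q * qpoch (q ^
        5) Q * qpoch (q ^ 6) Q * F"
    proof -
      have "{..<7} = {0, 1, 2, 3, 4, 5, 6 :: nat}" by auto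
      moreover have "q * q = q ^ 2" "q * q ^ 2 = q ^ 3" "q * q ^ 3 = q ^ 4" "q * q ^ 4 = q ^ 5"
        "q * q ^ 5 = q ^ 6" "q * q ^ 6 = q ^ 7" by (simp_all add: eval_nat_numeral)
      ultimately show ?thesis
        using qpoch_multisection[OF q(1), of 7 q] by (simp add: Ff Q mult_ac)
    qed
    ultimately show ?thesis by (simp add: power3_eq_cube power2_eq_square mult_ac)
  qed
  have K: "b ^ 2 * c / a ^ 3 + q * (c ^ 2 * a / b ^ 3) - q ^ 2 * (a ^ 2 * b / c ^ 3) = 8 * q
      + (f / F) ^ 4"
    unfolding Ff by (rule klein_identity[OF q Q abc])
  have "b / a ^ 4 + q * (c / b ^ 4) - q ^ 2 * (a / c ^ 4) =
      (b ^ 2 * c / a ^ 3 + q * (c ^ 2 * a / b ^ 3) - q ^ 2 * (a ^ 2 * b / c ^ 3)) / (a * b * c)"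
  proof -
    have "b ^ 2 * c / a ^ 3 / (a * b * c) = b / a ^ 4" "c ^ 2 * a / b ^ 3 / (a * b * c) = c / b ^ 4"
      "a ^ 2 * b / c ^ 3 / (a * b * c) = a / c ^ 4"
      using nz by (simp_all add: field_simps eval_nat_numeral)
    thus ?thesis by (simp add: diff_divide_distrib add_divide_distrib flip: times_divide_eq_right)
  qed
  also have "\<dots> = (8 * q + (f / F) ^ 4) / (F ^ 2 * f)" by (simp only: K prod)
  finally have "F ^ 9 * q * (b / a ^ 4 + q * (c / b ^ 4) - q ^ 2 * (a / c ^ 4)) =
     F ^ 9 * q * ((8 * q + (f / F) ^ 4) / (F ^ 2 * f))" by simp
  also have "\<dots> = 8 * q ^ 2 * (F ^ 7 / f) + q * f ^ 3 * F ^ 3"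
    using F0 by (simp add: power_divide field_simps eval_nat_numeral)
  finally show ?thesis
    using P1 P2 P4 unfolding Ff by (simp add: algebra_simps eval_nat_numeral)
qed

section \<open>The twisted divisor sums as Lambert series\<close>

lemma norm_chi74: "norm (of_int (chi74 m) :: complex) \<le> 1"
  by (auto simp: chi74_def)

lemma chi74_sum:
  assumes x: "norm (x :: complex) < 1"
  shows "((\<lambda>m. of_int (chi74 (int m)) * x ^ m) has_sum (x + x ^ 2 - x ^ 3 + x ^ 4 - x ^ 5
      - x ^ 6) / (1 - x ^ 7)) {1..}"
proof -
  let ?c = "\<lambda>m. of_int (chi74 (int m)) :: complex"
  have summ: "summable (\<lambda>m. norm (?c m * x ^ m))"
  proof (rule summable_comparison_test[of _ "\<lambda>m. norm x ^ m"], intro exI allI impI)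
    fix m show "norm (norm (?c m * x ^ m)) \<le> norm x ^ m"
      using norm_chi74[of "int m"] by (simp add: norm_mult norm_power mult_left_le_one_le)
  qed (use x in \<open>auto intro: summable_geometric\<close>)
  define S where "S = (\<Sum>m. ?c m * x ^ m)"
  have "S = (\<Sum>m. ?c (m + 7) * x ^ (m + 7)) + (\<Sum>m<7. ?c m * x ^ m)"
    unfolding S_def by (rule suminf_split_initial_segment[OF summable_norm_cancel[OF summ]])
  also have "(\<lambda>m. ?c (m + 7) * x ^ (m + 7)) = (\<lambda>m. x ^ 7 * (?c m * x ^ m))"
    by (auto simp: chi74_def power_add fun_eq_iff)
  also have "(\<Sum>m. x ^ 7 * (?c m * x ^ m)) = x ^ 7 * S"
    unfolding S_def by (rule suminf_mult[OF summable_norm_cancel[OF summ]])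
  also have "(\<Sum>m<7. ?c m * x ^ m) = x + x ^ 2 - x ^ 3 + x ^ 4 - x ^ 5 - x ^ 6"
  proof -
    have "{..<7} = {0, 1, 2, 3, 4, 5, 6 :: nat}" by auto
    thus ?thesis by (simp add: chi74_def)
  qed
  finally have "S * (1 - x ^ 7) = x + x ^ 2 - x ^ 3 + x ^ 4 - x ^ 5 - x ^ 6"
    by (simp add: algebra_simps)
  moreover have "x ^ 7 \<noteq> 1" using x power_less_one_iff[of "norm x" 7]
    by (metis norm_ge_zero norm_one norm_power order_less_irrefl zero_less_numeral)
  ultimately have "S = (x + x ^ 2 - x ^ 3 + x ^ 4 - x ^ 5 - x ^ 6) / (1 - x ^ 7)"
    by (simp add: field_simps)
  moreover have "((\<lambda>m. ?c m * x ^ m) has_sum S) UNIV"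
    unfolding S_def by (rule norm_summable_imp_has_sum[OF summ summable_sums[OF
        summable_norm_cancel[OF summ]]])
  ultimately have "((\<lambda>m. ?c m * x ^ m) has_sum (x + x ^ 2 - x ^ 3 + x ^ 4 - x ^ 5 - x ^ 6) / (1
      - x ^ 7)) UNIV"
    by simp
  also have "?this \<longleftrightarrow> ?thesis"
    by (rule has_sum_cong_neutral) (auto simp: chi74_def)
  finally show ?thesis .
qed

lemma summable_lambert_square:
  assumes x: "0 \<le> x" "x < (1::real)"
  shows "(\<lambda>(d, m). real d ^ 2 * x ^ (d * m)) summable_on {1..} \<times> {1..}"
proof (rule summable_on_SigmaI)
  fix d :: nat assume "d \<in> {1..}"
  hence "x ^ d < 1" using x by (simp add: power_less_one_iff)
  hence "((\<lambda>m. (x ^ d) ^ m) has_sum (x ^ d / (1 - x ^ d))) {1..}"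
    using x by (intro has_sum_geometric_from_1) auto
  from has_sum_cmult_right[OF this, of "real d ^ 2"]
  show "((\<lambda>m. case (d, m) of (d, m) \<Rightarrow> real d ^ 2 * x ^ (d * m)) has_sum (real d ^ 2 * (x ^ d / (1
      - x ^ d)))) {1..}"
    by (simp add: power_mult)
next
  have "(\<lambda>d. 1 / (1 - x) * (real d ^ 2 * x ^ d)) summable_on UNIV"
    using x by (intro summable_nonneg_imp_summable_on summable_mult summable_square_geometric) auto
  hence "(\<lambda>d. 1 / (1 - x) * (real d ^ 2 * x ^ d)) summable_on {1..}"
    by (rule summable_on_subset) auto
  thus "(\<lambda>d. real d ^ 2 * (x ^ d / (1 - x ^ d))) summable_on {1..}"
  proof (rule summable_on_comparison_test)
    fix d :: nat assume d: "d \<in> {1..}"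
    have "x ^ d \<le> x ^ 1" using x d by (intro power_decreasing) auto
    hence "x ^ d / (1 - x ^ d) \<le> x ^ d / (1 - x)" using x by (intro divide_left_mono) auto
    from mult_left_mono[OF this, of "real d ^ 2"]
    show "real d ^ 2 * (x ^ d / (1 - x ^ d)) \<le> 1 / (1 - x) * (real d ^ 2 * x ^ d)" by simp
    show "0 \<le> real d ^ 2 * (x ^ d / (1 - x ^ d))"
      using x by (intro mult_nonneg_nonneg divide_nonneg_nonneg) (auto simp: power_le_one)
  qed
qed (use x in auto)

text \<open>Both sides sum chi(m) d^2 q^(d m) over pairs (d, m). Summing over \<open>m\<close> first
  uses the period 7 of the character and produces the denominators 1 - Q^d; grouping by n = d m
  produces the divisor sums.\<close>

theorem sigma_star_lambert:
  assumes q: "norm q < 1" and Q: "Q = q ^ 7"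
  shows "((\<lambda>n. of_int (sigma_star 2 chi74 n) * q ^ n) has_sum
     (lambert_sum Q q + lambert_sum Q (q ^ 2) + lambert_sum Q (q ^ 4) - lambert_sum Q (q ^ 3)
         - lambert_sum Q (q ^ 5) - lambert_sum Q (q ^ 6))) {1..}"
proof -
  define f where "f = (\<lambda>(d, m). of_int (chi74 (int m)) * of_nat d ^ 2 * q ^ (d * m))"
  let ?E = "lambert_sum Q q + lambert_sum Q (q ^ 2) + lambert_sum Q (q ^ 4) - lambert_sum Q (q ^ 3)
      - lambert_sum Q (q ^ 5) - lambert_sum Q (q ^ 6)"
  have Q': "norm Q < 1" using q by (simp add: Q norm_power power_less_one_iff)
  have "(\<lambda>x. norm (f x)) summable_on {1..} \<times> {1..}"
  proof (rule summable_on_comparison_test[OF summable_lambert_square[of "norm q"]])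
    fix x :: "nat \<times> nat"
    obtain d m where x: "x = (d, m)" by (cases x)
    have "norm (of_int (chi74 (int m)) :: complex) * (real d ^ 2 * norm q ^ (d * m))
        \<le> 1 * (real d ^ 2 * norm q ^ (d * m))"
      by (intro mult_right_mono norm_chi74) auto
    thus "norm (f x) \<le> (case x of (d, m) \<Rightarrow> real d ^ 2 * norm q ^ (d * m))"
      by (simp add: x f_def norm_mult norm_power)
  qed (use q in auto)
  hence summ: "f summable_on {1..} \<times> {1..}"
    using summable_on_iff_abs_summable_on_complex by blast
  have Ws: "((\<lambda>d. of_nat d ^ 2 / (1 - Q ^ d) * (q ^ r) ^ d) has_sum lambert_sum Q (q ^ r)) {1..}" if
      "r > 0" for r
  proof -
    have "norm (q ^ r) < 1" using q that by (simp add: norm_power power_less_one_iff)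
    note w = Q' this
    have "((\<lambda>d. of_nat d ^ 2 / (1 - Q ^ d) * (q ^ r) ^ d) has_sum lambert_sum Q (q ^ r)) UNIV"
      by (rule norm_summable_imp_has_sum[OF summable_lambert_sum[OF w] lambert_sum_sums[OF w]])
    also have "?this \<longleftrightarrow> ?thesis" by (rule has_sum_cong_neutral) auto
    finally show ?thesis .
  qed
  have "(f has_sum ?E) ({1..} \<times> {1..})"
  proof (rule has_sum_SigmaI[OF _ _ summ])
    fix d :: nat assume d: "d \<in> {1..}"
    have "norm (q ^ d) < 1" using q d by (simp add: norm_power power_less_one_iff)
    from has_sum_cmult_right[OF chi74_sum[OF this], of "of_nat d ^ 2"]
    show "((\<lambda>m. f (d, m)) has_sum of_nat d ^ 2 * ((q ^ d + (q ^ d) ^ 2 - (q ^ d) ^ 3 + (q ^ d) ^ 4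
        - (q ^ d) ^ 5 - (q ^ d) ^ 6) / (1 - (q ^ d) ^ 7))) {1..}"
      by (simp add: f_def power_mult mult_ac)
  next
    have m1: "((\<lambda>x. f x - g x) has_sum a - b) A" if "(f has_sum a) A" "(g has_sum b) A" for f g ::
        "nat \<Rightarrow> complex" and a b A
      using has_sum_add[OF that(1) has_sum_uminusI[OF that(2)]] by simp
    have "((\<lambda>d. of_nat d ^ 2 / (1 - Q ^ d) * (q ^ 1) ^ d + of_nat d ^ 2 / (1 - Q ^ d) * (q ^ 2) ^ d
       + of_nat d ^ 2 / (1 - Q ^ d) * (q ^ 4) ^ d - of_nat d ^ 2 / (1 - Q ^ d) * (q ^ 3) ^ d
       - of_nat d ^ 2 / (1 - Q ^ d) * (q ^ 5) ^ d - of_nat d ^ 2 / (1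
           - Q ^ d) * (q ^ 6) ^ d) has_sum
       (lambert_sum Q (q ^ 1) + lambert_sum Q (q ^ 2) + lambert_sum Q (q ^ 4)
           - lambert_sum Q (q ^ 3) - lambert_sum Q (q ^ 5) - lambert_sum Q (q ^ 6))) {1..}"
      by (intro m1 has_sum_add Ws) auto
    moreover have "of_nat d ^ 2 / (1 - Q ^ d) * (q ^ 1) ^ d + of_nat d ^ 2 / (1
        - Q ^ d) * (q ^ 2) ^ d
       + of_nat d ^ 2 / (1 - Q ^ d) * (q ^ 4) ^ d - of_nat d ^ 2 / (1 - Q ^ d) * (q ^ 3) ^ d
       - of_nat d ^ 2 / (1 - Q ^ d) * (q ^ 5) ^ d - of_nat d ^ 2 / (1 - Q ^ d) * (q ^ 6) ^ d =
       of_nat d ^ 2 * ((q ^ d + (q ^ d) ^ 2 - (q ^ d) ^ 3 + (q ^ d) ^ 4 - (q ^ d) ^ 5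
           - (q ^ d) ^ 6) / (1 - (q ^ d) ^ 7))" for d
    proof -
      have e: "(q ^ r) ^ d = (q ^ d) ^ r" for r by (metis power_mult mult.commute)
      show ?thesis unfolding Q e by (simp add: add_divide_distrib diff_divide_distrib algebra_simps)
    qed
    ultimately show "((\<lambda>d. of_nat d ^ 2 * ((q ^ d + (q ^ d) ^ 2 - (q ^ d) ^ 3 + (q ^ d) ^ 4
        - (q ^ d) ^ 5 - (q ^ d) ^ 6) / (1 - (q ^ d) ^ 7))) has_sum ?E) {1..}"
      by simp
  qed
  also have "?this \<longleftrightarrow> ((\<lambda>(n, d). of_int (chi74 (int (n div d))) * of_nat d ^ 2 * q ^ n)
      has_sum ?E) (SIGMA n:{1..}. {d. d dvd n})"
    by (rule has_sum_reindex_bij_witness[of _ "\<lambda>(n, d). (d, n div d)" "\<lambda>(d, m). (d * m, d)"])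
       (auto simp: f_def Suc_le_eq intro!: Nat.gr0I elim!: dvdE)
  finally show ?thesis
  proof (rule has_sum_SigmaD)
    fix n :: nat assume n: "n \<in> {1..}"
    hence "finite {d. d dvd n}" by auto
    hence "((\<lambda>d. of_int (chi74 (int (n div d))) * of_nat d ^ 2 * q ^ n) has_sum
      (\<Sum>d | d dvd n. of_int (chi74 (int (n div d))) * of_nat d ^ 2 * q ^ n)) {d. d dvd n}"
      by simp
    thus "((\<lambda>d. case (n, d) of (n, d) \<Rightarrow> of_int (chi74 (int (n div d))) * of_nat d ^ 2 * q ^ n)
        has_sum
      of_int (sigma_star 2 chi74 n) * q ^ n) {d. d dvd n}"
      by (simp add: sigma_star_def sum_distrib_right)
  qed
qed

section \<open>Cores and beta-sets\<close>

text \<open>Parts equal to \<open>0\<close> are allowed, so that partitions can be padded to a common length.\<close>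

primrec beta_set :: "nat list \<Rightarrow> nat set" where
  "beta_set [] = {}"
| "beta_set (p # l) = insert (p + length l) (beta_set l)"

lemma finite_beta_set [simp]: "finite (beta_set l)"
  by (induction l) auto

lemma beta_set_less:
  assumes "sorted_wrt (\<ge>) (p # l)" "x \<in> beta_set l"
  shows "x < p + length l"
  using assms
proof (induction l arbitrary: p)
  case (Cons p' l)
  thus ?case using Cons.IH[of p'] by fastforce
qed simp

lemma card_beta_set: "sorted_wrt (\<ge>) l \<Longrightarrow> card (beta_set l) = length l"
proof (induction l)
  case (Cons p l)
  have "p + length l \<notin> beta_set l" using beta_set_less[OF Cons.prems, of "p + length l"] by blast
  thus ?case using Cons by simp
qed simp

lemma sum_beta_set: "sorted_wrt (\<ge>) l \<Longrightarrow> \<Sum>(beta_set l) = sum_list l + \<Sum>{..<length l}"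
proof (induction l)
  case (Cons p l)
  have "p + length l \<notin> beta_set l" using beta_set_less[OF Cons.prems, of "p + length l"] by blast
  thus ?case using Cons by simp
qed simp

lemma Max_beta_set:
  assumes "sorted_wrt (\<ge>) (p # l)"
  shows "Max (beta_set (p # l)) = p + length l"
  using beta_set_less[OF assms] by (intro Max_eqI) (auto intro: less_imp_le)

lemma beta_set_inject:
  assumes "sorted_wrt (\<ge>) l" "sorted_wrt (\<ge>) l'" "length l = length l'" "beta_set l = beta_set l'"
  shows "l = l'"
  using assms(3,1,2,4)
proof (induction l l' rule: list_induct2)
  case (Cons p l p' l')
  have p: "p = p'"
    using Max_beta_set[OF Cons.prems(1)] Max_beta_set[OF Cons.prems(2)] Cons.prems(3) Cons.hyps
      by simp
  have "p + length l \<notin> beta_set l" "p + length l \<notin> beta_set l'"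
    using beta_set_less[OF Cons.prems(1)] beta_set_less[OF Cons.prems(2)] Cons.hyps p by fastforce+
  hence "beta_set l = beta_set l'" using Cons.prems(3) Cons.hyps p by (simp add: insert_ident)
  with Cons p show ?case by simp
qed simp

lemma beta_set_surj:
  "finite X \<Longrightarrow> \<exists>l. sorted_wrt (\<ge>) l \<and> beta_set l = X \<and> length l = card X"
proof (induction "card X" arbitrary: X)
  case (Suc n)
  define x where "x = Max X"
  have X: "X \<noteq> {}" using Suc.hyps by auto
  have x: "x \<in> X" "\<And>y. y \<in> X \<Longrightarrow> y \<le> x" using Suc.prems X by (auto simp: x_def)
  have c: "card (X - {x}) = n" using Suc.hyps Suc.prems x by simp
  then obtain l where l: "sorted_wrt (\<ge>) l" "beta_set l = X - {x}" "length l = n"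
    using Suc.hyps(1)[of "X - {x}"] Suc.prems by auto
  have "X - {x} \<subseteq> {..<x}" using x by (auto simp: order_less_le)
  hence "n \<le> x" using card_mono[of "{..<x}" "X - {x}"] c by simp
  moreover have "sorted_wrt (\<ge>) ((x - n) # l)"
  proof (cases l)
    case (Cons p l')
    have "p + length l' \<in> X - {x}" using l(2) Cons by auto
    hence "p + length l' < x" using x by (auto simp: order_less_le)
    hence "p \<le> x - n" using l(3) Cons by simp
    thus ?thesis using l(1) Cons by auto
  qed simp
  moreover have "insert x (X - {x}) = X" using x by blast
  ultimately show ?case using l Suc.hyps by (intro exI[of _ "(x - n) # l"]) auto
qed simp

definition down_closed :: "nat \<Rightarrow> nat set \<Rightarrow> bool" where
  "down_closed t X \<longleftrightarrow> (\<forall>x\<in>X. \<forall>y<x. t dvd x - y \<longrightarrow> y \<in> X)"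

lemma hook_length_Cons_Suc: "hook_length (p # l) (Suc i) j = hook_length l i j"
proof -
  have "{k. Suc i < k \<and> k < length (p # l) \<and> j < (p # l) ! k}
      = Suc ` {k. i < k \<and> k < length l \<and> j < l ! k}"
    by (auto simp: image_iff gr0_conv_Suc less_Suc_eq_0_disj split: nat.splits)
  thus ?thesis by (simp add: hook_length_def card_image)
qed

lemma is_core_Cons:
  "is_core t (p # l) \<longleftrightarrow> (\<forall>j<p. \<not> t dvd hook_length (p # l) 0 j) \<and> is_core t l"
  unfolding is_core_def by (auto simp: All_less_Suc2 hook_length_Cons_Suc less_Suc_eq_0_disj)

text \<open>The leg is counted by its complement, so that the hook length becomes a distance: from
  the largest bead \<open>p + length l\<close> down to a position attached to column
  \<open>j\<close>, which \<open>gaps_eq\<close> shows to be a gap.\<close>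

lemma hook_length_0:
  assumes "j < p"
  shows "hook_length (p # l) 0 j = p + length l - (j + card {k. k < length l \<and> l ! k \<le> j})"
proof -
  have "{k. 0 < k \<and> k < length (p # l) \<and> j < (p # l) ! k} = Suc ` {k. k < length l \<and> j < l ! k}"
    by (auto simp: image_iff gr0_conv_Suc)
  hence 1: "hook_length (p # l) 0 j = p - Suc j + card {k. k < length l \<and> j < l ! k} + 1"
    by (simp add: hook_length_def card_image)
  have "card ({k. k < length l \<and> j < l ! k} \<union> {k. k < length l \<and> l ! k \<le> j}) =
    card {k. k < length l \<and> j < l ! k} + card {k. k < length l \<and> l ! k \<le> j}"
    by (rule card_Un_disjoint) auto
  moreover have "{k. k < length l \<and> j < l ! k} \<union> {k. k < length l \<and> l ! k \<le> j} = {..<length l}"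
    by auto
  ultimately show ?thesis using assms 1 by simp
qed

lemma beta_set_nth: "x \<in> beta_set l \<longleftrightarrow> (\<exists>i<length l. x = l ! i + (length l - Suc i))"
  by (induction l) (auto simp: less_Suc_eq_0_disj)

text \<open>The hook lengths of the first row are the distances from the largest bead down to the gaps.\<close>

lemma gaps_eq:
  assumes s: "sorted_wrt (\<ge>) (p # l)"
  shows "(\<lambda>j. j + card {k. k < length l \<and> l ! k \<le> j}) ` {..<p} = {y. y < p
      + length l \<and> y \<notin> beta_set l}"
proof (rule card_subset_eq)
  let ?c = "\<lambda>j. card {k. k < length l \<and> l ! k \<le> j}"
  have mono: "?c j \<le> ?c j'" if "j \<le> j'" for j j' using that by (intro card_mono) auto
  have le: "?c j \<le> length l" for j
    using card_mono[of "{..<length l}" "{k. k < length l \<and> l ! k \<le> j}"] by auto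
  have sl: "l ! k \<le> l ! i" if "i \<le> k" "k < length l" for i k
    using s that sorted_wrt_nth_less[of "(\<ge>)" l i k] by (cases "i = k") auto
  \<comment> \<open>If the position were the bead of row i, then either
    \<open>l ! i \<le> j\<close>, all rows from i on are counted, and the position lies above that
    bead; or only rows after i are counted and it lies below. Equality of the two sets then follows
    as both have p elements.\<close>
  have not_beta_set: "j + ?c j \<notin> beta_set l" for j
  proof
    assume "j + ?c j \<in> beta_set l"
    then obtain i where i: "i < length l" "j + ?c j = l ! i + (length l - Suc i)"
      by (auto simp: beta_set_nth)
    show False
    proof (cases "l ! i \<le> j")
      case True
      have "{i..<length l} \<subseteq> {k. k < length l \<and> l ! k \<le> j}"
      proof
        fix k assume k: "k \<in> {i..<length l}"
        hence "l ! k \<le> l ! i" by (intro sl) auto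
        thus "k \<in> {k. k < length l \<and> l ! k \<le> j}" using k True by auto
      qed
      hence "length l - i \<le> ?c j"
        using card_mono[of "{k. k < length l \<and> l ! k \<le> j}" "{i..<length l}"] by simp
      thus False using i True by linarith
    next
      case False
      have "{k. k < length l \<and> l ! k \<le> j} \<subseteq> {Suc i..<length l}"
      proof
        fix k assume k: "k \<in> {k. k < length l \<and> l ! k \<le> j}"
        have "\<not> k \<le> i" using sl[of k i] k False i(1) by auto
        thus "k \<in> {Suc i..<length l}" using k by auto
      qed
      hence "?c j \<le> length l - Suc i" using card_mono[of "{Suc i..<length l}"] by fastforce
      thus False using i False by linarith
    qed
  qed
  show "(\<lambda>j. j + ?c j) ` {..<p} \<subseteq> {y. y < p + length l \<and> y \<notin> beta_set l}"
    using le not_beta_set by (auto intro: add_less_le_mono)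
  have "inj_on (\<lambda>j. j + ?c j) {..<p}"
    by (rule strict_mono_on_imp_inj_on) (auto simp: strict_mono_on_def intro!: add_less_le_mono
        mono)
  hence "card ((\<lambda>j. j + ?c j) ` {..<p}) = p" by (simp add: card_image)
  moreover have "{y. y < p + length l \<and> y \<notin> beta_set l} = {..<p + length l} - beta_set l" by auto
  moreover have "card ({..<p + length l} - beta_set l) = p"
  proof -
    have "beta_set l \<subseteq> {..<p + length l}" using beta_set_less[OF s] by auto
    thus ?thesis using s card_beta_set[of l] by (simp add: card_Diff_subset)
  qed
  ultimately show "card ((\<lambda>j. j + ?c j) ` {..<p}) = card {y. y < p + length l \<and> y \<notin> beta_set l}"
    by simp
qed simp

text \<open>Induction on rows: the hooks of the first row are the distances from the top bead to the
  gaps below it, and adding a bead above all others does not affect the condition on those already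
  present.\<close>

theorem is_core_iff_down_closed:
  "sorted_wrt (\<ge>) l \<Longrightarrow> is_core t l \<longleftrightarrow> down_closed t (beta_set l)"
proof (induction l)
  case Nil
  show ?case by (simp add: is_core_def down_closed_def)
next
  case (Cons p l)
  let ?x = "p + length l"
  have less: "x < ?x" if "x \<in> beta_set l" for x using beta_set_less[OF Cons.prems that] .
  have "(\<forall>j<p. \<not> t dvd hook_length (p # l) 0 j) \<longleftrightarrow>
     (\<forall>y\<in>(\<lambda>j. j + card {k. k < length l \<and> l ! k \<le> j}) ` {..<p}. \<not> t dvd ?x - y)"
    by (auto simp: hook_length_0)
  also have "\<dots> \<longleftrightarrow> (\<forall>y<?x. t dvd ?x - y \<longrightarrow> y \<in> beta_set l)"
    unfolding gaps_eq[OF Cons.prems] by auto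
  finally have "is_core t (p # l) \<longleftrightarrow> (\<forall>y<?x. t dvd ?x
      - y \<longrightarrow> y \<in> beta_set l) \<and> down_closed t (beta_set l)"
    using Cons by (simp add: is_core_Cons)
  also have "\<dots> \<longleftrightarrow> down_closed t (beta_set (p # l))"
  proof -
    have "y \<in> beta_set (p # l) \<longleftrightarrow> y \<in> beta_set l" if "y < ?x" for y using that by auto
    moreover have "y < ?x" if "x \<in> beta_set l" "y < x" for x y using less[OF that(1)] that(2)
      by simp
    ultimately show ?thesis unfolding down_closed_def by (simp add: Ball_def) blast
  qed
  finally show ?case .
qed

section \<open>Partitions as bead sets of fixed cardinality\<close>

definition pad_zeros :: "nat \<Rightarrow> nat list \<Rightarrow> nat list" where
  "pad_zeros N l = l @ replicate (N - length l) 0"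

lemma length_le_sum_list: "0 \<notin> set l \<Longrightarrow> length l \<le> sum_list (l :: nat list)"
  by (induction l) auto

lemma nth_append_zeros:
    "k < length l + m \<Longrightarrow> (l @ replicate m 0) ! k = (if k < length l then l ! k else 0)"
  by (auto simp: nth_append)

lemma is_core_append_zeros: "is_core t (l @ replicate m 0) \<longleftrightarrow> is_core t l"
proof -
  have h: "hook_length (l @ replicate m 0) i j = hook_length l i j" if "i < length l" for i j
  proof -
    have "{k. i < k \<and> k < length (l @ replicate m 0) \<and> j < (l @ replicate m 0) ! k} =
          {k. i < k \<and> k < length l \<and> j < l ! k}"
      by (auto simp: nth_append_zeros split: if_splits)
    thus ?thesis using that by (simp add: hook_length_def nth_append)
  qed
  show ?thesis unfolding is_core_def
  proof (intro iffI allI impI)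
    fix i j assume *: "\<forall>i<length (l @ replicate m 0). \<forall>j<(l @ replicate m 0) ! i. \<not> t dvd
        hook_length (l @ replicate m 0) i j"
      "i < length l" "j < l ! i"
    thus "\<not> t dvd hook_length l i j"
      using h[of i j] *(1)[rule_format, of i j] by (simp add: nth_append)
  next
    fix i j assume *: "\<forall>i<length l. \<forall>j<l ! i. \<not> t dvd hook_length l i j"
      "i < length (l @ replicate m 0)" "j < (l @ replicate m 0) ! i"
    have "i < length l" using *(2,3) by (auto simp: nth_append_zeros split: if_splits)
    thus "\<not> t dvd hook_length (l @ replicate m 0) i j" using * h[of i j] by (simp add: nth_append)
  qed
qed

lemma sorted_pad_zeros: "is_partition l \<Longrightarrow> sorted_wrt (\<ge>) (pad_zeros N l)"
proof -
  have "sorted_wrt (\<ge>) (replicate m (0 :: nat))" for m by (induction m) auto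
  thus "is_partition l \<Longrightarrow> sorted_wrt (\<ge>) (pad_zeros N l)"
    by (auto simp: is_partition_def pad_zeros_def sorted_wrt_append)
qed

lemma sorted_split_zeros:
  "sorted_wrt (\<ge>) l \<Longrightarrow> l = filter (\<lambda>x. x \<noteq> 0) l @ replicate (length l
      - length (filter (\<lambda>x. x \<noteq> 0) l)) (0 :: nat)"
proof (induction l)
  case (Cons p l)
  show ?case
  proof (cases "p = 0")
    case True
    hence "\<forall>x\<in>set l. x = 0" using Cons.prems by auto
    hence "filter (\<lambda>x. x \<noteq> 0) l = []" "l = replicate (length l) 0"
      by (auto simp: filter_empty_conv replicate_length_same)
    thus ?thesis using True by simp
  qed (use Cons in simp)
qed simp

text \<open>A partition of n has at most n parts, so N >= n beads suffice. The number subtracted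
  from the bead sum is that of the empty partition, whose beads fill the first N positions.\<close>

lemma bij_betw_partitions_beta_set:
  assumes "n \<le> N"
  shows "bij_betw (\<lambda>l. beta_set (pad_zeros N l)) {l. is_partition l \<and> is_core t l \<and> sum_list l = n}
           {X. finite X \<and> card X = N \<and> down_closed t X \<and> \<Sum>X = n + \<Sum>{..<N}}"
proof (rule bij_betwI')
  fix l l' assume l: "l \<in> {l. is_partition l \<and> is_core t l \<and> sum_list l = n}"
    and l': "l' \<in> {l. is_partition l \<and> is_core t l \<and> sum_list l = n}"
  have len: "length l \<le> N" "length l' \<le> N"
    using l l' assms length_le_sum_list[of l] length_le_sum_list[of l']
      by (auto simp: is_partition_def)
  show "(beta_set (pad_zeros N l) = beta_set (pad_zeros N l')) = (l = l')"
  proof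
    assume "beta_set (pad_zeros N l) = beta_set (pad_zeros N l')"
    hence "pad_zeros N l = pad_zeros N l'"
      using l l' len by (intro beta_set_inject sorted_pad_zeros) (auto simp: pad_zeros_def)
    hence "filter (\<lambda>x. x \<noteq> 0) (pad_zeros N l) = filter (\<lambda>x. x \<noteq> 0) (pad_zeros N l')" by simp
    moreover have "filter (\<lambda>x. x \<noteq> 0) l = l" "filter (\<lambda>x. x \<noteq> 0) l' = l'"
      using l l' by (auto simp: is_partition_def filter_id_conv) (metis gr0I)+
    ultimately show "l = l'" by (simp add: pad_zeros_def)
  qed simp
next
  fix l assume l: "l \<in> {l. is_partition l \<and> is_core t l \<and> sum_list l = n}"
  have len: "length l \<le> N"
    using l assms length_le_sum_list[of l] by (auto simp: is_partition_def)
  have s: "sorted_wrt (\<ge>) (pad_zeros N l)" using l by (auto intro: sorted_pad_zeros)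
  have "is_core t (pad_zeros N l)" using l by (simp add: pad_zeros_def is_core_append_zeros)
  moreover have "length (pad_zeros N l) = N" "sum_list (pad_zeros N l) = n" using len l
    by (auto simp: pad_zeros_def sum_list_replicate)
  ultimately show "beta_set (pad_zeros N l) \<in> {X. finite X \<and> card X = N \<and> down_closed t X \<and> \<Sum>X = n
      + \<Sum>{..<N}}"
    using is_core_iff_down_closed[OF s, of t] card_beta_set[OF s] sum_beta_set[OF s] by simp
next
  fix X assume X: "X \<in> {X. finite X \<and> card X = N \<and> down_closed t X \<and> \<Sum>X = n + \<Sum>{..<N}}"
  then obtain l' where l': "sorted_wrt (\<ge>) l'" "beta_set l' = X" "length l' = N"
    using beta_set_surj[of X] by auto
  define l where "l = filter (\<lambda>x. x \<noteq> 0) l'"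
  have "l' = pad_zeros N l" using sorted_split_zeros[OF l'(1)] l'(3)
    by (simp add: pad_zeros_def l_def)
  moreover have "is_core t l'" using is_core_iff_down_closed[OF l'(1), of t] X l'(2) by simp
  hence "is_core t l" using \<open>l' = pad_zeros N l\<close> by (simp add: pad_zeros_def is_core_append_zeros)
  moreover have "is_partition l" using l'(1)
    by (auto simp: is_partition_def l_def sorted_wrt_filter)
  moreover have "sum_list l = n"
  proof -
    have "sum_list l' = n" using sum_beta_set[OF l'(1)] X l' by simp
    thus ?thesis using \<open>l' = pad_zeros N l\<close> by (simp add: pad_zeros_def sum_list_replicate)
  qed
  ultimately show "\<exists>l\<in>{l. is_partition l \<and> is_core t l \<and> sum_list l = n}. X
      = beta_set (pad_zeros N l)"
    using l'(2) by blast
qed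

lemma A_core_1: "A_core t 1 n = card {l. is_partition l \<and> is_core t l \<and> sum_list l = n}"
proof -
  have "core_tuples t 1 n = (\<lambda>l. [l]) ` {l. is_partition l \<and> is_core t l \<and> sum_list l = n}"
    by (auto simp: core_tuples_def length_Suc_conv)
  thus ?thesis by (simp add: A_core_def card_image inj_on_def)
qed

section \<open>The generating function of 7-cores\<close>

text \<open>For a vector of sum 0 this is the size of the core whose runner k carries
  \<open>g k\<close> beads more than in the empty configuration.\<close>

definition energy :: "(nat \<Rightarrow> int) \<Rightarrow> int" where
  "energy g = (\<Sum>k<7. 7 * tri (g k) + int k * g k)"

text \<open>Extensional functions, so that each integer vector of length 7 is represented exactly
  once.\<close>

definition int7 :: "(nat \<Rightarrow> int) set" where
  "int7 = PiE {..<7} (\<lambda>_. UNIV)"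

lemma lessThan_7: "{..<7} = {0, 1, 2, 3, 4, 5, 6 :: nat}"
  by auto

lemma prod_powi:
  fixes q :: "'b :: field"
  assumes "q \<noteq> 0"
  shows "(\<Prod>k\<in>A. q powi f k) = q powi (\<Sum>k\<in>A. f k)"
  by (induction A rule: infinite_finite_induct) (auto simp: power_int_add assms)

lemma energy_term_nonneg:
  assumes "k < 7"
  shows "7 * tri m + int k * m \<ge> 0"
proof -
  have "2 * (7 * tri m + int k * m) = m * (7 * m - 7 + 2 * int k)"
    using two_tri[of m] by (simp add: algebra_simps)
  also have "\<dots> \<ge> 0"
    using assms by (cases "m \<ge> 1"; cases
        "m = 0") (auto intro!: mult_nonneg_nonneg mult_nonpos_nonpos)
  finally show ?thesis by simp
qed

lemma energy_nonneg: "energy g \<ge> 0"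
  unfolding energy_def by (intro sum_nonneg energy_term_nonneg) auto

text \<open>Energy grows quadratically, so a core of size n lacks at most n beads on any runner.
  Hence adding n to every coordinate yields genuine bead counts.\<close>

lemma energy_bound:
  assumes "energy g = int n" "k < 7"
  shows "g k + int n \<ge> 0"
proof (rule ccontr)
  assume "\<not> g k + int n \<ge> 0"
  define M where "M = - g k"
  have M: "M \<ge> int n + 1" using \<open>\<not> g k + int n \<ge> 0\<close> by (simp add: M_def)
  have "7 * tri (g k) + int k * g k \<le> energy g"
    unfolding energy_def using assms(2)
    by (intro member_le_sum[of k "{..<7}"
        "\<lambda>k. 7 * tri (g k) + int k * g k"] energy_term_nonneg) auto
  moreover have "2 * (7 * tri (g k) + int k * g k) = M * (7 * M + 7 - 2 * int k)"
    using two_tri[of "g k"] by (simp add: M_def algebra_simps)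
  moreover have "M * (7 * M + 7 - 2 * int k) \<ge> M * 2"
    using assms(2) M by (intro mult_left_mono) auto
  ultimately show False using assms(1) M by simp
qed

text \<open>Summability is extracted from a default value: \<open>infsum\<close> is 0 for a
  non-summable family, whereas for the norms it equals a product of positive sums. The hypothesis on
  \<open>f x 0\<close> provides the positivity.\<close>

lemma prod_PiE_has_sum:
  fixes f :: "nat \<Rightarrow> int \<Rightarrow> complex"
  assumes A: "finite A" and summ: "\<And>x. x \<in> A \<Longrightarrow> (\<lambda>n. norm (f x n)) summable_on UNIV" and nz:
      "\<And>x. x \<in> A \<Longrightarrow> f x 0 \<noteq> 0"
  shows "((\<lambda>g. \<Prod>x\<in>A. f x (g x)) has_sum (\<Prod>x\<in>A. infsum (f x) UNIV)) (PiE A (\<lambda>_. UNIV))"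
proof -
  have "infsum (\<lambda>g. \<Prod>x\<in>A. norm (f x (g x))) (PiE A (\<lambda>_. UNIV))
      = (\<Prod>x\<in>A. infsum (\<lambda>n. norm (f x n)) UNIV)"
    by (rule infsum_prod_PiE_abs) (use A summ in auto)
  also have "\<dots> \<noteq> 0"
  proof -
    have "infsum (\<lambda>n. norm (f x n)) UNIV > 0" if "x \<in> A" for x
    proof -
      have "norm (f x 0) \<le> infsum (\<lambda>n. norm (f x n)) UNIV"
        using finite_sum_le_infsum[OF summ[OF that], of "{0}"] by simp
      moreover have "norm (f x 0) > 0" using nz[OF that] by simp
      ultimately show ?thesis by linarith
    qed
    thus ?thesis using A by (auto simp: less_le)
  qed
  finally have "(\<lambda>g. \<Prod>x\<in>A. norm (f x (g x))) summable_on (PiE A (\<lambda>_. UNIV))"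
    using infsum_not_exists by blast
  hence "(\<lambda>g. norm (\<Prod>x\<in>A. f x (g x))) summable_on (PiE A (\<lambda>_. UNIV))"
    by (simp add: prod_norm)
  hence "(\<lambda>g. \<Prod>x\<in>A. f x (g x)) summable_on (PiE A (\<lambda>_. UNIV))"
    by (rule abs_summable_summable)
  moreover have "infsum (\<lambda>g. \<Prod>x\<in>A. f x (g x)) (PiE A (\<lambda>_. UNIV)) = (\<Prod>x\<in>A. infsum (f x) UNIV)"
    by (rule infsum_prod_PiE_abs[OF A summ])
  ultimately show ?thesis by (simp add: has_sum_iff)
qed

lemma int7_term:
  assumes "q \<noteq> 0" "z \<noteq> 0"
  shows "(\<Prod>k<7. theta_coeff (q ^ 7) (g k) * (z * q ^ k) powi g k) =
     (- 1) powi (\<Sum>k<7. g k) * q powi energy g * z powi (\<Sum>k<7. g k)"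
proof -
  have "theta_coeff (q ^ 7) (g k) * (z * q ^ k) powi g k = (- 1) powi g k * q powi (7 * tri (g k)
      + int k * g k) * z powi g k" for k
    using assms by (simp add: theta_coeff_def power_int_mult_distrib power_int_power power_int_add)
  thus ?thesis using assms by (simp only: prod.distrib energy_def) (simp add: prod_powi)
qed

text \<open>Apply the triple product to each factor. The arguments \<open>z * q ^ k\<close> to the
  base \<open>q ^ 7\<close> recombine to the base \<open>q\<close>, and so do the complementary ones
  after reversing k; only the Euler factors differ.\<close>

lemma theta_product:
  assumes q: "norm q < 1" "q \<noteq> 0" and z: "z \<noteq> 0" and Q: "Q = q ^ 7"
  shows "(\<Prod>k<7. theta Q (z * q ^ k)) = qpoch Q Q ^ 7 / qpoch q q * theta q z"
proof -
  have Q': "norm Q < 1" "Q \<noteq> 0" using q by (simp_all add: Q norm_power power_less_one_iff)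
  have "(\<Prod>k<7. theta Q (z * q ^ k)) = (\<Prod>k<7. qpoch Q Q * (qpoch (z * q ^ k) Q * qpoch (Q / (z * q ^
      k)) Q))"
    using q z by (intro prod.cong jacobi_triple_product Q') auto
  also have "\<dots> = qpoch Q Q ^ 7 * ((\<Prod>k<7. qpoch (z * q ^ k) Q) * (\<Prod>k<7. qpoch (Q / (z * q ^ k)) Q))"
    by (simp add: prod.distrib)
  also have "(\<Prod>k<7. qpoch (z * q ^ k) Q) = qpoch z q"
    unfolding Q by (rule qpoch_multisection[OF q(1), symmetric]) simp
  also have "(\<Prod>k<7. qpoch (Q / (z * q ^ k)) Q) = (\<Prod>k<7. qpoch (Q / (z * q ^ (7 - Suc k))) Q)"
    by (rule prod.nat_diff_reindex[symmetric])
  also have "\<dots> = (\<Prod>k<7. qpoch (q / z * q ^ k) Q)"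
  proof (rule prod.cong)
    fix k :: nat assume "k \<in> {..<7}"
    hence "Q = q ^ (7 - Suc k) * q ^ Suc k" by (simp add: Q flip: power_add power_Suc)
    thus "qpoch (Q / (z * q ^ (7 - Suc k))) Q = qpoch (q / z * q ^ k) Q" using q z
      by (simp add: field_simps)
  qed simp
  also have "\<dots> = qpoch (q / z) q"
    unfolding Q by (rule qpoch_multisection[OF q(1), symmetric]) simp
  finally show ?thesis
    using jacobi_triple_product[OF q z] qpoch_nonzero'[OF q(1) q(1)] by simp
qed

text \<open>The coefficient of \<open>z ^ N\<close> in the product of the seven theta series
  \<open>theta (q ^ 7) (z * q ^ k)\<close> obeys the recurrence of the coefficients of \<open>theta q z\<close>, so the ratio of both series is the constant term.\<close>

lemma int7_sum:
  assumes q: "norm q < 1" "q \<noteq> 0" and Q: "Q = q ^ 7"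
  shows "((\<lambda>g. q powi energy g) has_sum (qpoch Q Q ^ 7 / qpoch q q)) {g \<in> int7. (\<Sum>k<7. g k) = 0}"
proof -
  have Q': "norm Q < 1" "Q \<noteq> 0" using q by (simp_all add: Q norm_power power_less_one_iff)
  define w where "w g = (- 1) powi (\<Sum>k<7. g k) * q powi energy g" for g
  define L where "L N = {g \<in> int7. (\<Sum>k<7. g k) = N}" for N
  \<comment> \<open>Evaluation at one point is enough, since the coefficients \<open>c N\<close> are
    known up to the constant \<open>c 0\<close>. At z = -1 theta does not vanish, so it can be
    cancelled.\<close>
  have "((\<lambda>g. \<Prod>k<7. theta_coeff Q (g k) * (- 1 * q ^ k) powi g k)
      has_sum (\<Prod>k<7. infsum (\<lambda>n. theta_coeff Q n * (- 1 * q ^ k) powi n) UNIV)) int7"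
    unfolding int7_def
  proof (rule prod_PiE_has_sum)
    show "(\<lambda>n. norm (theta_coeff Q n * (- 1 * q ^ k) powi n)) summable_on UNIV" for k
      by (rule abs_summable_theta_coeff[OF Q']) (use q in simp)
  qed (auto simp: theta_coeff_def)
  also have "(\<lambda>g. \<Prod>k<7. theta_coeff Q (g k) * (- 1 * q ^ k) powi g k)
      = (\<lambda>g. w g * (- 1) powi (\<Sum>k<7. g k))"
    unfolding Q w_def by (rule ext, rule int7_term) (use q in auto)
  also have "(\<Prod>k<7. infsum (\<lambda>n. theta_coeff Q n * (- 1 * q ^ k) powi n) UNIV)
      = qpoch Q Q ^ 7 / qpoch q q * theta q (- 1)"
    using theta_product[OF q _ Q, of "- 1"] by (simp add: theta_def)
  finally have tot: "((\<lambda>g. w g * (- 1) powi (\<Sum>k<7. g k))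
      has_sum qpoch Q Q ^ 7 / qpoch q q * theta q (- 1)) int7" .
  have w_summ: "w summable_on L N" for N
  proof -
    have "(\<lambda>g. w g * (- 1) powi (\<Sum>k<7. g k)) summable_on L N"
      by (rule summable_on_subset[OF has_sum_imp_summable[OF tot]]) (auto simp: L_def)
    hence "(\<lambda>g. w g * (- 1) powi (\<Sum>k<7. g k) * (- 1) powi N) summable_on L N"
      by (rule summable_on_cmult_left)
    also have "?this \<longleftrightarrow> ?thesis"
      by (rule summable_on_cong) (auto simp: L_def)
    finally show ?thesis .
  qed
  define c where "c N = infsum w (L N)" for N
  have c_step: "c (N + 1) = - (q powi N) * c N" for N
  proof -
    \<comment> \<open>Rotating the coordinates, with one unit removed from the one that wraps
      around, is the lattice form of replacing z by q z: the energy changes by exactly N.\<close>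
    have "c (N + 1) = infsum (\<lambda>g. - (q powi N) * w g) (L N)"
      unfolding c_def
    proof (rule infsum_reindex_bij_witness[of _
        "\<lambda>g. \<lambda>k\<in>{..<7}. if k = 0 then g 6 + 1 else g (k - 1)"
        "\<lambda>g. \<lambda>k\<in>{..<7}. if k = 6 then g 0 - 1 else g (k + 1)"])
      fix g assume g: "g \<in> L (N + 1)"
      define h where "h = (\<lambda>k\<in>{..<7}. if k = 6 then g 0 - 1 else g (k + 1))"
      show "(\<lambda>k\<in>{..<7}. if k = 0 then h 6 + 1 else h (k - 1)) = g"
        using g by (auto simp: h_def L_def int7_def fun_eq_iff PiE_def extensional_def)
      have sum: "(\<Sum>k<7. h k) = N" using g by (simp add: h_def L_def lessThan_7 flip: numeral_2_eq_2)
      thus "h \<in> L N" by (auto simp: L_def int7_def h_def)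
      have "tri (g 0) = tri (g 0 - 1) + (g 0 - 1)" using tri_Suc[of "g 0 - 1"] by simp
      hence "energy g = energy h + N"
        unfolding sum[symmetric] by (simp add: energy_def h_def lessThan_7 flip: numeral_2_eq_2)
      moreover have "(\<Sum>k<7. g k) = N + 1" using g by (simp add: L_def)
      ultimately show "- (q powi N) * w h = w g"
        using q sum by (simp add: w_def power_int_add)
    next
      fix g assume g: "g \<in> L N"
      define h where "h = (\<lambda>k\<in>{..<7}. if k = 0 then g 6 + 1 else g (k - 1))"
      show "(\<lambda>k\<in>{..<7}. if k = 6 then h 0 - 1 else h (k + 1)) = g"
        using g by (auto simp: h_def L_def int7_def fun_eq_iff PiE_def extensional_def)
      have sum: "(\<Sum>k<7. h k) = N + 1" using g
        by (simp add: h_def L_def lessThan_7 flip: numeral_2_eq_2)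
      thus "h \<in> L (N + 1)" by (auto simp: L_def int7_def h_def)
    qed
    thus ?thesis by (simp only: infsum_cmult_right' c_def)
  qed
  have c_eq: "c N = c 0 * theta_coeff q N" for N
  proof (induction N rule: int_induct[of _ 0])
    case base
    show ?case by (simp add: theta_coeff_def)
  next
    case (step1 i)
    thus ?case using c_step[of i] theta_coeff_shift[OF q(2), of i] by simp
  next
    case (step2 i)
    have "- (q powi (i - 1)) * c (i - 1) = - (q powi (i - 1)) * (c 0 * theta_coeff q (i - 1))"
    proof -
      have "- (q powi (i - 1)) * c (i - 1) = c 0 * theta_coeff q i"
        using c_step[of "i - 1"] step2 by simp
      also have "theta_coeff q i = - (q powi (i - 1)) * theta_coeff q (i - 1)"
        using theta_coeff_shift[OF q(2), of "i - 1"] by simp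
      finally show ?thesis by (simp only: mult_ac)
    qed
    moreover have "- (q powi (i - 1)) \<noteq> 0" using q by simp
    ultimately show ?case by (simp only: mult_left_cancel simp_thms)
  qed
  have "((\<lambda>(N, g). w g * (- 1) powi N) has_sum qpoch Q Q ^ 7 / qpoch q q * theta q (- 1)) (SIGMA
      N:UNIV. L N)"
    using tot
    by (rule has_sum_reindex_bij_witness[of _ snd
        "\<lambda>g. (\<Sum>k<7. g k, g)", THEN iffD1, rotated -1]) (auto simp: L_def)
  hence "((\<lambda>N. c N * (- 1) powi N) has_sum qpoch Q Q ^ 7 / qpoch q q * theta q (- 1)) UNIV"
  proof (rule has_sum_SigmaD)
    fix N
    show "((\<lambda>g. case (N, g) of (N, g) \<Rightarrow> w g * (- 1) powi N) has_sum c N * (- 1) powi N) (L N)"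
      using has_sum_cmult_left[OF has_sum_infsum[OF w_summ]] by (simp add: c_def)
  qed
  hence 1: "((\<lambda>N. c 0 * (theta_coeff q N * (- 1) powi N))
      has_sum qpoch Q Q ^ 7 / qpoch q q * theta q (- 1)) UNIV"
    by (subst (asm) c_eq) (simp add: mult.assoc)
  have 2: "((\<lambda>N. c 0 * (theta_coeff q N * (- 1) powi N)) has_sum c 0 * theta q (- 1)) UNIV"
    by (intro has_sum_cmult_right theta_has_sum q) simp
  have "theta q (- 1) \<noteq> 0"
  proof -
    have "- (q ^ n) \<noteq> 1" for n
    proof (cases "n = 0")
      case False
      hence "norm (q ^ n) < 1" using q by (simp add: norm_power power_less_one_iff)
      thus ?thesis by (metis norm_minus_cancel norm_one order_less_irrefl)
    qed simp
    hence "qpoch (- 1) q \<noteq> 0" by (intro qpoch_nonzero q) simp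
    thus ?thesis using q by (simp add: jacobi_triple_product qpoch_nonzero')
  qed
  hence "qpoch Q Q ^ 7 / qpoch q q = c 0" using has_sum_unique[OF 1 2]
    by (simp only: mult_right_cancel simp_thms)
  hence "(w has_sum qpoch Q Q ^ 7 / qpoch q q) (L 0)" using has_sum_infsum[OF w_summ[of 0]]
    by (simp add: c_def)
  also have "?this \<longleftrightarrow> ?thesis"
    unfolding L_def by (intro has_sum_cong) (auto simp: w_def)
  finally show ?thesis .
qed

text \<open>The beads on runner \<open>k\<close> of the 7-abacus occupy the first \<open>c k\<close> positions.\<close>

definition runner :: "(nat \<Rightarrow> nat) \<Rightarrow> nat set" where
  "runner c = {x. x div 7 < c (x mod 7)}"

lemma runner_eq: "runner c = (\<Union>k<7. (\<lambda>j. 7 * j + k) ` {..<c k})"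
proof (intro equalityI subsetI)
  fix x assume "x \<in> runner c"
  moreover have "x = 7 * (x div 7) + x mod 7" "x mod 7 < 7" by auto
  ultimately show "x \<in> (\<Union>k<7. (\<lambda>j. 7 * j + k) ` {..<c k})"
    unfolding runner_def by blast
qed (auto simp: runner_def)

lemma finite_runner: "finite (runner c)"
  unfolding runner_eq by auto

lemma sum_runner: "sum f (runner c) = (\<Sum>k<7. \<Sum>j<c k. f (7 * j + k))"
proof -
  have "sum f (runner c) = (\<Sum>k<7. sum f ((\<lambda>j. 7 * j + k) ` {..<c k}))"
    unfolding runner_eq
  proof (rule sum.UNION_disjoint)
    show "\<forall>i\<in>{..<7}. \<forall>j\<in>{..<7}. i \<noteq> j \<longrightarrow> (\<lambda>x. 7 * x + i) ` {..<c i} \<inter> (\<lambda>x. 7 * x + j) ` {..<c j}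
        = {}"
    proof (intro ballI impI)
      fix i j :: nat assume ij: "i \<in> {..<7}" "j \<in> {..<7}" "i \<noteq> j"
      have "7 * x + i \<noteq> 7 * y + j" for x y using ij by simp presburger
      thus "(\<lambda>x. 7 * x + i) ` {..<c i} \<inter> (\<lambda>x. 7 * x + j) ` {..<c j} = {}" by blast
    qed
  qed auto
  also have "\<dots> = (\<Sum>k<7. \<Sum>j<c k. f (7 * j + k))"
  proof (rule sum.cong)
    show "sum f ((\<lambda>j. 7 * j + k) ` {..<c k}) = (\<Sum>j<c k. f (7 * j + k))" for k
      by (subst sum.reindex) (auto simp: inj_on_def)
  qed simp
  finally show ?thesis .
qed

lemma card_runner: "card (runner c) = (\<Sum>k<7. c k)"
  by (simp only: card_eq_sum sum_runner) simp

lemma down_closed_runner: "down_closed 7 (runner c)"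
  unfolding down_closed_def runner_def
proof safe
  fix x y :: nat assume *: "x div 7 < c (x mod 7)" "y < x" "7 dvd x - y"
  have "x mod 7 = y mod 7" using *(2,3) by (simp add: mod_eq_dvd_iff_nat)
  moreover have "y div 7 \<le> x div 7" using *(2) by (simp add: div_le_mono)
  ultimately show "y div 7 < c (y mod 7)" using *(1) by simp
qed

lemma down_closed_imp_runner:
  assumes "finite X" "down_closed 7 X"
  shows "X = runner (\<lambda>k. card {j. 7 * j + k \<in> X})"
proof -
  have J: "{j. 7 * j + k \<in> X} = {..<card {j. 7 * j + k \<in> X}}" for k
  proof (rule card_subset_eq)
    let ?J = "{j. 7 * j + k \<in> X}"
    have fin: "finite ?J"
    proof (rule finite_subset)
      show "?J \<subseteq> {..Max X}"
      proof
        fix j assume "j \<in> ?J"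
        hence "7 * j + k \<le> Max X" using Max_ge[OF assms(1)] by blast
        thus "j \<in> {..Max X}" by simp
      qed
    qed simp
    show "?J \<subseteq> {..<card ?J}"
    proof
      fix j assume j: "j \<in> ?J"
      have "{..j} \<subseteq> ?J"
      proof
        fix i assume "i \<in> {..j}"
        show "i \<in> ?J"
        proof (cases "i = j")
          case False
          hence "7 * i + k < 7 * j + k" "7 dvd (7 * j + k) - (7 * i + k)"
            using \<open>i \<in> {..j}\<close> by (auto simp flip: diff_mult_distrib2)
          thus ?thesis using assms(2) j unfolding down_closed_def by blast
        qed (use j in simp)
      qed
      hence "card {..j} \<le> card ?J" by (intro card_mono fin)
      thus "j \<in> {..<card ?J}" by simp
    qed
  qed auto
  have "x \<in> X \<longleftrightarrow> x div 7 \<in> {j. 7 * j + x mod 7 \<in> X}" for x by simp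
  thus ?thesis unfolding runner_def using J by blast
qed

lemma sum_progression: "int (\<Sum>j<c. 7 * j + k) = 7 * tri (int c) + int k * int c"
proof (induction c)
  case (Suc c)
  thus ?case using tri_Suc[of "int c"] by (simp add: algebra_simps)
qed simp

lemma sum_lessThan_tri: "int (\<Sum>{..<N}) = tri (int N)"
proof (induction N)
  case (Suc N)
  thus ?case using tri_Suc[of "int N"] by (simp add: algebra_simps)
qed simp

text \<open>Adding n to each coordinate creates a cross term 7 n times the sum of \<open>g\<close>,
  which is 0, and the constant 49 tri(n) + 21 n = tri(7n), the bead sum of the empty
  partition.\<close>

lemma runner_sums:
  assumes "(\<Sum>k<7. g k) = 0" "\<And>k. k < 7 \<Longrightarrow> g k + int n \<ge> 0"
  shows "card (runner (\<lambda>k. nat (g k + int n))) = 7 * n"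
    "int (\<Sum>(runner (\<lambda>k. nat (g k + int n)))) = energy g + int (\<Sum>{..<7 * n})"
proof -
  have "int (card (runner (\<lambda>k. nat (g k + int n)))) = (\<Sum>k<7. g k + int n)"
    using assms(2) unfolding card_runner of_nat_sum by (intro sum.cong) auto
  also have "\<dots> = 7 * int n" using assms(1) by (simp add: sum.distrib)
  finally show "card (runner (\<lambda>k. nat (g k + int n))) = 7 * n" by simp
  have "int (\<Sum>(runner (\<lambda>k. nat (g k + int n)))) = (\<Sum>k<7. 7 * tri (g k + int n) + int k * (g k
      + int n))"
    using assms(2) unfolding sum_runner of_nat_sum[of _ "{..<7}"] sum_progression
      by (intro sum.cong) auto
  also have "\<dots> = (\<Sum>k<7. (7 * tri (g k) + int k * g k) + 7 * int n * g k + (7 * tri (int n)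
      + int k * int n))"
  proof (rule sum.cong)
    fix k
    have "tri (g k + int n) = tri (g k) + int n * g k + tri (int n)"
      using two_tri[of "g k + int n"] two_tri[of "g k"] two_tri[of "int n"]
        by (simp add: algebra_simps)
    thus "7 * tri (g k + int n) + int k * (g k + int n) =
      (7 * tri (g k) + int k * g k) + 7 * int n * g k + (7 * tri (int n) + int k * int n)"
      by (simp add: algebra_simps)
  qed simp
  also have "\<dots> = energy g + (49 * tri (int n) + 21 * int n)"
    using assms(1) by (simp add: sum.distrib energy_def flip: sum_distrib_left sum_distrib_right)
        (simp add: lessThan_7)
  also have "49 * tri (int n) + 21 * int n = int (\<Sum>{..<7 * n})"
    unfolding sum_lessThan_tri using two_tri[of "int n"] two_tri[of "int (7 * n)"]
      by (simp add: algebra_simps)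
  finally show "int (\<Sum>(runner (\<lambda>k. nat (g k + int n)))) = energy g + int (\<Sum>{..<7 * n})" .
qed

lemma runner_inject:
  assumes "runner c = runner c'" "k < 7"
  shows "c k = c' k"
proof -
  have "{j. 7 * j + k \<in> runner c} = {..<c k}" for c
    using assms(2) by (auto simp: runner_def)
  thus ?thesis using assms(1) by (metis lessThan_eq_iff)
qed

text \<open>Cores of size n are modelled with 7n beads, n per runner on average;
  \<open>energy_bound\<close> ensures that \<open>nat\<close> truncates nothing.\<close>

lemma bij_betw_int7_runner:
  "bij_betw (\<lambda>g. runner (\<lambda>k. nat (g k + int n))) {g \<in> int7. (\<Sum>k<7. g k) = 0 \<and> energy g = int n}
     {X. finite X \<and> card X = 7 * n \<and> down_closed 7 X \<and> \<Sum>X = n + \<Sum>{..<7 * n}}"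
proof (rule bij_betwI')
  fix g g' assume g: "g \<in> {g \<in> int7. (\<Sum>k<7. g k) = 0 \<and> energy g = int n}"
    and g': "g' \<in> {g \<in> int7. (\<Sum>k<7. g k) = 0 \<and> energy g = int n}"
  show "(runner (\<lambda>k. nat (g k + int n)) = runner (\<lambda>k. nat (g' k + int n))) = (g = g')"
  proof
    assume eq: "runner (\<lambda>k. nat (g k + int n)) = runner (\<lambda>k. nat (g' k + int n))"
    have "g k = g' k" if "k < 7" for k
      using runner_inject[OF eq that] energy_bound[OF _ that, of g n] energy_bound[OF _ that, of g'
          n] g g' by auto
    thus "g = g'" using g g' by (intro PiE_ext[of g "{..<7}" "\<lambda>_. UNIV" g']) (auto simp: int7_def)
  qed simp
next
  fix g assume g: "g \<in> {g \<in> int7. (\<Sum>k<7. g k) = 0 \<and> energy g = int n}"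
  have "int (\<Sum>(runner (\<lambda>k. nat (g k + int n)))) = int (n + \<Sum>{..<7 * n})"
    using runner_sums(2)[of g n] g energy_bound[of g n] by auto
  thus "runner (\<lambda>k. nat (g k + int n)) \<in> {X. finite X \<and> card X = 7 * n \<and> down_closed 7 X \<and> \<Sum>X = n
      + \<Sum>{..<7 * n}}"
    using runner_sums(1)[of g n] g energy_bound[of g n] finite_runner down_closed_runner
      by (auto simp only: of_nat_eq_iff mem_Collect_eq simp_thms)
next
  fix X assume X: "X \<in> {X. finite X \<and> card X = 7 * n \<and> down_closed 7 X \<and> \<Sum>X = n + \<Sum>{..<7 * n}}"
  define c where "c k = card {j. 7 * j + k \<in> X}" for k
  have Xc: "X = runner c" using down_closed_imp_runner[of X] X by (simp add: c_def[abs_def])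
  define g where "g = (\<lambda>k\<in>{..<7}. int (c k) - int n)"
  have Xg: "runner (\<lambda>k. nat (g k + int n)) = X"
    unfolding Xc runner_def by (auto simp: g_def)
  have s0: "(\<Sum>k<7. g k) = 0"
  proof -
    have "(\<Sum>k<7. g k) = (\<Sum>k<7. int (c k) - int n)" by (intro sum.cong) (auto simp: g_def)
    also have "\<dots> = int (card X) - 7 * int n" by (simp add: Xc card_runner sum_subtractf)
    finally show ?thesis using X by simp
  qed
  have "g k + int n \<ge> 0" if "k < 7" for k using that by (simp add: g_def)
  from runner_sums(2)[OF s0 this] have "int (\<Sum>X) = energy g + int (\<Sum>{..<7 * n})" unfolding Xg .
  moreover have "\<Sum>X = n + \<Sum>{..<7 * n}" using X by simp
  ultimately have "energy g = int n" by linarith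
  moreover have "g \<in> int7" by (simp add: g_def int7_def)
  ultimately show "\<exists>g\<in>{g \<in> int7. (\<Sum>k<7. g k) = 0 \<and> energy g = int n}. X = runner (\<lambda>k. nat (g k
      + int n))"
    using s0 Xg by blast
qed

lemma card_int7:
  "finite {g \<in> int7. (\<Sum>k<7. g k) = 0 \<and> energy g = int n}"
  "card {g \<in> int7. (\<Sum>k<7. g k) = 0 \<and> energy g = int n} = A_core 7 1 n"
proof -
  note b1 = bij_betw_int7_runner[of n] and b2 = bij_betw_partitions_beta_set[of n "7 * n" 7]
  have "finite {l. is_partition l \<and> is_core 7 l \<and> sum_list l = n}"
  proof -
    have "(\<lambda>l. [l]) ` {l. is_partition l \<and> is_core 7 l \<and> sum_list l = n} \<subseteq> core_tuples 7 1 n"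
      by (auto simp: core_tuples_def)
    from finite_subset[OF this finite_core_tuples] show ?thesis
      by (rule finite_imageD) (auto simp: inj_on_def)
  qed
  thus "finite {g \<in> int7. (\<Sum>k<7. g k) = 0 \<and> energy g = int n}"
    using bij_betw_finite[OF b1] bij_betw_finite[OF b2] by simp
  show "card {g \<in> int7. (\<Sum>k<7. g k) = 0 \<and> energy g = int n} = A_core 7 1 n"
    using bij_betw_same_card[OF b1] bij_betw_same_card[OF b2] by (simp only: A_core_1)
qed

theorem core_generating_function:
  assumes q: "norm q < 1" "q \<noteq> 0" and Q: "Q = q ^ 7"
  shows "((\<lambda>n. of_nat (A_core 7 1 n) * q ^ n) has_sum (qpoch Q Q ^ 7 / qpoch q q)) UNIV"
proof -
  let ?L = "\<lambda>n. {g \<in> int7. (\<Sum>k<7. g k) = 0 \<and> energy g = int n}"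
  have "((\<lambda>(n, g). q ^ n) has_sum (qpoch Q Q ^ 7 / qpoch q q)) (SIGMA n:UNIV. ?L n)"
    using int7_sum[OF q Q]
    by (rule has_sum_reindex_bij_witness[of _ snd
        "\<lambda>g. (nat (energy g), g)", THEN iffD1, rotated -1])
       (auto simp: energy_nonneg power_int_nonneg_exp)
  thus ?thesis
  proof (rule has_sum_SigmaD)
    fix n
    have "((\<lambda>g. q ^ n) has_sum (\<Sum>g\<in>?L n. q ^ n)) (?L n)"
      by (rule has_sum_finite[OF card_int7(1)])
    thus "((\<lambda>g. case (n, g) of (n, g) \<Rightarrow> q ^ n) has_sum of_nat (A_core 7 1 n) * q ^ n) (?L n)"
      using card_int7(2)[of n] by simp
  qed
qed

section \<open>Comparison of coefficients\<close>

lemma eta_product: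
  assumes "Im \<tau> > 0" "q = qexp \<tau>" "Q = q ^ 7"
  shows "dedekind_eta \<tau> ^ 3 * dedekind_eta (7 * \<tau>) ^ 3 = q * qpoch q q ^ 3 * qpoch Q Q ^ 3"
proof -
  have eta: "dedekind_eta t = exp (2 * of_real pi * \<i> * t / 24) * qpoch (qexp t) (qexp t)" for t
    by (simp add: dedekind_eta_def qpoch_def)
  have "qexp (7 * \<tau>) = Q"
    unfolding assms qexp_def by (simp flip: exp_of_nat_mult add: mult_ac)
  \<comment> \<open>The fractional powers combine to an integral one: (3 + 21) / 24 = 1.\<close>
  moreover have "exp (2 * of_real pi * \<i> * \<tau> / 24) ^ 3 * exp (2 * of_real pi * \<i> * (7 * \<tau>) / 24) ^ 3
      = q"
    unfolding assms qexp_def by (simp flip: exp_of_nat_mult exp_add) (simp add: field_simps)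
  ultimately show ?thesis by (simp add: eta power_mult_distrib assms(2)[symmetric])
qed

text \<open>The expansion is assumed on the upper half plane; this transfers it to every point of
  the punctured disc.\<close>

lemma qexp_surj:
  assumes "norm q < 1" "q \<noteq> 0"
  obtains \<tau> where "Im \<tau> > 0" "qexp \<tau> = q"
proof (rule that)
  define \<tau> where "\<tau> = Ln q / (2 * of_real pi * \<i>)"
  show "qexp \<tau> = q" using assms by (simp add: \<tau>_def qexp_def)
  have "norm (qexp \<tau>) < 1" using \<open>qexp \<tau> = q\<close> assms by simp
  thus "Im \<tau> > 0" by (simp add: qexp_def norm_exp_eq_Re zero_less_mult_iff)
qed

lemma powser_eq_0:
  fixes b :: "nat \<Rightarrow> complex"
  assumes "\<And>q. norm q < 1 \<Longrightarrow> q \<noteq> 0 \<Longrightarrow> (\<lambda>n. b n * q ^ n) sums 0" and "b 0 = 0"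
  shows "b n = 0"
proof -
  have s: "(\<lambda>n. b n * q ^ n) sums 0" if "norm q < 1" for q
  proof (cases "q = 0")
    case True
    have "(\<lambda>n. b n * 0 ^ n) sums b 0" by (rule powser_sums_zero)
    thus ?thesis using True assms(2) by simp
  qed (use assms(1) that in auto)
  have "Abs_fps b = 0"
  proof (rule eval_fps_eqD)
    have "summable (\<lambda>n. b n * (1 / 2) ^ n)" using s[of "1 / 2"] by (auto simp: sums_iff norm_divide)
    from conv_radius_geI[OF this] show "fps_conv_radius (Abs_fps b) > 0"
      by (auto simp: fps_conv_radius_def norm_divide intro: less_le_trans[rotated])
    have "eventually (\<lambda>q. q \<in> ball 0 1) (nhds (0 :: complex))"
      by (intro eventually_nhds_in_open) auto
    thus "eventually (\<lambda>q. eval_fps (Abs_fps b) q = eval_fps 0 q) (nhds 0)"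
      by eventually_elim (use s in \<open>auto simp: eval_fps_def sums_iff\<close>)
  qed simp
  thus ?thesis by (metis fps_nth_Abs_fps fps_zero_nth)
qed

theorem theorem6p1:
  fixes a :: "nat \<Rightarrow> complex"
  assumes "\<And>\<tau>. Im \<tau> > 0 \<Longrightarrow>
    ((\<lambda>n. a n * qexp \<tau> ^ n) has_sum (dedekind_eta \<tau> ^ 3 * dedekind_eta (7 * \<tau>) ^ 3)) {1..}"
  shows "\<forall>n. of_nat (A_core 7 1 n) = 1 / 8 * (of_int (sigma_star 2 chi74 (n + 2)) - a (n + 2))"
proof
  fix n
  \<comment> \<open>The shift by 2 comes from the factor 8 q^2 of \<open>eisenstein_product\<close>.
    In \<open>b\<close> the index 0 is set to 0 because \<open>a 0\<close> is left open by an
    expansion that starts at 1.\<close>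
  define A where "A m = (if m \<ge> 2 then 8 * of_nat (A_core 7 1 (m - 2)) else 0 :: complex)" for m
  define b where "b m = (if m = 0 then 0 else of_int (sigma_star 2 chi74 m) - A m - a m)" for m
  have "b (n + 2) = 0"
  proof (rule powser_eq_0)
    fix q :: complex assume q: "norm q < 1" "q \<noteq> 0"
    obtain \<tau> where \<tau>: "Im \<tau> > 0" "qexp \<tau> = q" using qexp_surj[OF q] by blast
    define Q where "Q = q ^ 7"
    have 1: "((\<lambda>n. a n * q ^ n) has_sum (q * qpoch q q ^ 3 * qpoch Q Q ^ 3)) {1..}"
      using assms[OF \<tau>(1)] eta_product[OF \<tau>(1) \<tau>(2)[symmetric] Q_def] \<tau>(2) by simp
    have "((\<lambda>m. 8 * q ^ 2 * (of_nat (A_core 7 1 m) * q ^ m))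
        has_sum (8 * q ^ 2 * (qpoch Q Q ^ 7 / qpoch q q))) UNIV"
      by (intro has_sum_cmult_right core_generating_function q Q_def)
    also have "?this \<longleftrightarrow> ((\<lambda>m. A m * q ^ m) has_sum (8 * q ^ 2 * (qpoch Q Q ^ 7 / qpoch q q))) {2..}"
      by (rule has_sum_reindex_bij_witness[of _ "\<lambda>m. m - 2"
          "\<lambda>m. m + 2"]) (auto simp: A_def power_add power2_eq_square)
    also have "\<dots> \<longleftrightarrow> ((\<lambda>m. A m * q ^ m) has_sum (8 * q ^ 2 * (qpoch Q Q ^ 7 / qpoch q q))) {1..}"
      by (rule has_sum_cong_neutral) (auto simp: A_def)
    finally have 2: "((\<lambda>m. A m * q ^ m) has_sum (8 * q ^ 2 * (qpoch Q Q ^ 7 / qpoch q q))) {1..}" .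
    have 3: "((\<lambda>m. of_int (sigma_star 2 chi74 m) * q ^ m) has_sum
        (8 * q ^ 2 * (qpoch Q Q ^ 7 / qpoch q q) + q * qpoch q q ^ 3 * qpoch Q Q ^ 3)) {1..}"
      using sigma_star_lambert[OF q(1) Q_def] eisenstein_product[OF q Q_def] by simp
    from has_sum_add[OF has_sum_add[OF 3 has_sum_uminusI[OF 2]] has_sum_uminusI[OF 1]]
    have "((\<lambda>m. of_int (sigma_star 2 chi74 m) * q ^ m + - (A m * q ^ m) + - (a m * q ^ m))
        has_sum 0) {1..}"
      by simp
    also have "?this \<longleftrightarrow> ((\<lambda>m. b m * q ^ m) has_sum 0) UNIV"
      by (rule has_sum_cong_neutral) (auto simp: b_def algebra_simps)
    finally show "(\<lambda>m. b m * q ^ m) sums 0" by (rule has_sum_imp_sums)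
  qed (simp add: b_def)
  thus "of_nat (A_core 7 1 n) = 1 / 8 * (of_int (sigma_star 2 chi74 (n + 2)) - a (n + 2))"
    by (simp add: b_def A_def field_simps)
qed

end
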